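(* Let $p\geq 2$ be an integer and let $v=(v_k)_{k\geq 1}$ be a real sequence with only finitely many, and at least one, non-zero terms, such that $v_k=0$ for any even $k$ (resp., for any odd $k$). Put $k_v:=\min\{k:v_k\neq 0\}$ and $K_v:=\max\{k:v_k\neq 0\}$. Let $f$ be an angular function that is $q$ times differentiable at zero, where $q\geq K_v$ is an integer, and such that $f^{(k)}(0)=0$ for any odd (resp., even) $k$ in $\{k_v,\ldots,q\}$. Let $\tau>0$. Then, under $\mathrm{P}^{(n)}_{\kappa_n,f}$ with $\kappa_n=n^{-1/(2q)}\tau$, as $n\to\infty$, $S_v^{(n)}$ converges in distribution to $\sum_{k=1}^{K_v}v_k^2\chi^2_{d_{p,k}}$.
   Context: $\mathcal{S}^{p-1}$ is the unit sphere of $\mathbb{R}^p$ and $\theta_0:=(0,\ldots,0,1)'\in\mathbb{R}^p$. An angular function is a (Borel measurable) function $f:\mathbb{R}\to[0,\infty)$ with $f(0)=1$; $f^{(k)}$ denotes its $k$th derivative. For $\kappa_n>0$, $\mathrm{P}^{(n)}_{\kappa_n,f}$ is the hypothesis under which $U_1,\ldots,U_n$ are i.i.d. on $\mathcal{S}^{p-1}$ with density, with respect to the surface area measure, proportional to $u\mapsto f(\kappa_n u'\theta_0)$. (This is well defined as soon as the integral of this function is finite and positive, hence for all large $n$ when $\kappa_n\to0$ and $f$ is continuous at zero.) $C_q^{0}$ is the Chebyshev polynomial of the first kind, $C_q^0(\cos\theta)=\cos(q\theta)$; for $\lambda>0$, $C_q^\lambda(t)=\sum_{j=0}^{\lfloor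 q/2\rfloor}(-1)^j\frac{2^{q-2j}\Gamma(q-j+\lambda)}{\Gamma(\lambda)j!(q-2j)!}t^{q-2j}$ is the Gegenbauer polynomial. $d_{p,k}=\binom{p+k-3}{p-2}+\binom{p+k-2}{p-2}$ for $k\ge1$ (so $d_{2,k}=2$). Sobolev statistic: $S_v^{(n)}:=\frac1n\sum_{i,j=1}^n\sum_{k=1}^\infty v_k^2h_{p,k}(U_i'U_j)$, where $h_{p,k}(s):=2C_k^0(s)$ if $p=2$ and $h_{p,k}(s):=(1+\frac{2k}{p-2})C_k^{(p-2)/2}(s)$ if $p\geq3$. $\sum_k w_k\chi^2_{d_k}$ denotes the law of the weighted sum of mutually independent chi-square random variables with $d_k$ degrees of freedom. *)

theory Defs
  imports "HOL-Probability.Probability"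
begin

section \<open>The unit sphere and its surface area measure\<close>

text \<open>The vector \<open>(0, \<dots>, 0, 1)\<close>: coordinates are ordered by the linear order of the index type.\<close>

definition north_pole :: "real ^ 'p::{finite,linorder}" where
  "north_pole = axis (Max UNIV) 1"

text \<open>
  The surface area of a Borel subset \<open>A\<close> of the unit sphere is the dimension times the Lebesgue
  measure of the cone \<open>{x. 0 < norm x \<le> 1 \<and> x /\<^sub>R norm x \<in> A}\<close> over \<open>A\<close>.
\<close>

definition surface_measure :: "'a::euclidean_space measure" where
  "surface_measure =
     scale_measure (ennreal (real DIM('a)))
       (distr (restrict_space lborel (cball 0 1 - {0})) (restrict_space borel (sphere 0 1))
          (\<lambda>x. x /\<^sub>R norm x))"

lemma emeasure_surface_measure:
  fixes A :: "'a::euclidean_space set"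
  assumes A: "A \<in> sets borel" "A \<subseteq> sphere 0 1"
  shows "emeasure surface_measure A =
    ennreal (real DIM('a)) * emeasure lborel {x. 0 < norm x \<and> norm x \<le> 1 \<and> x /\<^sub>R norm x \<in> A}"
proof -
  let ?B = "cball 0 1 - {0} :: 'a set"
  have meas: "(\<lambda>x::'a. x /\<^sub>R norm x) \<in>
      restrict_space lborel ?B \<rightarrow>\<^sub>M restrict_space borel (sphere 0 1)"
    by (intro measurable_restrict_space2 measurable_restrict_space1)
       (auto simp: space_restrict_space)
  have sets_A: "A \<in> sets (restrict_space borel (sphere 0 1))"
    using A by (auto simp: sets_restrict_space_iff)
  have eq: "(\<lambda>x::'a. x /\<^sub>R norm x) -` A \<inter> space (restrict_space lborel ?B) =
      {x. 0 < norm x \<and> norm x \<le> 1 \<and> x /\<^sub>R norm x \<in> A}"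
    by (auto simp: space_restrict_space)
  have "emeasure surface_measure A = ennreal (real DIM('a)) *
      emeasure (restrict_space lborel ?B) {x. 0 < norm x \<and> norm x \<le> 1 \<and> x /\<^sub>R norm x \<in> A}"
    unfolding surface_measure_def by (simp only: emeasure_scale_measure emeasure_distr[OF meas sets_A] eq)
  also have "emeasure (restrict_space lborel ?B) {x. 0 < norm x \<and> norm x \<le> 1 \<and> x /\<^sub>R norm x \<in> A} =
      emeasure lborel {x. 0 < norm x \<and> norm x \<le> 1 \<and> x /\<^sub>R norm x \<in> A}"
    by (rule emeasure_restrict_space) auto
  finally show ?thesis .
qed

section \<open>Angular functions and the rotationally symmetric model\<close>

definition angular_function :: "(real \<Rightarrow> real) \<Rightarrow> bool" where
  "angular_function f \<longleftrightarrow> f \<in> borel_measurable borel \<and> (\<forall>x. 0 \<le> f x) \<and> f 0 = 1"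

definition times_differentiable_at :: "nat \<Rightarrow> (real \<Rightarrow> real) \<Rightarrow> real \<Rightarrow> bool" where
  "times_differentiable_at q f x \<longleftrightarrow>
     (\<forall>k. Suc k < q \<longrightarrow> (\<forall>\<^sub>F y in nhds x. (deriv ^^ k) f differentiable (at y))) \<and>
     (0 < q \<longrightarrow> (deriv ^^ (q - 1)) f differentiable (at x))"

text \<open>
  The hypothesis that \<open>U 1, \<dots>, U n\<close>, defined on the probability space \<open>M\<close>, are i.i.d. on the
  sphere with density proportional to \<open>u \<mapsto> f (\<kappa> * (u \<bullet> north_pole))\<close>. The value \<open>c\<close> is
  necessarily the inverse of the integral of that function, since \<open>M\<close> is a probability space.
\<close>

definition rotsym_sample ::
    "'a measure \<Rightarrow> nat \<Rightarrow> (nat \<Rightarrow> 'a \<Rightarrow> real ^ 'p::{finite,linorder}) \<Rightarrow> real \<Rightarrow> (real \<Rightarrow> real) \<Rightarrow> bool"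
  where
  "rotsym_sample M n U \<kappa> f \<longleftrightarrow>
     prob_space M \<and>
     prob_space.indep_vars M (\<lambda>_. surface_measure) U {1..n} \<and>
     (\<exists>c>0. \<forall>i\<in>{1..n}. distributed M surface_measure (U i)
        (\<lambda>u. ennreal (c * f (\<kappa> * (u \<bullet> north_pole)))))"

section \<open>Sobolev statistics\<close>

fun chebyshev :: "nat \<Rightarrow> real \<Rightarrow> real" where
  "chebyshev 0 t = 1"
| "chebyshev (Suc 0) t = t"
| "chebyshev (Suc (Suc k)) t = 2 * t * chebyshev (Suc k) t - chebyshev k t"

lemma chebyshev_cos: "chebyshev k (cos \<theta>) = cos (real k * \<theta>)"
proof (induction k "cos \<theta>" rule: chebyshev.induct)
  case (3 k)
  have "cos (real (Suc (Suc k)) * \<theta>) + cos (real k * \<theta>) = 2 * cos \<theta> * cos (real (Suc k) * \<theta>)"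
    using cos_add[of "real (Suc k) * \<theta>" \<theta>] cos_diff[of "real (Suc k) * \<theta>" \<theta>]
    by (simp add: algebra_simps)
  with 3 show ?case by simp
qed simp_all

definition gegenbauer :: "real \<Rightarrow> nat \<Rightarrow> real \<Rightarrow> real" where
  "gegenbauer a k t =
     (\<Sum>j = 0..k div 2. (-1) ^ j *
        (2 ^ (k - 2 * j) * Gamma (real k - real j + a) / (Gamma a * fact j * fact (k - 2 * j))) *
        t ^ (k - 2 * j))"

definition sobolev_kernel :: "nat \<Rightarrow> nat \<Rightarrow> real \<Rightarrow> real" where
  "sobolev_kernel p k s =
     (if p = 2 then 2 * chebyshev k s
      else (1 + 2 * real k / (real p - 2)) * gegenbauer ((real p - 2) / 2) k s)"

definition harmonic_dim :: "nat \<Rightarrow> nat \<Rightarrow> nat" where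
  "harmonic_dim p k = ((p + k - 3) choose (p - 2)) + ((p + k - 2) choose (p - 2))"

text \<open>The series starts at \<open>k = 1\<close>; the value \<open>v 0\<close> plays no role.\<close>

definition sobolev_stat ::
    "(nat \<Rightarrow> real) \<Rightarrow> nat \<Rightarrow> (nat \<Rightarrow> 'a \<Rightarrow> real ^ 'p::finite) \<Rightarrow> 'a \<Rightarrow> real" where
  "sobolev_stat v n U \<omega> =
     1 / real n * (\<Sum>i\<in>{1..n}. \<Sum>j\<in>{1..n}.
       (\<Sum>k. (v (Suc k))\<^sup>2 * sobolev_kernel CARD('p) (Suc k) (U i \<omega> \<bullet> U j \<omega>)))"

section \<open>Weighted sums of independent chi-square variables\<close>

definition chi_square :: "nat \<Rightarrow> real measure" where
  "chi_square d =
     distr (\<Pi>\<^sub>M i\<in>{1..d}. density lborel std_normal_density) borel (\<lambda>z. \<Sum>i\<in>{1..d}. (z i)\<^sup>2)"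

definition weighted_chi_square :: "nat set \<Rightarrow> (nat \<Rightarrow> real) \<Rightarrow> (nat \<Rightarrow> nat) \<Rightarrow> real measure" where
  "weighted_chi_square I w d =
     distr (\<Pi>\<^sub>M k\<in>I. chi_square (d k)) borel (\<lambda>x. \<Sum>k\<in>I. w k * x k)"

end

(*
  The kernel h_k(s) is the reproducing kernel of the spherical harmonics of degree k: writing
  B(P, Q)(u . w) for the mean of P(u . x) Q(w . x) over the sphere, the operator
  L = (1 - x^2) D^2 - (p - 1) x D satisfies B(L P, Q) = B(x P', x Q') - (u . w) B(P', Q'), which is
  symmetric in P and Q, so the eigenfunctions h_k, h_l of L are orthogonal, and P = Q = h_k gives
  B(h_k, h_k) = h_k by induction on k.  Hence h_k(u . w) = sum_r g_r(u) g_r(w) with exactly d_{p,k}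
  orthonormal functions g_r, and the statistic is a quadratic form in the normalised sums of the
  g_r(U_i).  The functions g_r are orthogonal to the powers (x . theta)^j with j < k or with j and k
  of different parity; since the remaining Taylor coefficients of f vanish, the means of the g_r are
  o(kappa_n^q) = o(n^(-1/2)), so that the central limit theorem for triangular arrays applies with
  centred limit and identity covariance.  A Gaussian average of characteristic functions is the
  Laplace transform of the quadratic form, and Laplace transforms at the natural numbers determine
  weak convergence on [0, oo) by the Weierstrass theorem applied to exp(-x).
*)
theory Submission
  imports Defs "HOL-Computational_Algebra.Polynomial"
begin

section \<open>Gegenbauer polynomials\<close>

text \<open>No spherical harmonic is written down and no calculus on the sphere is used. Rotation
  invariance fixes the moments of one linear form up to constants, polarization gives the mixed
  moments of two forms, and their recurrence takes the place of the integration by parts behind the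
  symmetry of L. The dimension is forced by a trace: the kernel is constant on the diagonal, its
  value there is d_{p,k}, and every function split off uses up exactly one unit of trace.

  The rate is critical: the q-th power of \<kappa>_n is \<tau>^q / sqrt n. A surviving Taylor term
  of order q would leave a drift in the limit, and one of lower order would diverge. So every order
  up to q has to cancel exactly; the Peano remainder is all that may stay, and its little-o is just
  enough.

  Averaging over Gaussian arguments means that only scalar sums of bounded variables need a limit
  theorem; convergence of random vectors is never formulated. The one-dimensional Gaussian integrals
  that come out are literally the factors of the Laplace transform of the chi-square mixture, so
  they are never evaluated.\<close>

lemma gegenbauer_recurrence:
  assumes "a > 0"
  shows "(real k + 2) * gegenbauer a (Suc (Suc k)) t =
    2 * (real k + 1 + a) * t * gegenbauer a (Suc k) t - (real k + 2 * a) * gegenbauer a k t"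
proof -
  \<comment> \<open>\<open>c j m\<close> is the coefficient of t^m in the polynomial of degree 2j +
    m. Indexing by the exponent keeps truncated subtraction out of the formula, and the Pochhammer
    symbol replaces the quotient of Gamma values.\<close>
  define c where "c j m = (-1) ^ j * 2 ^ m * pochhammer a (j + m) / (fact j * fact m)" for j m :: nat
  have G: "gegenbauer a k t = (\<Sum>j = 0..k div 2. c j (k - 2 * j) * t ^ (k - 2 * j))" for k
    unfolding gegenbauer_def
  proof (intro sum.cong refl)
    fix j assume "j \<in> {0..k div 2}"
    then have j: "2 * j \<le> k" by auto
    have "pochhammer a (k - j) = Gamma (real k - real j + a) / Gamma a"
      using j assms pochhammer_Gamma[of a "k - j"]
      by (auto simp: of_nat_diff algebra_simps nonpos_Ints_def)
    moreover have "j + (k - 2 * j) = k - j" using j by simp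
    ultimately show "(- 1) ^ j * (2 ^ (k - 2 * j) * Gamma (real k - real j + a) /
        (Gamma a * fact j * fact (k - 2 * j))) * t ^ (k - 2 * j) = c j (k - 2 * j) * t ^ (k - 2 * j)"
      by (simp add: c_def)
  qed
  define N where "N = Suc (k div 2)"
  have N: "Suc (Suc k) div 2 = N" by (simp add: N_def)
  \<comment> \<open>Both lower terms are put on the index range of degree k + 2: multiplication by t
    keeps j, while the polynomial of degree k has its index shifted by one. The guards mark the ends
    of the original ranges, so the recurrence can be compared coefficientwise.\<close>
  have G1: "t * gegenbauer a (Suc k) t =
    (\<Sum>j = 0..N. if 2 * j \<le> Suc k then c j (Suc k - 2 * j) * t ^ (Suc (Suc k) - 2 * j) else 0)"
  proof -
    have "t * gegenbauer a (Suc k) t = (\<Sum>j = 0..Suc k div 2. c j (Suc k - 2 * j) * t ^ (Suc (Suc k) - 2 * j))"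
      unfolding G sum_distrib_left by (intro sum.cong refl) (auto simp: Suc_diff_le)
    also have "\<dots> = (\<Sum>j = 0..N. if 2 * j \<le> Suc k then c j (Suc k - 2 * j) * t ^ (Suc (Suc k) - 2 * j) else 0)"
      by (rule sum.mono_neutral_cong_left) (auto simp: N_def)
    finally show ?thesis .
  qed
  have G2: "gegenbauer a k t = (\<Sum>j = 0..N. if j \<ge> 1 then c (j - 1) (Suc (Suc k) - 2 * j) * t ^ (Suc (Suc k) - 2 * j) else 0)"
  proof -
    have "(\<Sum>j = 0..N. if j \<ge> 1 then c (j - 1) (Suc (Suc k) - 2 * j) * t ^ (Suc (Suc k) - 2 * j) else 0)
      = (\<Sum>j = 0..k div 2. c j (Suc (Suc k) - 2 * Suc j) * t ^ (Suc (Suc k) - 2 * Suc j))"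
      unfolding N_def by (subst sum.atLeast0_atMost_Suc_shift) simp
    then show ?thesis unfolding G by simp
  qed
  have "(real k + 2) * gegenbauer a (Suc (Suc k)) t =
      (\<Sum>j = 0..N. (2 * (real k + 1 + a) * (if 2 * j \<le> Suc k then c j (Suc k - 2 * j) * t ^ (Suc (Suc k) - 2 * j) else 0)
       - (real k + 2 * a) * (if j \<ge> 1 then c (j - 1) (Suc (Suc k) - 2 * j) * t ^ (Suc (Suc k) - 2 * j) else 0)))"
    unfolding G N sum_distrib_left
  proof (intro sum.cong refl)
    fix j assume "j \<in> {0..N}"
    then have "2 * j \<le> Suc (Suc k)" by (auto simp: N_def)
    then obtain m where m: "Suc (Suc k) = 2 * j + m" using le_Suc_ex by blast
    have k: "real k + 2 = 2 * real j + real m"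
      using arg_cong[OF m, of real] by simp
    have c1: "c j m * real m = c j (m - 1) * (2 * (a + real (j + m - 1)))" if "m \<ge> 1"
    proof -
      obtain l where l: "m = Suc l" using \<open>m \<ge> 1\<close> not0_implies_Suc by force
      have "c j (Suc l) * real (Suc l) = (-1) ^ j * 2 ^ Suc l * pochhammer a (Suc (j + l)) / (fact j * fact l)"
        unfolding c_def by (simp add: divide_simps del: of_nat_Suc)
      then show ?thesis by (simp add: l c_def pochhammer_Suc)
    qed
    have c2: "c j m * real j = - c (j - 1) m * (a + real (j + m - 1))" if "j \<ge> 1"
    proof -
      obtain l where l: "j = Suc l" using \<open>j \<ge> 1\<close> not0_implies_Suc by force
      have "c (Suc l) m * real (Suc l) = (-1) ^ Suc l * 2 ^ m * pochhammer a (Suc (l + m)) / (fact l * fact m)"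
        unfolding c_def by (simp add: divide_simps del: of_nat_Suc)
      then show ?thesis by (simp add: l c_def pochhammer_Suc)
    qed
    have pos: "a + real (j + m - 1) > 0" using assms by linarith
    have jm: "real (j + m - 1) = real j + real m - 1" using m by (cases "j + m") auto
    \<comment> \<open>The two neighbouring coefficients are tied to \<open>c j m\<close> through
      this common factor. It is positive, so the identity may be checked after multiplying by
      it.\<close>
    define d where "d = a + real j + real m - 1"
    have d: "d > 0" using pos jm by (simp add: d_def)
    have e1: "2 * d * (if m \<ge> 1 then c j (m - 1) else 0) = c j m * real m"
      using c1 jm by (auto simp: d_def algebra_simps)
    have e2: "d * (if j \<ge> 1 then c (j - 1) m else 0) = - c j m * real j"
      using c2 jm by (auto simp: d_def algebra_simps)
    have main: "(real k + 2) * c j m = 2 * (real k + 1 + a) * (if m \<ge> 1 then c j (m - 1) else 0)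
        - (real k + 2 * a) * (if j \<ge> 1 then c (j - 1) m else 0)" (is "?L = 2 * ?x * ?A - ?y * ?B")
    proof -
      have "d * ((real k + 2) * c j m) = ?x * (2 * d * ?A) - ?y * (d * ?B)"
        unfolding e1 e2 using k by (simp add: d_def) algebra
      then have "d * ?L = d * (2 * ?x * ?A - ?y * ?B)" by (simp add: algebra_simps)
      then show ?thesis using d by simp
    qed
    have i1: "(2 * j \<le> Suc k) = (m \<ge> 1)" using m by linarith
    have i2: "Suc k - 2 * j = m - 1" "Suc (Suc k) - 2 * j = m" using m by auto
    show "(real k + 2) * (c j (Suc (Suc k) - 2 * j) * t ^ (Suc (Suc k) - 2 * j)) =
       2 * (real k + 1 + a) * (if 2 * j \<le> Suc k then c j (Suc k - 2 * j) * t ^ (Suc (Suc k) - 2 * j) else 0)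
       - (real k + 2 * a) * (if j \<ge> 1 then c (j - 1) (Suc (Suc k) - 2 * j) * t ^ (Suc (Suc k) - 2 * j) else 0)"
      unfolding i1 i2 using arg_cong[OF main, of "\<lambda>x. x * t ^ m"] by (auto simp: algebra_simps split: if_splits)
  qed
  also have "\<dots> = 2 * (real k + 1 + a) * (t * gegenbauer a (Suc k) t) - (real k + 2 * a) * gegenbauer a k t"
    unfolding G1 G2 sum_subtractf sum_distrib_left ..
  finally show ?thesis by simp
qed

lemma gegenbauer_0: "a > 0 \<Longrightarrow> gegenbauer a 0 t = 1"
  using Gamma_real_pos[of a] by (simp add: gegenbauer_def less_imp_neq[symmetric] del: Gamma_real_pos)

lemma gegenbauer_1: "a > 0 \<Longrightarrow> gegenbauer a (Suc 0) t = 2 * a * t"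
  using Gamma_real_pos[of a] Gamma_real_pos[of "1 + a"] Gamma_plus1[of a]
  by (auto simp: gegenbauer_def add.commute nonpos_Ints_def simp del: Gamma_real_pos)

section \<open>Polynomial form of the zonal kernels and its differential relations\<close>

text \<open>
  \<open>ultra_poly p k\<close> is the Gegenbauer polynomial with parameter \<open>p / 2\<close>, one more than the parameter
  \<open>(p - 2) / 2\<close> of the kernels; by \<open>C\<^sub>k\<^sup>\<lambda> (k + \<lambda>) / \<lambda> = C\<^sub>k\<^sup>\<lambda>\<^sup>+\<^sup>1 - C\<^sub>k\<^sub>-\<^sub>2\<^sup>\<lambda>\<^sup>+\<^sup>1\<close>, \<open>harm_poly p k\<close> is the kernel
  of degree \<open>k\<close>, and this also covers the Chebyshev case \<open>p = 2\<close>.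
\<close>

fun ultra_poly :: "nat \<Rightarrow> nat \<Rightarrow> real poly" where
  "ultra_poly p 0 = 1"
| "ultra_poly p (Suc 0) = [:0, real p:]"
| "ultra_poly p (Suc (Suc k)) = smult (1 / (real k + 2))
     (smult (2 * real k + real p + 2) ([:0, 1:] * ultra_poly p (Suc k)) - smult (real k + real p) (ultra_poly p k))"

definition harm_poly :: "nat \<Rightarrow> nat \<Rightarrow> real poly" where
  "harm_poly p k = ultra_poly p k - (if k < 2 then 0 else ultra_poly p (k - 2))"

lemma harm_poly_simps [simp]:
  "harm_poly p 0 = 1" "harm_poly p (Suc 0) = [:0, real p:]"
  "harm_poly p (Suc (Suc k)) = ultra_poly p (Suc (Suc k)) - ultra_poly p k"
  by (simp_all add: harm_poly_def)

lemma poly_ultra_poly_Suc_Suc: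
  "(real k + 2) * poly (ultra_poly p (Suc (Suc k))) x =
     (2 * real k + real p + 2) * x * poly (ultra_poly p (Suc k)) x - (real k + real p) * poly (ultra_poly p k) x"
  by (simp add: field_simps)

declare ultra_poly.simps(3) [simp del]

lemma poly_pderiv_ultra_poly_Suc_Suc:
  "(real k + 2) * poly (pderiv (ultra_poly p (Suc (Suc k)))) x =
     (2 * real k + real p + 2) * (poly (ultra_poly p (Suc k)) x + x * poly (pderiv (ultra_poly p (Suc k))) x)
      - (real k + real p) * poly (pderiv (ultra_poly p k)) x"
  by (simp add: ultra_poly.simps pderiv_smult pderiv_diff pderiv_mult pderiv_pCons field_simps)

text \<open>The two relations feed each other and need one joint induction: the first at k combines
  both at k - 1 and k - 2, and the second at k is the differentiated three-term recurrence with the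
  first substituted.\<close>

lemma ultra_poly_deriv:
  shows "x * poly (pderiv (ultra_poly p (Suc k))) x =
      poly (pderiv (ultra_poly p k)) x + (real k + 1) * poly (ultra_poly p (Suc k)) x"
    and "poly (pderiv (ultra_poly p (Suc (Suc k)))) x =
      poly (pderiv (ultra_poly p k)) x + (2 * real k + real p + 2) * poly (ultra_poly p (Suc k)) x"
proof (induction k rule: less_induct)
  case (less k)
  let ?S = "\<lambda>k. poly (ultra_poly p k) x" and ?D = "\<lambda>k. poly (pderiv (ultra_poly p k)) x"
  have A: "x * ?D (Suc k) = ?D k + (real k + 1) * ?S (Suc k)"
  proof (cases k)
    case 0
    then show ?thesis by (simp add: pderiv_pCons)
  next
    case (Suc l)
    have 1: "x * ?D (Suc l) = ?D l + (real l + 1) * ?S (Suc l)"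
      and 2: "?D (Suc (Suc l)) = ?D l + (2 * real l + real p + 2) * ?S (Suc l)"
      using less[of l] Suc by auto
    have 3: "x * ?D l = ?D (Suc l) - (real l + real p) * ?S l"
    proof (cases l)
      case 0
      then show ?thesis by (simp add: pderiv_pCons)
    next
      case (Suc m)
      have "x * ?D (Suc m) = ?D m + (real m + 1) * ?S (Suc m)"
        "?D (Suc (Suc m)) = ?D m + (2 * real m + real p + 2) * ?S (Suc m)"
        using less[of m] Suc \<open>k = Suc l\<close> by auto
      then show ?thesis using Suc by (simp add: algebra_simps)
    qed
    have "x * ?D (Suc (Suc l)) = ?D (Suc l) - (real l + real p) * ?S l + (2 * real l + real p + 2) * x * ?S (Suc l)"
      unfolding 2 distrib_left 3 by simp
    then show ?thesis using poly_ultra_poly_Suc_Suc[of l p x] Suc by (simp add: algebra_simps)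
  qed
  have "(real k + 2) * ?D (Suc (Suc k)) = (2 * real k + real p + 2) * (?S (Suc k) + x * ?D (Suc k))
      - (real k + real p) * ?D k"
    by (rule poly_pderiv_ultra_poly_Suc_Suc)
  also have "\<dots> = (real k + 2) * (?D k + (2 * real k + real p + 2) * ?S (Suc k))"
    unfolding A by (simp add: algebra_simps)
  finally have "?D (Suc (Suc k)) = ?D k + (2 * real k + real p + 2) * ?S (Suc k)"
    by simp
  with A show "x * ?D (Suc k) = ?D k + (real k + 1) * ?S (Suc k)"
    "?D (Suc (Suc k)) = ?D k + (2 * real k + real p + 2) * ?S (Suc k)" .
qed

text \<open>The second derivative relation telescopes on the difference S_{k+1} - S_{k-1} of values
  of \<open>ultra_poly p\<close>. This single-term derivative is what the eigenvalue equation and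
  the norm computation rest on.\<close>

lemma pderiv_harm_poly_Suc:
  "pderiv (harm_poly p (Suc k)) = smult (2 * real k + real p) (ultra_poly p k)"
proof (cases k)
  case 0
  then show ?thesis by (simp add: pderiv_pCons)
next
  case (Suc l)
  have "poly (pderiv (harm_poly p (Suc k))) x = poly (smult (2 * real k + real p) (ultra_poly p k)) x" for x
    using ultra_poly_deriv(2)[where k = l and p = p and x = x] Suc by (simp add: pderiv_diff algebra_simps)
  then show ?thesis by (metis poly_eq_poly_eq_iff ext)
qed

text \<open>With S for \<open>ultra_poly p\<close> and H for \<open>harm_poly p\<close>: putting
  S_{k+1} = H_{k+1} + S_{k-1} into the three-term recurrence gives S_{k-1} the coefficients
  (k+1)/(2k+p) and (k+p-1)/(2k+p), which add up to one.\<close>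

lemma x_times_ultra_poly:
  assumes "p > 0"
  shows "x * poly (ultra_poly p k) x = (real k + 1) / (2 * real k + real p) * poly (harm_poly p (Suc k)) x
     + (if k = 0 then 0 else poly (ultra_poly p (k - 1)) x)"
proof (cases k)
  case 0
  then show ?thesis using assms by (simp add: field_simps)
next
  case (Suc l)
  have "2 * real l + real p + 2 > 0" using assms by simp
  then show ?thesis using poly_ultra_poly_Suc_Suc[of l p x] Suc
    by (simp add: field_simps)
qed

text \<open>Difference of the previous expansion at two indices two apart. The case k = 0 is
  separate because the general coefficient would read 0/0 there when p = 2.\<close>

lemma x_times_harm_poly:
  assumes "p > 0"
  shows "[:0, 1:] * harm_poly p (Suc k) = smult ((real k + 2) / (2 * real k + real p + 2)) (harm_poly p (Suc (Suc k)))
     + smult (if k = 0 then 1 else (real k + real p - 2) / (2 * real k + real p - 2)) (harm_poly p k)"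
proof -
  have "x * poly (harm_poly p (Suc k)) x = (real k + 2) / (2 * real k + real p + 2) * poly (harm_poly p (Suc (Suc k))) x
     + (if k = 0 then 1 else (real k + real p - 2) / (2 * real k + real p - 2)) * poly (harm_poly p k) x" for x
  proof (cases k)
    case 0
    then show ?thesis using x_times_ultra_poly[OF assms, of x "Suc 0"] by simp
  next
    case (Suc l)
    have pos: "2 * real l + real p > 0" using assms by simp
    have "(real l + real p - 1) / (2 * real l + real p) = 1 - (real l + 1) / (2 * real l + real p)"
      using pos by (simp add: field_simps)
    moreover have "x * poly (harm_poly p (Suc k)) x = x * poly (ultra_poly p (Suc (Suc l))) x - x * poly (ultra_poly p l) x"
      using Suc by (simp add: algebra_simps)
    moreover have "poly (ultra_poly p (Suc l)) x - (if l = 0 then 0 else poly (ultra_poly p (l - 1)) x) = poly (harm_poly p (Suc l)) x"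
      by (cases l) (auto simp: )
    moreover have "x * poly (ultra_poly p (Suc (Suc l))) x =
        (real k + 2) / (2 * real k + real p + 2) * poly (harm_poly p (Suc (Suc k))) x + poly (ultra_poly p (Suc l)) x"
      using x_times_ultra_poly[OF assms, of x "Suc k"] Suc by (simp add: add.commute add.left_commute del: harm_poly_simps)
    moreover have "x * poly (ultra_poly p l) x = (real l + 1) / (2 * real l + real p) * poly (harm_poly p (Suc l)) x
        + (if l = 0 then 0 else poly (ultra_poly p (l - 1)) x)"
      by (rule x_times_ultra_poly[OF assms])
    moreover have "(if k = 0 then 1 else (real k + real p - 2) / (2 * real k + real p - 2)) = (real l + real p - 1) / (2 * real l + real p)"
      using Suc by (simp add: algebra_simps)
    ultimately show ?thesis
      using Suc by (simp add: left_diff_distrib del: harm_poly_simps)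
  qed
  then have "poly ([:0, 1:] * harm_poly p (Suc k)) x = poly (smult ((real k + 2) / (2 * real k + real p + 2)) (harm_poly p (Suc (Suc k)))
     + smult (if k = 0 then 1 else (real k + real p - 2) / (2 * real k + real p - 2)) (harm_poly p k)) x" for x
    by simp
  then show ?thesis by (metis poly_eq_poly_eq_iff ext)
qed

text \<open>Since the derivative of \<open>harm_poly\<close> is a multiple of one
  \<open>ultra_poly\<close>, the second-order equation reduces to the first-order lowering relation
  \<open>3\<close>. The eigenvalue is that of the Laplace-Beltrami operator on spherical harmonics
  of degree k.\<close>

lemma harm_poly_eigen:
  "(1 - x\<^sup>2) * poly (pderiv (pderiv (harm_poly p k))) x - (real p - 1) * x * poly (pderiv (harm_poly p k)) x
     = - real k * (real k + real p - 2) * poly (harm_poly p k) x"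
proof (cases k)
  case 0
  then show ?thesis by simp
next
  case (Suc l)
  show ?thesis
  proof (cases l)
    case 0
    then show ?thesis using Suc by (simp add: pderiv_pCons algebra_simps)
  next
    case (Suc m)
    let ?S = "\<lambda>k. poly (ultra_poly p k) x" and ?D = "\<lambda>k. poly (pderiv (ultra_poly p k)) x"
    have 1: "x * ?D (Suc m) = ?D m + (real m + 1) * ?S (Suc m)" by (rule ultra_poly_deriv)
    have 2: "x * ?D m = ?D (Suc m) - (real m + real p) * ?S m"
    proof (cases m)
      case 0
      then show ?thesis by (simp add: pderiv_pCons)
    next
      case (Suc i)
      show ?thesis using ultra_poly_deriv[where k = i and p = p and x = x] Suc by (simp add: algebra_simps)
    qed
    have "x\<^sup>2 * ?D (Suc m) = x * ?D m + (real m + 1) * x * ?S (Suc m)"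
      unfolding power2_eq_square mult.assoc 1 by (simp add: algebra_simps)
    then have 3: "(1 - x\<^sup>2) * ?D (Suc m) = (real m + real p) * ?S m - (real m + 1) * x * ?S (Suc m)"
      unfolding 2 by (simp add: algebra_simps)
    have H: "(real m + 2) * poly (harm_poly p (Suc (Suc m))) x = (2 * real m + real p + 2) * (x * ?S (Suc m) - ?S m)"
      using poly_ultra_poly_Suc_Suc[of m p x] by (simp add: algebra_simps)
    have "pderiv (pderiv (harm_poly p k)) = smult (2 * real m + real p + 2) (pderiv (ultra_poly p (Suc m)))"
      "pderiv (harm_poly p k) = smult (2 * real m + real p + 2) (ultra_poly p (Suc m))"
      using \<open>k = Suc l\<close> Suc pderiv_harm_poly_Suc[of p "Suc m"] by (simp_all add: pderiv_smult algebra_simps)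
    then have "(1 - x\<^sup>2) * poly (pderiv (pderiv (harm_poly p k))) x - (real p - 1) * x * poly (pderiv (harm_poly p k)) x
       = (2 * real m + real p + 2) * ((1 - x\<^sup>2) * ?D (Suc m) - (real p - 1) * x * ?S (Suc m))"
      by (simp add: algebra_simps)
    also have "\<dots> = - (real m + real p) * ((2 * real m + real p + 2) * (x * ?S (Suc m) - ?S m))"
      unfolding 3 by (simp add: algebra_simps)
    also have "\<dots> = - real k * (real k + real p - 2) * poly (harm_poly p k) x"
      unfolding H[symmetric] using \<open>k = Suc l\<close> Suc by (simp add: algebra_simps)
    finally show ?thesis .
  qed
qed

section \<open>Values at 1 and identification with the Sobolev kernels\<close>

text \<open>The binomial is the number of monomials of degree k in p variables; subtracting the
  count for degree k - 2 will leave the dimension of the harmonics.\<close>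

lemma poly_ultra_poly_1:
  assumes "p > 0"
  shows "poly (ultra_poly p k) 1 = real ((k + p - 1) choose (p - 1))"
  using assms
proof (induction p k rule: ultra_poly.induct)
  case (2 p)
  then obtain r where r: "p = Suc r" using not0_implies_Suc by blast
  show ?case by (simp add: r binomial_symmetric[of r "Suc r"])
next
  case (3 p k)
  then obtain r where r: "p = Suc r" using not0_implies_Suc by blast
  let ?b = "\<lambda>k. real ((k + r) choose r)"
  have step: "(real k + 1) * ?b (Suc k) = (real k + 1 + real r) * ?b k" for k
  proof -
    have "Suc k * (Suc (k + r) choose Suc k) = Suc (k + r) * ((k + r) choose k)"
      by (rule Suc_times_binomial)
    moreover have "(Suc (k + r) choose Suc k) = ((Suc k + r) choose r)" "((k + r) choose k) = ((k + r) choose r)"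
      using binomial_symmetric[of "Suc k" "Suc (k + r)"] binomial_symmetric[of k "k + r"] by auto
    ultimately have "Suc k * ((Suc k + r) choose r) = Suc (k + r) * ((k + r) choose r)" by simp
    from arg_cong[OF this, of real] show ?thesis by (simp add: algebra_simps)
  qed
  have IH: "poly (ultra_poly p (Suc k)) 1 = ?b (Suc k)" "poly (ultra_poly p k) 1 = ?b k"
    using 3 by (auto simp: r)
  have "(real k + 2) * poly (ultra_poly p (Suc (Suc k))) 1 =
      (2 * real k + real r + 3) * ?b (Suc k) - (real k + 1 + real r) * ?b k"
    using poly_ultra_poly_Suc_Suc[of k p 1] unfolding IH by (simp add: r algebra_simps del: binomial_Suc_Suc)
  also have "\<dots> = (real k + 2 + real r) * ?b (Suc k)"
    unfolding step[symmetric] by (simp add: algebra_simps)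
  also have "\<dots> = (real k + 2) * ?b (Suc (Suc k))"
    using step[of "Suc k"] by (simp add: algebra_simps)
  finally show ?case by (simp add: r)
qed simp

text \<open>Pascal's rule twice. The value at 1 is the kernel on the diagonal, whose integral later
  counts the basis functions.\<close>

lemma poly_harm_poly_1:
  assumes "p \<ge> 2" "k > 0"
  shows "poly (harm_poly p k) 1 = real (harmonic_dim p k)"
proof -
  obtain r where r: "p = Suc (Suc r)" using assms(1) by (metis add_2_eq_Suc le_Suc_ex)
  obtain l where l: "k = Suc l" using assms(2) gr0_implies_Suc by blast
  show ?thesis
  proof (cases l)
    case 0
    then show ?thesis by (simp add: r l harmonic_dim_def binomial_symmetric[of r "Suc r"])
  next
    case (Suc m)
    have "((k + p - 1) choose (p - 1)) = ((m + p - 1) choose (p - 1)) + harmonic_dim p k"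
      by (simp add: r l Suc harmonic_dim_def add.commute)
    then show ?thesis
      using assms by (simp add: l Suc poly_ultra_poly_1)
  qed
qed

lemma sobolev_kernel_eq_poly:
  assumes "p \<ge> 2" "k > 0"
  shows "sobolev_kernel p k s = poly (harm_poly p k) s"
proof (cases "p = 2")
  case True
  \<comment> \<open>In degree 0 the polynomial is 1 while the kernel formula would give 2; the
    induction passes through degree 0 and therefore carries the conditional.\<close>
  have "poly (harm_poly 2 k) s = (if k = 0 then 1 else 2 * chebyshev k s)" for k
  proof (induction k s rule: chebyshev.induct)
    case (3 k t)
    have "t * poly (harm_poly 2 (Suc k)) t = 1 / 2 * poly (harm_poly 2 (Suc (Suc k))) t
       + (if k = 0 then 1 else 1 / 2) * poly (harm_poly 2 k) t"
    proof -
      have "(real k + 2) / (2 * real k + real 2 + 2) * y = 1 / 2 * y" for y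
        by (simp add: field_simps)
      moreover have
        "(if k = 0 then 1 else (real k + real 2 - 2) / (2 * real k + real 2 - 2)) = (if k = 0 then 1 else 1 / 2)"
        by (simp add: field_simps)
      moreover note arg_cong[OF x_times_harm_poly[of 2 k], of "\<lambda>P. poly P t"]
      ultimately show ?thesis
        by (simp only: poly_mult poly_add poly_smult) (simp del: harm_poly_simps(3))
    qed
    then show ?case using 3 by (auto simp del: harm_poly_simps(3) split: if_splits)
  qed auto
  with True assms show ?thesis by (simp add: sobolev_kernel_def)
next
  case False
  define a where "a = (real p - 2) / 2"
  have a: "a > 0" using False assms by (simp add: a_def)
  have p: "real p = 2 * a + 2" by (simp add: a_def field_simps)
  \<comment> \<open>The factor 1 + 2k/(p-2) is (k+a)/a. Clearing the denominator lets the recurrence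
    for \<open>harm_poly\<close> be compared with the one for \<open>gegenbauer\<close>.\<close>
  have "a * poly (harm_poly p k) t = (real k + a) * gegenbauer a k t" for k t
  proof (induction k rule: induct_nat_012)
    case 0
    then show ?case using a by (simp add: gegenbauer_0)
  next
    case 1
    then show ?case using a p by (simp add: gegenbauer_1 algebra_simps)
  next
    case (ge2 k)
    let ?H = "\<lambda>k. poly (harm_poly p k) t" and ?G = "\<lambda>k. gegenbauer a k t"
    have k: "real k + a > 0" "real k + a + 1 > 0" "real k + a + 2 > 0" using a by auto
    have "t * ?H (Suc k) = (real k + 2) / (2 * real k + real p + 2) * ?H (Suc (Suc k))
       + (if k = 0 then 1 else (real k + real p - 2) / (2 * real k + real p - 2)) * ?H k"
      using arg_cong[OF x_times_harm_poly[of p k], of "\<lambda>P. poly P t"] assms by (simp del: harm_poly_simps(3))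
    \<comment> \<open>As a > 0, the exceptional coefficient at k = 0 agrees with the general
      formula.\<close>
    also have "(if k = 0 then 1 else (real k + real p - 2) / (2 * real k + real p - 2)) = (real k + 2 * a) / (2 * (real k + a))"
      using a by (simp add: p distrib_left add_divide_distrib)
    also have "(real k + 2) / (2 * real k + real p + 2) = (real k + 2) / (2 * (real k + a + 2))"
      using p by (simp add: algebra_simps)
    finally have tH: "t * ?H (Suc k) = (real k + 2) / (2 * (real k + a + 2)) * ?H (Suc (Suc k))
       + (real k + 2 * a) / (2 * (real k + a)) * ?H k" .
    then have "2 * a * (t * ?H (Suc k)) = (real k + 2) / (real k + a + 2) * (a * ?H (Suc (Suc k)))
       + (real k + 2 * a) / (real k + a) * (a * ?H k)"
    proof -
      have "2 * a * (x / (2 * y) * h + x' / (2 * y') * h') = x / y * (a * h) + x' / y' * (a * h')"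
        for x y h x' y' h' :: real
        by (simp add: distrib_left mult.left_commute)
      then show ?thesis by (simp only: tH)
    qed
    then have "2 * t * (a * ?H (Suc k)) = (real k + 2) / (real k + a + 2) * (a * ?H (Suc (Suc k)))
       + (real k + 2 * a) / (real k + a) * (a * ?H k)"
      by (simp only: mult.assoc mult.left_commute[of t a])
    then have "2 * t * ((real k + 1 + a) * ?G (Suc k)) = (real k + 2) / (real k + a + 2) * (a * ?H (Suc (Suc k)))
       + (real k + 2 * a) * ?G k"
    proof -
      have "(real k + 2 * a) / (real k + a) * ((real k + a) * ?G k) = (real k + 2 * a) * ?G k"
        using k by simp
      moreover have "real (Suc k) + a = real k + 1 + a" by simp
      ultimately show ?thesis
        using \<open>2 * t * (a * ?H (Suc k)) = _\<close> unfolding ge2 by (simp only:)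
    qed
    with gegenbauer_recurrence[OF a, of k t]
    have "(real k + 2) / (real k + a + 2) * (a * ?H (Suc (Suc k))) = (real k + 2) * ?G (Suc (Suc k))"
      by (simp add: algebra_simps)
    then have "(real k + 2) * (a * ?H (Suc (Suc k))) = (real k + 2) * ((real k + a + 2) * ?G (Suc (Suc k)))"
      using k by (simp add: field_simps)
    then have "a * ?H (Suc (Suc k)) = (real k + a + 2) * ?G (Suc (Suc k))"
      by (subst (asm) mult_left_cancel) auto
    then show ?case by (simp add: algebra_simps del: harm_poly_simps(3))
  qed
  then have "poly (harm_poly p k) s = (real k + a) / a * gegenbauer a k s"
    using a by (simp add: field_simps)
  also have "(real k + a) / a = 1 + 2 * real k / (real p - 2)"
    using a by (simp add: p field_simps)
  finally show ?thesis using False by (simp add: sobolev_kernel_def a_def)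
qed

section \<open>Moments of the uniform distribution on the sphere\<close>

text \<open>
  An open set is, up to a null set, a countable disjoint union of balls (Vitali), and the preimage of
  a ball under an isometry is a ball of the same radius.
\<close>

lemma distr_lborel_orthogonal_transformation:
  fixes T :: "'a::euclidean_space \<Rightarrow> 'a"
  assumes T: "orthogonal_transformation T"
  shows "distr lborel borel T = lborel"
proof -
  \<comment> \<open>One inequality for all orthogonal maps is enough: used for \<open>T\<close> and
    for \<open>inv T\<close> it yields equality on open boxes, which identify Lebesgue
    measure.\<close>
  have le: "emeasure lborel U \<le> emeasure lborel (R -` U)"
    if R: "orthogonal_transformation R" and U: "open U" for R :: "'a \<Rightarrow> 'a" and U
  proof -
    let ?K = "{(x, r). 0 < r \<and> ball x r \<subseteq> U}"
    have "\<exists>i. i \<in> ?K \<and> x \<in> ball (fst i) (snd i) \<and> snd i < d" if x: "x \<in> U" and d: "0 < d" for x d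
    proof -
      obtain e where e: "e > 0" "ball x e \<subseteq> U" using U x by (meson openE)
      then have "(x, min e (d / 2)) \<in> ?K" using d by (auto simp: subset_iff)
      moreover have "x \<in> ball x (min e (d / 2))" "min e (d / 2) < d" using d e by auto
      ultimately show ?thesis by (intro exI[of _ "(x, min e (d / 2))"]) (auto simp del: min_less_iff_conj)
    qed
    then obtain C where C: "countable C" "C \<subseteq> ?K"
      "pairwise (\<lambda>i j. disjnt (ball (fst i) (snd i)) (ball (fst j) (snd j))) C"
      "negligible (U - (\<Union>i\<in>C. ball (fst i) (snd i)))"
      by (rule Vitali_covering_theorem_balls[of U ?K fst snd])
    let ?B = "\<lambda>i. ball (fst i) (snd i)"
    let ?V = "\<Union>i\<in>C. ?B i"
    have V: "?V \<subseteq> U" using C(2) by fastforce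
    have lin: "linear R" and bij: "bij R"
      using R orthogonal_transformation_linear orthogonal_transformation_bij by auto
    have contR: "continuous_on UNIV R" using lin by (simp add: linear_continuous_on linear_conv_bounded_linear)
    then have Rm: "R \<in> borel_measurable borel" by (rule borel_measurable_continuous_onI)
    have pre: "R -` ball x r = ball (inv R x) r" for x r
    proof -
      have "dist (R y) x = dist y (inv R x)" for y
        using R orthogonal_transformation_surj[OF R] orthogonal_transformation_isometry surj_f_inv_f by metis
      then show ?thesis by (auto simp: dist_commute)
    qed
    have disj: "disjoint_family_on ?B C"
      using C(3) by (auto simp: disjoint_family_on_def pairwise_def disjnt_def)
    have "emeasure lborel U = emeasure lborel ?V + emeasure lborel (U - ?V)"
      proof (subst plus_emeasure)
      show "?V \<in> sets lborel" "U - ?V \<in> sets lborel"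
        using U borel_open[of U] borel_open[of ?V, OF open_UN] by (simp_all add: sets.Diff)
    qed (use V in \<open>auto intro!: arg_cong2[where f = emeasure]\<close>)
    also have "emeasure lborel (U - ?V) = 0"
    proof -
      have "U - ?V \<in> null_sets lebesgue" using C(4) by (simp add: negligible_iff_null_sets)
      moreover have "U - ?V \<in> sets lborel"
        using U borel_open[of U] borel_open[of ?V, OF open_UN] by (simp_all add: sets.Diff)
      ultimately show ?thesis by (simp add: null_sets_def)
    qed
    also have "emeasure lborel ?V + 0 = (\<integral>\<^sup>+i. emeasure lborel (?B i) \<partial>count_space C)"
      using C(1) disj by (subst emeasure_UN_countable) auto
    also have "\<dots> = (\<integral>\<^sup>+i. emeasure lborel (R -` ?B i) \<partial>count_space C)"
    proof (rule nn_integral_cong)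
      fix i
      show "emeasure lborel (?B i) = emeasure lborel (R -` ?B i)"
        unfolding pre by (cases "snd i \<ge> 0") (simp_all add: emeasure_ball ball_empty)
    qed
    also have "\<dots> = emeasure lborel (\<Union>i\<in>C. R -` ?B i)"
    proof (rule emeasure_UN_countable[symmetric])
      show "disjoint_family_on (\<lambda>i. R -` ?B i) C" using disj by (fastforce simp: disjoint_family_on_def)
    qed (use C(1) pre in auto)
    also have "\<dots> \<le> emeasure lborel (R -` U)"
    proof (rule emeasure_mono)
      show "(\<Union>i\<in>C. R -` ?B i) \<subseteq> R -` U" using V by auto
      show "R -` U \<in> sets lborel" using measurable_sets[OF Rm, of U] U by auto
    qed
    finally show ?thesis .
  qed
  have lin: "linear T" and bij: "bij T" and inv: "orthogonal_transformation (inv T)"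
    using T orthogonal_transformation_linear orthogonal_transformation_bij orthogonal_transformation_inv by auto
  have contT: "continuous_on UNIV T" using lin by (simp add: linear_continuous_on linear_conv_bounded_linear)
  then have Tm: "T \<in> borel_measurable borel" by (rule borel_measurable_continuous_onI)
  have "lborel = distr lborel borel T"
  proof (rule lborel_eqI)
    fix l u :: 'a assume lu: "\<And>b. b \<in> Basis \<Longrightarrow> l \<bullet> b \<le> u \<bullet> b"
    have op: "open (T -` box l u)" by (rule open_vimage[OF open_box contT])
    have "inv T -` (T -` box l u) = box l u"
      using bij by (auto simp: bij_is_surj surj_f_inv_f)
    with le[OF T open_box, of l u] le[OF inv op] have "emeasure lborel (T -` box l u) = emeasure lborel (box l u)"
      by auto
    then show "emeasure (distr lborel borel T) (box l u) = ennreal (\<Prod>b\<in>Basis. (u - l) \<bullet> b)"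
      using Tm lu by (subst emeasure_distr) auto
  qed simp
  then show ?thesis ..
qed

section \<open>Surface area, its normalisation, and rotation invariance\<close>

lemma sets_surface_measure [measurable_cong]:
  "sets (surface_measure :: 'a::euclidean_space measure) = sets (restrict_space borel (sphere 0 1))"
  by (simp add: surface_measure_def)

lemma space_surface_measure [simp]:
  "space (surface_measure :: 'a::euclidean_space measure) = sphere 0 1"
  using sets_eq_imp_space_eq[OF sets_surface_measure] by (simp add: space_restrict_space)

lemma borel_measurable_surface_measure:
  fixes \<phi> :: "'a::euclidean_space \<Rightarrow> 'b::topological_space"
  assumes "\<phi> \<in> borel_measurable borel"
  shows "\<phi> \<in> borel_measurable surface_measure"
  using measurable_restrict_space1[OF assms] by (simp cong: measurable_cong_sets add: sets_surface_measure)

lemma emeasure_surface_measure_sphere: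
  "emeasure surface_measure (sphere 0 1 :: 'a::euclidean_space set) \<noteq> 0"
  "emeasure surface_measure (sphere 0 1 :: 'a::euclidean_space set) \<noteq> \<infinity>"
proof -
  let ?B = "{x :: 'a. 0 < norm x \<and> norm x \<le> 1 \<and> x /\<^sub>R norm x \<in> sphere 0 1}"
  have B: "?B = cball 0 1 - {0}" by auto
  have "emeasure lborel ?B = emeasure lborel (cball 0 1 :: 'a set)"
    unfolding B by (subst emeasure_Diff) auto
  also have "\<dots> \<noteq> 0 \<and> \<dots> \<noteq> \<infinity>"
    using unit_ball_vol_pos[of "real DIM('a)"] by (simp add: emeasure_cball less_imp_neq[symmetric])
  finally have "emeasure lborel ?B \<noteq> 0 \<and> emeasure lborel ?B \<noteq> \<infinity>" .
  then show "emeasure surface_measure (sphere 0 1 :: 'a set) \<noteq> 0"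
    "emeasure surface_measure (sphere 0 1 :: 'a set) \<noteq> \<infinity>"
    by (subst emeasure_surface_measure; auto simp: ennreal_mult_eq_top_iff)+
qed

definition uniform_sphere :: "'a::euclidean_space measure" where
  "uniform_sphere = uniform_measure surface_measure (sphere 0 1)"

lemma sets_uniform_sphere [measurable_cong]: "sets uniform_sphere = sets (restrict_space borel (sphere 0 1))"
  by (simp add: uniform_sphere_def sets_surface_measure)

lemma space_uniform_sphere [simp]: "space uniform_sphere = sphere 0 1"
  by (simp add: uniform_sphere_def)

lemma prob_space_uniform_sphere: "prob_space (uniform_sphere :: 'a::euclidean_space measure)"
  unfolding uniform_sphere_def using emeasure_surface_measure_sphere
  by (rule prob_space_uniform_measure)

lemma borel_measurable_uniform_sphere:
  fixes \<phi> :: "'a::euclidean_space \<Rightarrow> 'b::topological_space"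
  assumes "\<phi> \<in> borel_measurable borel"
  shows "\<phi> \<in> borel_measurable uniform_sphere"
  using measurable_restrict_space1[OF assms] by (simp cong: measurable_cong_sets add: sets_uniform_sphere)

lemma integrable_uniform_sphere:
  fixes \<phi> :: "'a::euclidean_space \<Rightarrow> real"
  assumes "continuous_on UNIV \<phi>"
  shows "integrable uniform_sphere \<phi>"
proof -
  interpret prob_space "uniform_sphere :: 'a measure" by (rule prob_space_uniform_sphere)
  have "compact (\<phi> ` sphere 0 1)"
    by (intro compact_continuous_image continuous_on_subset[OF assms]) auto
  then obtain B where "\<And>x. x \<in> sphere 0 1 \<Longrightarrow> norm (\<phi> x) \<le> B"
    using compact_imp_bounded[of "\<phi> ` sphere 0 1"] unfolding bounded_iff by blast
  then show ?thesis
    by (intro integrable_const_bound[of _ B] AE_I2 borel_measurable_uniform_sphere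
        borel_measurable_continuous_onI assms) auto
qed

text \<open>Orthogonal maps are linear and preserve the norm, so the cone over a preimage is the
  preimage of the cone; the invariance of surface area is thereby inherited from Lebesgue
  measure.\<close>

lemma integral_uniform_sphere_orthogonal_transformation:
  fixes T :: "'a::euclidean_space \<Rightarrow> 'a" and \<phi> :: "'a \<Rightarrow> real"
  assumes T: "orthogonal_transformation T" and [measurable]: "\<phi> \<in> borel_measurable borel"
  shows "(LINT x|uniform_sphere. \<phi> (T x)) = (LINT x|uniform_sphere. \<phi> x)"
proof -
  have lin: "linear T" and nT: "\<And>x. norm (T x) = norm x"
    using T orthogonal_transformation_linear orthogonal_transformation_norm by auto
  have Tm [measurable]: "T \<in> borel_measurable borel"
    using lin by (intro borel_measurable_continuous_onI) (simp add: linear_continuous_on linear_conv_bounded_linear)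
  have T1: "T \<in> uniform_sphere \<rightarrow>\<^sub>M uniform_sphere"
    unfolding measurable_cong_sets[OF sets_uniform_sphere sets_uniform_sphere]
    by (intro measurable_restrict_space2 measurable_restrict_space1)
       (auto simp: space_restrict_space nT)
  have surf: "emeasure surface_measure (T -` A \<inter> sphere 0 1) = emeasure surface_measure A"
    if A: "A \<in> sets borel" "A \<subseteq> sphere 0 1" for A
  proof -
    have pre: "T -` A \<in> sets borel" using measurable_sets[OF Tm A(1)] by simp
    let ?C = "\<lambda>A. {x. 0 < norm x \<and> norm x \<le> 1 \<and> x /\<^sub>R norm x \<in> A}"
    have C: "?C A \<in> sets borel"
      using A(1) by measurable
    have "?C (T -` A \<inter> sphere 0 1) = T -` ?C A"
      using A(2) by (auto simp: nT linear_cmul[OF lin])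
    moreover have "emeasure lborel (T -` ?C A) = emeasure (distr lborel borel T) (?C A)"
      using C by (subst emeasure_distr) auto
    ultimately show ?thesis
      using A pre by (simp add: emeasure_surface_measure distr_lborel_orthogonal_transformation[OF T])
  qed
  have "distr uniform_sphere uniform_sphere T = uniform_sphere"
  proof (rule measure_eqI)
    fix A assume "A \<in> sets (distr uniform_sphere uniform_sphere T)"
    then have A: "A \<in> sets uniform_sphere" by simp
    then have A': "A \<in> sets borel" "A \<subseteq> sphere 0 1"
      by (auto simp: sets_uniform_sphere sets_restrict_space_iff)
    have "emeasure (distr uniform_sphere uniform_sphere T) A = emeasure uniform_sphere (T -` A \<inter> sphere 0 1)"
      using A T1 by (simp add: emeasure_distr)
    also have "\<dots> = emeasure uniform_sphere A"
    proof -
      have s: "sphere 0 1 \<in> sets (surface_measure :: 'a measure)" "A \<in> sets surface_measure"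
        using sets.top[of "surface_measure :: 'a measure"] A by (auto simp: sets_uniform_sphere sets_surface_measure)
      have "T -` A \<inter> sphere 0 1 \<in> sets surface_measure"
        using measurable_sets[OF T1 A] by (simp add: sets_uniform_sphere sets_surface_measure)
      with s surf[OF A'] A'(2) show ?thesis
        unfolding uniform_sphere_def
        by (simp add: emeasure_uniform_measure Int_absorb1 Int_absorb2 Int_commute)
    qed
    finally show "emeasure (distr uniform_sphere uniform_sphere T) A = emeasure uniform_sphere A" .
  qed simp
  then have "(LINT x|uniform_sphere. \<phi> x) = (LINT x|distr uniform_sphere uniform_sphere T. \<phi> x)" by simp
  also have "\<dots> = (LINT x|uniform_sphere. \<phi> (T x))"
    by (intro integral_distr T1 borel_measurable_uniform_sphere) simp
  finally show ?thesis ..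
qed

section \<open>Mixed moments of two linear forms on the sphere\<close>

text \<open>For unit vectors u, w with inner product r, \<open>[:1, 2 * r, 1:]\<close> evaluated at
  t is the squared norm of u + t w; its powers generate the mixed moments.\<close>

lemma coeff_quadratic_power:
  fixes r :: real
  shows "coeff ([:1, 2 * r, 1:] ^ n) 0 = 1" "coeff ([:1, 2 * r, 1:] ^ n) (Suc 0) = 2 * real n * r"
    "coeff ([:1, 2 * r, 1:] ^ n) 2 = real n + 2 * real n * (real n - 1) * r\<^sup>2"
proof -
  have [simp]: "coeff (pCons a Q) 2 = coeff Q 1" for a :: real and Q by (simp add: numeral_2_eq_2)
  show 0: "coeff ([:1, 2 * r, 1:] ^ n) 0 = 1" for n by (induction n) (auto simp: coeff_mult)
  show 1: "coeff ([:1, 2 * r, 1:] ^ n) (Suc 0) = 2 * real n * r" for n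
  proof (induction n)
    case (Suc n)
    have "coeff ([:1, 2 * r, 1:] ^ Suc n) (Suc 0) = coeff ([:1, 2 * r, 1:] ^ n) (Suc 0) + 2 * r * coeff ([:1, 2 * r, 1:] ^ n) 0"
      by simp
    then show ?case unfolding 0 Suc by (simp add: algebra_simps)
  qed simp
  show "coeff ([:1, 2 * r, 1:] ^ n) 2 = real n + 2 * real n * (real n - 1) * r\<^sup>2"
  proof (induction n)
    case (Suc n)
    have "coeff ([:1, 2 * r, 1:] ^ Suc n) 2 = coeff ([:1, 2 * r, 1:] ^ n) 2 + 2 * r * coeff ([:1, 2 * r, 1:] ^ n) (Suc 0)
        + coeff ([:1, 2 * r, 1:] ^ n) 0"
      by simp
    then show ?case unfolding 0 1 Suc by (simp add: algebra_simps power2_eq_square)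
  qed simp
qed

text \<open>With Q the quadratic, 2 Q - x Q' = 2 (1 + r x). Multiplied by (N+1) Q^N this is an
  identity between Q^(N+1), its derivative and Q^N, read off at x^b.\<close>

lemma coeff_quadratic_power_Suc:
  fixes r :: real
  shows "(2 * real (Suc N) - real b) * coeff ([:1, 2 * r, 1:] ^ Suc N) b =
    2 * real (Suc N) * (coeff ([:1, 2 * r, 1:] ^ N) b + (if b = 0 then 0 else r * coeff ([:1, 2 * r, 1:] ^ N) (b - 1)))"
proof -
  let ?Q = "[:1, 2 * r, 1:]"
  have "smult (2 * real (Suc N)) (?Q ^ Suc N) - [:0, 1:] * pderiv (?Q ^ Suc N)
      = smult (2 * real (Suc N)) ([:1, r:] * ?Q ^ N)"
  proof -
    have "poly (smult (2 * real (Suc N)) (?Q ^ Suc N) - [:0, 1:] * pderiv (?Q ^ Suc N)) x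
      = poly (smult (2 * real (Suc N)) ([:1, r:] * ?Q ^ N)) x" for x
      by (simp add: pderiv_power_Suc pderiv_pCons algebra_simps del: power_Suc) (simp add: algebra_simps)
    then show ?thesis by (metis poly_eq_poly_eq_iff ext)
  qed
  from arg_cong[OF this, of "\<lambda>P. coeff P b"] show ?thesis
    by (cases b) (auto simp: coeff_pderiv algebra_simps simp del: power_Suc)
qed

text \<open>Some orthogonal map sends a fixed unit vector, scaled by \<open>norm u\<close>, to u.
  The constants stay unspecified: only the ratio of consecutive even ones will matter.\<close>

lemma sphere_moment_power:
  "\<exists>c. \<forall>n (u :: real ^ 'p::finite). (LINT x|uniform_sphere. (u \<bullet> x) ^ n) = c n * norm u ^ n"
proof -
  \<comment> \<open>Any coordinate direction serves; \<open>undefined\<close> merely picks some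
    index.\<close>
  define e :: "real ^ 'p" where "e = axis undefined 1"
  have e: "norm e = 1" unfolding e_def by (rule norm_axis_1)
  have *: "(LINT x|uniform_sphere. (u \<bullet> x) ^ n) = (LINT x|uniform_sphere. (e \<bullet> x) ^ n) * norm u ^ n" for n and u :: "real ^ 'p"
  proof -
    obtain T :: "real ^ 'p \<Rightarrow> real ^ 'p" where T: "orthogonal_transformation T" "T (norm u *\<^sub>R e) = u"
      by (rule orthogonal_transformation_exists[of "norm u *\<^sub>R e" u]) (simp_all add: e)
    have "(LINT x|uniform_sphere. (u \<bullet> x) ^ n) = (LINT x|uniform_sphere. (u \<bullet> T x) ^ n)"
      by (rule integral_uniform_sphere_orthogonal_transformation[OF T(1), symmetric]) measurable
    also have "\<dots> = (LINT x|uniform_sphere. (norm u * (e \<bullet> x)) ^ n)"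
    proof -
      have "u \<bullet> T x = norm u * (e \<bullet> x)" for x
      proof -
        have "u \<bullet> T x = T (norm u *\<^sub>R e) \<bullet> T x" by (simp only: T(2))
        also have "\<dots> = norm u *\<^sub>R e \<bullet> x" using T(1) unfolding orthogonal_transformation_def by blast
        finally show ?thesis by simp
      qed
      then show ?thesis by simp
    qed
    also have "\<dots> = (LINT x|uniform_sphere. (e \<bullet> x) ^ n * norm u ^ n)"
      by (simp add: power_mult_distrib mult.commute)
    finally show ?thesis by simp
  qed
  show ?thesis by (intro exI[of _ "\<lambda>n. LINT x|uniform_sphere. (e \<bullet> x) ^ n"] allI) (rule *)
qed

definition sphere_moment :: "real ^ 'p::finite \<Rightarrow> real ^ 'p \<Rightarrow> nat \<Rightarrow> nat \<Rightarrow> real" where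
  "sphere_moment u w a b = (LINT x|uniform_sphere. (u \<bullet> x) ^ a * (w \<bullet> x) ^ b)"

lemma integrable_sphere_moment [simp]:
  fixes u w :: "real ^ 'p::finite"
  shows "integrable uniform_sphere (\<lambda>x. (u \<bullet> x) ^ a * (w \<bullet> x) ^ b)"
  by (intro integrable_uniform_sphere continuous_intros)

text \<open>The antipodal map is orthogonal and flips the sign of the integrand.\<close>

lemma sphere_moment_odd:
  assumes "odd (a + b)"
  shows "sphere_moment u w a b = 0"
proof -
  have "sphere_moment u w a b = (LINT x|uniform_sphere. (u \<bullet> - x) ^ a * (w \<bullet> - x) ^ b)"
    unfolding sphere_moment_def
    by (rule integral_uniform_sphere_orthogonal_transformation
          [where T = uminus and \<phi> = "\<lambda>x. (u \<bullet> x) ^ a * (w \<bullet> x) ^ b", symmetric])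
       (auto simp: orthogonal_transformation linear_uminus)
  also have "\<dots> = (LINT x|uniform_sphere. - ((u \<bullet> x) ^ a * (w \<bullet> x) ^ b))"
    using assms by (cases "even a") (simp_all add: uminus_power_if)
  finally show ?thesis by (simp add: sphere_moment_def)
qed

lemma poly_eqI_values:
  fixes P Q :: "real poly"
  assumes "\<And>x. poly P x = poly Q x"
  shows "P = Q"
  using assms by (metis poly_eq_poly_eq_iff ext)

text \<open>Polarization: expand \<open>\<integral> ((u + t w) \<bullet> x) ^ n = c n * norm (u + t w) ^ n\<close> in powers of \<open>t\<close>.\<close>

lemma sphere_moment_polarize:
  fixes u w :: "real ^ 'p::finite"
  assumes c: "\<And>n (u :: real ^ 'p). (LINT x|uniform_sphere. (u \<bullet> x) ^ n) = c n * norm u ^ n"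
    and u: "norm u = 1" and w: "norm w = 1" and b: "b \<le> 2 * N"
  shows "real (2 * N choose b) * sphere_moment u w (2 * N - b) b =
    c (2 * N) * coeff ([:1, 2 * (u \<bullet> w), 1:] ^ N) b"
proof -
  let ?n = "2 * N"
  let ?P = "\<Sum>b\<le>?n. monom (real (?n choose b) * sphere_moment u w (?n - b) b) b"
  have "poly ?P t = poly (smult (c ?n) ([:1, 2 * (u \<bullet> w), 1:] ^ N)) t" for t
  proof -
    have "poly ?P t = (\<Sum>b\<le>?n. (LINT x|uniform_sphere. real (?n choose b) * t ^ b * ((u \<bullet> x) ^ (?n - b) * (w \<bullet> x) ^ b)))"
      by (simp add: poly_sum poly_monom sphere_moment_def mult.assoc mult.left_commute[of _ "t ^ _"] mult.commute[of _ "t ^ _"])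
    also have "\<dots> = (LINT x|uniform_sphere. (\<Sum>b\<le>?n. real (?n choose b) * t ^ b * ((u \<bullet> x) ^ (?n - b) * (w \<bullet> x) ^ b)))"
      by (subst Bochner_Integration.integral_sum) auto
    also have "\<dots> = (LINT x|uniform_sphere. ((u + t *\<^sub>R w) \<bullet> x) ^ ?n)"
    proof (intro Bochner_Integration.integral_cong refl)
      fix x
      have "((u + t *\<^sub>R w) \<bullet> x) ^ ?n = (t * (w \<bullet> x) + u \<bullet> x) ^ ?n"
        by (simp add: inner_add_left add.commute)
      also have "\<dots> = (\<Sum>b\<le>?n. real (?n choose b) * t ^ b * ((u \<bullet> x) ^ (?n - b) * (w \<bullet> x) ^ b))"
        unfolding binomial_ring power_mult_distrib by (simp only: ac_simps)
      finally show "(\<Sum>b\<le>?n. real (?n choose b) * t ^ b * ((u \<bullet> x) ^ (?n - b) * (w \<bullet> x) ^ b))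
          = ((u + t *\<^sub>R w) \<bullet> x) ^ ?n" ..
    qed
    also have "\<dots> = c ?n * ((norm (u + t *\<^sub>R w))\<^sup>2) ^ N"
      by (simp only: c power_mult[symmetric])
    also have "(norm (u + t *\<^sub>R w))\<^sup>2 = 1 + t * (2 * (u \<bullet> w) + t)"
    proof -
      have "u \<bullet> u = 1" "w \<bullet> w = 1" using u w by (simp_all add: norm_eq_1)
      then show ?thesis
        by (simp add: power2_norm_eq_inner inner_add_left inner_add_right inner_commute[of w u] distrib_left)
    qed
    finally show ?thesis by simp
  qed
  then have "?P = smult (c ?n) ([:1, 2 * (u \<bullet> w), 1:] ^ N)" by (rule poly_eqI_values)
  from arg_cong[OF this, of "\<lambda>P. coeff P b"] b show ?thesis
    by (simp add: coeff_sum sum.delta)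
qed

text \<open>Polarization at b = 2 is summed over an orthonormal basis in place of w. On the sphere
  the squared coordinates add up to 1, which lowers the order of the moment by two; on the algebraic
  side the summation produces the dimension.\<close>

lemma sphere_moment_const_Suc:
  assumes c: "\<And>n (u :: real ^ 'p::finite). (LINT x|uniform_sphere. (u \<bullet> x) ^ n) = c n * norm u ^ n"
  shows "(2 * real N + real CARD('p)) * c (2 * Suc N) = (2 * real N + 1) * c (2 * N)"
proof -
  obtain u :: "real ^ 'p" where u: "norm u = 1" by (rule vector_choose_size[of 1]) simp_all
  have "real (2 * Suc N choose 2) * sphere_moment u e (2 * N) 2 =
    c (2 * Suc N) * (real (Suc N) + 2 * real (Suc N) * real N * (u \<bullet> e)\<^sup>2)" if "e \<in> Basis" for e
  proof -
    have "2 * Suc N - 2 = 2 * N" "real (Suc N) - 1 = real N" "2 \<le> 2 * Suc N" by simp_all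
    then show ?thesis
      using sphere_moment_polarize[OF c u norm_Basis[OF that], of 2 "Suc N"] by (simp only: coeff_quadratic_power(3))
  qed
  then have "real (2 * Suc N choose 2) * (\<Sum>e\<in>Basis. sphere_moment u e (2 * N) 2) =
     (\<Sum>e\<in>Basis. c (2 * Suc N) * (real (Suc N) + 2 * real (Suc N) * real N * (u \<bullet> e)\<^sup>2))"
    by (simp add: sum_distrib_left)
  also have "\<dots> = c (2 * Suc N) * (real (Suc N) * real CARD('p) + 2 * real (Suc N) * real N)"
  proof -
    have "(\<Sum>e\<in>Basis. (u \<bullet> e)\<^sup>2) = 1"
      using u euclidean_inner[of u u] by (simp add: power2_eq_square norm_eq_1)
    then show ?thesis
      by (simp add: sum_distrib_left[symmetric] sum.distrib)
  qed
  also have "(\<Sum>e\<in>Basis. sphere_moment u e (2 * N) 2) = (LINT x|uniform_sphere. (\<Sum>e\<in>Basis. (u \<bullet> x) ^ (2 * N) * (e \<bullet> x)\<^sup>2))"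
    unfolding sphere_moment_def by (subst Bochner_Integration.integral_sum) auto
  also have "\<dots> = (LINT x|uniform_sphere. (u \<bullet> x) ^ (2 * N))"
  proof (rule Bochner_Integration.integral_cong[OF refl])
    fix x :: "real ^ 'p" assume "x \<in> space uniform_sphere"
    then have "(\<Sum>e\<in>Basis. (e \<bullet> x)\<^sup>2) = 1"
      using euclidean_inner[of x x] by (simp add: power2_eq_square norm_eq_1 inner_commute)
    then show "(\<Sum>e\<in>Basis. (u \<bullet> x) ^ (2 * N) * (e \<bullet> x)\<^sup>2) = (u \<bullet> x) ^ (2 * N)"
      by (simp add: sum_distrib_left[symmetric])
  qed
  also have "\<dots> = c (2 * N)" by (simp add: c u)
  also have "real (2 * Suc N choose 2) = real (Suc N) * (2 * real N + 1)"
  proof -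
    have "2 * Suc N choose 2 = Suc N * (2 * N + 1)" by (simp add: choose_two)
    then have "real (2 * Suc N choose 2) = real (Suc N) * real (2 * N + 1)" by (simp only: of_nat_mult)
    then show ?thesis by simp
  qed
  finally have "real (Suc N) * ((2 * real N + 1) * c (2 * N)) = real (Suc N) * ((2 * real N + real CARD('p)) * c (2 * Suc N))"
    by (simp add: algebra_simps)
  then show ?thesis by (subst (asm) mult_left_cancel) auto
qed

text \<open>This is integration by parts on the sphere for the tangential derivative in direction u
  of (u . x)^a (w . x)^b. It is obtained from the coefficient identity for Q^(N+1) and the ratio of
  the moment constants.\<close>

lemma sphere_moment_recurrence:
  fixes u w :: "real ^ 'p::finite"
  assumes u: "norm u = 1" and w: "norm w = 1"
  shows "(real a + real b + real CARD('p) - 1) * sphere_moment u w (Suc a) b =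
    real a * sphere_moment u w (a - 1) b + real b * (u \<bullet> w) * sphere_moment u w a (b - 1)"
proof (cases "odd (Suc a + b)")
  case True
  \<comment> \<open>If a or b is 0, truncated subtraction changes the parity of the index, but the
    factor in front vanishes.\<close>
  have z: "real a * sphere_moment u w (a - 1) b = 0" "real b * (u \<bullet> w) * sphere_moment u w a (b - 1) = 0"
    using True by (cases a; cases b; simp add: sphere_moment_odd)+
  have "sphere_moment u w (Suc a) b = 0" using True by (rule sphere_moment_odd)
  then show ?thesis unfolding z by simp
next
  case False
  then obtain M where M: "Suc a + b = 2 * M" by blast
  then obtain N where N: "Suc a + b = 2 * Suc N" by (cases M) auto
  obtain c where c: "\<And>n (u :: real ^ 'p). (LINT x|uniform_sphere. (u \<bullet> x) ^ n) = c n * norm u ^ n"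
    using sphere_moment_power by metis
  let ?\<rho> = "u \<bullet> w" and ?m = "sphere_moment u w" and ?p = "real CARD('p)"
  let ?g = "\<lambda>N b. coeff ([:1, 2 * (u \<bullet> w), 1:] ^ N) b"
  let ?C = "real (2 * Suc N choose b)"
  have a: "real a = 2 * real N + 1 - real b" using arg_cong[OF N, of real] by simp
  have m0: "?C * ?m (Suc a) b = c (2 * Suc N) * ?g (Suc N) b"
  proof -
    have "2 * Suc N - b = Suc a" "b \<le> 2 * Suc N" using N by auto
    then show ?thesis using sphere_moment_polarize[OF c u w, of b "Suc N"] by simp
  qed
  \<comment> \<open>Absorption identities trade the binomial of order 2N + 2 for the one of order 2N
    that polarization attaches to the lower moment; \<open>m2\<close> does the same for the moment
    with b lowered.\<close>
  have m1: "real (2 * N + 2) * real (2 * N + 1) * (c (2 * N) * ?g N b) = ?C * (real (Suc a) * (real a * ?m (a - 1) b))"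
  proof (cases a)
    case 0
    \<comment> \<open>Here b = 2N + 1 exceeds the degree of the N-th power, so both sides are
      0.\<close>
    have "degree ([:1, 2 * (u \<bullet> w), 1:] ^ N) = 2 * N" by (subst degree_power_eq) auto
    then show ?thesis using 0 N by (simp add: coeff_eq_0)
  next
    case (Suc k)
    have b: "2 * Suc N - b = Suc (Suc k)" "2 * N - b = k" "Suc (2 * N) - b = Suc k" "b \<le> 2 * N" using N Suc by auto
    have e1: "Suc (Suc k) * (2 * Suc N choose b) = (2 * N + 2) * (Suc (2 * N) choose b)"
      using binomial_absorb_comp[of "Suc (Suc (2 * N))" b] b by simp
    have e2: "Suc k * (Suc (2 * N) choose b) = (2 * N + 1) * (2 * N choose b)"
      using binomial_absorb_comp[of "Suc (2 * N)" b] b by simp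
    have "real (2 * N + 2) * real (2 * N + 1) * real (2 * N choose b) = real (2 * N + 2) * real ((2 * N + 1) * (2 * N choose b))"
      by (simp only: of_nat_mult mult.assoc)
    also have "\<dots> = real (Suc k) * real ((2 * N + 2) * (Suc (2 * N) choose b))"
      unfolding e2[symmetric] by (simp only: of_nat_mult mult.left_commute)
    also have "\<dots> = ?C * (real (Suc a) * real a)"
      unfolding e1[symmetric] Suc by (simp only: of_nat_mult ac_simps)
    finally have main: "real (2 * N + 2) * real (2 * N + 1) * (real (2 * N choose b) * ?m k b) = ?C * (real (Suc a) * (real a * ?m k b))"
      by (simp only: mult.assoc[symmetric])
    have pol: "real (2 * N choose b) * ?m k b = c (2 * N) * ?g N b" "a - 1 = k"
      using sphere_moment_polarize[OF c u w b(4)] Suc b(2) by simp_all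
    show ?thesis unfolding pol(1)[symmetric] unfolding pol(2) by (rule main)
  qed
  have m2: "real (2 * N + 2) * real (2 * N + 1) * (c (2 * N) * (if b = 0 then 0 else ?g N (b - 1)))
      = ?C * (real (Suc a) * (real b * ?m a (b - 1)))"
  proof (cases b)
    case (Suc k)
    have k: "2 * N - k = a" "Suc (2 * N) - k = Suc a" "k \<le> 2 * N" using N Suc by auto
    have e1: "Suc k * (2 * Suc N choose Suc k) = (2 * N + 2) * (Suc (2 * N) choose k)"
      using Suc_times_binomial[of k "Suc (2 * N)"] by simp
    have e2: "Suc a * (Suc (2 * N) choose k) = (2 * N + 1) * (2 * N choose k)"
      using binomial_absorb_comp[of "Suc (2 * N)" k] k by simp
    have "real (2 * N + 2) * real (2 * N + 1) * real (2 * N choose k) = real (2 * N + 2) * real ((2 * N + 1) * (2 * N choose k))"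
      by (simp only: of_nat_mult mult.assoc)
    also have "\<dots> = real (Suc a) * real ((2 * N + 2) * (Suc (2 * N) choose k))"
      unfolding e2[symmetric] by (simp only: of_nat_mult mult.left_commute)
    also have "\<dots> = ?C * (real (Suc a) * real b)"
      unfolding e1[symmetric] Suc by (simp only: of_nat_mult ac_simps)
    finally have main: "real (2 * N + 2) * real (2 * N + 1) * (real (2 * N choose k) * ?m a k) = ?C * (real (Suc a) * (real b * ?m a k))"
      by (simp only: mult.assoc[symmetric])
    have pol: "real (2 * N choose k) * ?m a k = c (2 * N) * (if b = 0 then 0 else ?g N (b - 1))" "b - 1 = k"
      using sphere_moment_polarize[OF c u w k(3)] Suc k(1) by simp_all
    show ?thesis unfolding pol(1)[symmetric] unfolding pol(2) by (rule main)
  qed simp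
  have ab: "real a + real b + ?p - 1 = 2 * real N + ?p" and a1: "2 * real (Suc N) - real b = real (Suc a)"
    using a by auto
  have "(?C * real (Suc a)) * ((real a + real b + ?p - 1) * ?m (Suc a) b)
     = (2 * real N + ?p) * (real (Suc a) * (?C * ?m (Suc a) b))"
    unfolding ab by (simp only: ac_simps)
  also have "\<dots> = (2 * real N + ?p) * c (2 * Suc N) * (real (Suc a) * ?g (Suc N) b)"
    unfolding m0 by (simp only: ac_simps)
  also have "real (Suc a) * ?g (Suc N) b = real (2 * N + 2) * (?g N b + ?\<rho> * (if b = 0 then 0 else ?g N (b - 1)))"
    using coeff_quadratic_power_Suc[of N b "?\<rho>"] unfolding a1 by (cases "b = 0") (simp_all del: power_Suc)
  also have "(2 * real N + ?p) * c (2 * Suc N) = real (2 * N + 1) * c (2 * N)"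
    using sphere_moment_const_Suc[OF c, of N] by simp
  also have "real (2 * N + 1) * c (2 * N) * (real (2 * N + 2) * (?g N b + ?\<rho> * (if b = 0 then 0 else ?g N (b - 1))))
     = real (2 * N + 2) * real (2 * N + 1) * (c (2 * N) * ?g N b)
      + ?\<rho> * (real (2 * N + 2) * real (2 * N + 1) * (c (2 * N) * (if b = 0 then 0 else ?g N (b - 1))))"
    by (simp add: algebra_simps)
  also have "\<dots> = (?C * real (Suc a)) * (real a * ?m (a - 1) b + real b * ?\<rho> * ?m a (b - 1))"
    unfolding m1 m2 by (simp add: algebra_simps)
  finally have "(?C * real (Suc a)) * ((real a + real b + ?p - 1) * ?m (Suc a) b)
     = (?C * real (Suc a)) * (real a * ?m (a - 1) b + real b * ?\<rho> * ?m a (b - 1))" .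
  moreover have "?C * real (Suc a) \<noteq> 0" using N by simp
  ultimately show ?thesis by (subst (asm) mult_left_cancel)
qed

section \<open>The reproducing property of the zonal kernels\<close>

definition sphere_form :: "real ^ 'p::finite \<Rightarrow> real ^ 'p \<Rightarrow> real poly \<Rightarrow> real poly \<Rightarrow> real" where
  "sphere_form u w P Q = (LINT x|uniform_sphere. poly P (u \<bullet> x) * poly Q (w \<bullet> x))"

lemma integrable_sphere_form:
  fixes u w :: "real ^ 'p::finite"
  shows "integrable uniform_sphere (\<lambda>x. poly P (u \<bullet> x) * poly Q (w \<bullet> x))"
  by (intro integrable_uniform_sphere continuous_intros)

lemma sphere_form_commute: "sphere_form u w P Q = sphere_form w u Q P"
  unfolding sphere_form_def by (simp only: mult.commute)

lemma sphere_form_add_left: "sphere_form u w (P + P') Q = sphere_form u w P Q + sphere_form u w P' Q"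
  unfolding sphere_form_def
  by (subst Bochner_Integration.integral_add[symmetric])
     (auto intro: integrable_sphere_form simp: distrib_right)

lemma sphere_form_smult_left: "sphere_form u w (smult c P) Q = c * sphere_form u w P Q"
  unfolding sphere_form_def by (simp add: mult.assoc)

lemma sphere_form_add_right: "sphere_form u w P (Q + Q') = sphere_form u w P Q + sphere_form u w P Q'"
  by (metis sphere_form_commute sphere_form_add_left)

lemma sphere_form_smult_right: "sphere_form u w P (smult c Q) = c * sphere_form u w P Q"
  by (metis sphere_form_commute sphere_form_smult_left)

lemma sphere_form_0 [simp]: "sphere_form u w 0 Q = 0" "sphere_form u w P 0 = 0"
  by (simp_all add: sphere_form_def)

lemmas sphere_form_linear =
  sphere_form_add_left sphere_form_add_right sphere_form_smult_left sphere_form_smult_right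

lemma sphere_form_monom: "sphere_form u w (monom 1 a) (monom 1 b) = sphere_moment u w a b"
  by (simp add: sphere_form_def sphere_moment_def poly_monom)

lemma poly_linear_functional_eqI:
  fixes f g :: "real poly \<Rightarrow> real"
  assumes "\<And>P Q. f (P + Q) = f P + f Q" "\<And>c P. f (smult c P) = c * f P"
    and "\<And>P Q. g (P + Q) = g P + g Q" "\<And>c P. g (smult c P) = c * g P"
    and eq: "\<And>n. f (monom 1 n) = g (monom 1 n)"
  shows "f P = g P"
proof (induction P)
  case 0
  then show ?case using assms(2)[of 0 0] assms(4)[of 0 0] by simp
next
  case (pCons a P)
  \<comment> \<open>The extra monomial is the induction load: peeling off a coefficient shifts the
    remaining polynomial by one power.\<close>
  have "f (Q * monom 1 n) = g (Q * monom 1 n)" for Q n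
  proof (induction Q arbitrary: n)
    case 0
    then show ?case using assms(2)[of 0 0] assms(4)[of 0 0] by simp
  next
    case (pCons b Q)
    have "pCons b Q * monom 1 n = smult b (monom 1 n) + Q * monom 1 (Suc n)"
      by (simp add: monom_Suc mult_pCons_left)
    then show ?case by (simp add: assms pCons)
  qed
  from this[of "pCons a P" 0] show ?case by simp
qed

section \<open>The zonal Laplace operator and Green's formula\<close>

text \<open>The Laplace-Beltrami operator of the unit sphere in dimension p, restricted to functions
  of u . x and written in that variable.\<close>

definition ultra_op :: "nat \<Rightarrow> real poly \<Rightarrow> real poly" where
  "ultra_op p P = [:1, 0, -1:] * pderiv (pderiv P) - smult (real p - 1) ([:0, 1:] * pderiv P)"

lemma ultra_op_add: "ultra_op p (P + Q) = ultra_op p P + ultra_op p Q"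
  by (simp add: ultra_op_def pderiv_add algebra_simps smult_add_right)

lemma ultra_op_smult: "ultra_op p (smult c P) = smult c (ultra_op p P)"
  by (rule poly_eqI_values) (simp add: ultra_op_def pderiv_smult algebra_simps)

text \<open>Green's formula: the tangential gradient of P(u . x) is P'(u . x) (u - (u . x) x), and
  the right-hand side is minus the integral of the product of two such gradients. By bilinearity
  monomials suffice, where it becomes the moment recurrence.\<close>

lemma sphere_form_ultra_op:
  fixes u w :: "real ^ 'p::finite"
  assumes u: "norm u = 1" and w: "norm w = 1"
  shows "sphere_form u w (ultra_op CARD('p) P) Q =
    sphere_form u w ([:0, 1:] * pderiv P) ([:0, 1:] * pderiv Q) - (u \<bullet> w) * sphere_form u w (pderiv P) (pderiv Q)"
proof (rule poly_linear_functional_eqI[where P = P])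
  fix a
  show "sphere_form u w (ultra_op CARD('p) (monom 1 a)) Q =
    sphere_form u w ([:0, 1:] * pderiv (monom 1 a)) ([:0, 1:] * pderiv Q)
      - (u \<bullet> w) * sphere_form u w (pderiv (monom 1 a)) (pderiv Q)"
  proof (rule poly_linear_functional_eqI[where P = Q])
    fix b
    let ?m = "sphere_moment u w"
    have X: "[:0, 1:] * monom c n = smult c (monom 1 (Suc n))" for c :: real and n
      by (simp add: monom_Suc smult_monom)
    have D: "pderiv (monom 1 n :: real poly) = smult (real n) (monom 1 (n - 1))" for n
      by (simp add: pderiv_monom smult_monom)
    have XD: "[:0, 1:] * pderiv (monom 1 n :: real poly) = smult (real n) (monom 1 n)" for n
      unfolding D by (cases n) (simp_all add: X del: of_nat_Suc mult_pCons_left)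
    have L: "ultra_op CARD('p) (monom 1 a) = smult (real a * (real a - 1)) (monom 1 (a - 2))
        + smult (- real a * (real a + real CARD('p) - 2)) (monom 1 a)"
    proof (rule poly_eqI_values)
      fix x :: real
      show "poly (ultra_op CARD('p) (monom 1 a)) x = poly (smult (real a * (real a - 1)) (monom 1 (a - 2))
        + smult (- real a * (real a + real CARD('p) - 2)) (monom 1 a)) x"
      proof (cases a)
        case (Suc c)
        then show ?thesis
          by (cases c) (simp_all add: ultra_op_def D pderiv_smult poly_monom algebra_simps power2_eq_square)
      qed (simp add: ultra_op_def)
    qed
    show "sphere_form u w (ultra_op CARD('p) (monom 1 a)) (monom 1 b) =
      sphere_form u w ([:0, 1:] * pderiv (monom 1 a)) ([:0, 1:] * pderiv (monom 1 b))
      - (u \<bullet> w) * sphere_form u w (pderiv (monom 1 a)) (pderiv (monom 1 b))"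
    proof (cases a)
      case 0
      then show ?thesis by (simp add: ultra_op_def)
    next
      case (Suc c)
      \<comment> \<open>The recurrence is taken at c = a - 1 and multiplied by a, the factor coming
        from the derivative of x^a.\<close>
      have "real a * ((real c + real b + real CARD('p) - 1) * ?m a b) =
          real a * (real c * ?m (c - 1) b + real b * (u \<bullet> w) * ?m c (b - 1))"
        using sphere_moment_recurrence[OF u w, of c b] Suc by simp
      moreover have "a - 2 = c - 1" "a - 1 = c" "real a = real c + 1" using Suc by auto
      ultimately show ?thesis
        unfolding L XD unfolding D sphere_form_linear sphere_form_monom
        by (simp only:) (simp add: algebra_simps)
    qed
  qed (unfold pderiv_add pderiv_smult distrib_left mult_smult_right sphere_form_linear, simp_all add: algebra_simps)
qed (unfold pderiv_add pderiv_smult ultra_op_add ultra_op_smult distrib_left mult_smult_right sphere_form_linear,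
    simp_all add: algebra_simps)

lemma ultra_op_harm_poly:
  "ultra_op p (harm_poly p k) = smult (- real k * (real k + real p - 2)) (harm_poly p k)"
proof (rule poly_eqI_values)
  fix x
  show "poly (ultra_op p (harm_poly p k)) x = poly (smult (- real k * (real k + real p - 2)) (harm_poly p k)) x"
    using harm_poly_eigen[of x p k] by (simp add: ultra_op_def power2_eq_square algebra_simps)
qed

lemma sphere_form_harm_poly_orthogonal:
  fixes u w :: "real ^ 'p::finite"
  assumes p: "CARD('p) \<ge> 2" and u: "norm u = 1" and w: "norm w = 1" and kl: "k \<noteq> l"
  shows "sphere_form u w (harm_poly CARD('p) k) (harm_poly CARD('p) l) = 0"
proof -
  let ?H = "harm_poly CARD('p)" and ?p = "real CARD('p)"
  have "sphere_form u w (ultra_op CARD('p) (?H k)) (?H l) = sphere_form w u (ultra_op CARD('p) (?H l)) (?H k)"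
    unfolding sphere_form_ultra_op[OF u w] sphere_form_ultra_op[OF w u]
    using sphere_form_commute inner_commute by metis
  then have "- real k * (real k + ?p - 2) * sphere_form u w (?H k) (?H l)
      = - real l * (real l + ?p - 2) * sphere_form u w (?H k) (?H l)"
    unfolding ultra_op_harm_poly sphere_form_linear using sphere_form_commute[of w u "?H l" "?H k"] by simp
  then have "((real k - real l) * (real k + real l + ?p - 2)) * sphere_form u w (?H k) (?H l) = 0"
    by (simp add: algebra_simps)
  \<comment> \<open>The eigenvalues differ by (k - l)(k + l + p - 2). Distinct degrees have k + l at
    least 1, which keeps the second factor positive even for p = 2.\<close>
  moreover have "real k + real l + ?p - 2 > 0"
  proof -
    have "real k + real l \<ge> 1" using kl by (cases k; cases l) auto
    then show ?thesis using p by linarith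
  qed
  ultimately show ?thesis using kl by simp
qed

lemma ultra_poly_conv_harm_poly:
  "ultra_poly p k = harm_poly p k + (if k < 2 then 0 else ultra_poly p (k - 2))"
  by (simp add: harm_poly_def)

text \<open>\<open>ultra_poly\<close> of degree l is the sum of the \<open>harm_poly\<close> of
  degrees l, l - 2, ..., all below k.\<close>

lemma sphere_form_harm_ultra:
  fixes u w :: "real ^ 'p::finite"
  assumes "CARD('p) \<ge> 2" "norm u = 1" "norm w = 1"
  shows "l < k \<Longrightarrow> sphere_form u w (harm_poly CARD('p) k) (ultra_poly CARD('p) l) = 0"
proof (induction l rule: less_induct)
  case (less l)
  then show ?case
    using assms by (subst ultra_poly_conv_harm_poly) (auto simp: sphere_form_linear sphere_form_harm_poly_orthogonal)
qed

text \<open>In Green's formula for P = Q = H_k the unknown B(H_k, H_k) occurs twice: with the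
  eigenvalue on the left, and on the right through x S_{k-1} = a H_k + S_{k-2}. The cross terms
  vanish by orthogonality and the rest has lower degree, so one linear equation remains to be
  solved.\<close>

lemma sphere_form_harm_poly_same:
  fixes u w :: "real ^ 'p::finite"
  assumes p: "CARD('p) \<ge> 2" and u: "norm u = 1" and w: "norm w = 1"
  shows "sphere_form u w (harm_poly CARD('p) k) (harm_poly CARD('p) k) = poly (harm_poly CARD('p) k) (u \<bullet> w)"
proof (induction k rule: less_induct)
  case (less k)
  let ?H = "harm_poly CARD('p)" and ?S = "ultra_poly CARD('p)" and ?p = "real CARD('p)" and ?B = "sphere_form u w"
  \<comment> \<open>The reproducing property passes from the H of degree below k to the S, which are
    sums of pairwise orthogonal H.\<close>
  have S: "?B (?S l) (?S l) = poly (?S l) (u \<bullet> w)" if "l < k" for l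
    using that
  proof (induction l rule: less_induct)
    case (less l)
    have "?B (?H l) (?S (l - 2)) = 0" "?B (?S (l - 2)) (?H l) = 0" if "\<not> l < 2"
      using that sphere_form_harm_ultra[OF p u w, of "l - 2" l] sphere_form_harm_ultra[OF p w u, of "l - 2" l]
        sphere_form_commute[of u w "?S (l - 2)"] by auto
    moreover have "?B (?S (l - 2)) (?S (l - 2)) = poly (?S (l - 2)) (u \<bullet> w)" if "\<not> l < 2"
      using less that by auto
    ultimately show ?case
      using \<open>\<And>y. y < k \<Longrightarrow> ?B (?H y) (?H y) = poly (?H y) (u \<bullet> w)\<close>[OF less.prems]
      by (simp add: ultra_poly_conv_harm_poly[of "CARD('p)" l] sphere_form_linear)
  qed
  show ?case
  proof (cases k)
    case 0
    interpret prob_space "uniform_sphere :: (real ^ 'p) measure" by (rule prob_space_uniform_sphere)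
    show ?thesis using 0 prob_space by (simp add: sphere_form_def)
  next
    case (Suc l)
    define R where "R = (if l = 0 then 0 else ?S (l - 1))"
    define a where "a = (real l + 1) / (2 * real l + ?p)"
    have pos: "2 * real l + ?p > 0" using p by linarith
    have x: "[:0, 1:] * ?S l = smult a (?H k) + R"
      by (rule poly_eqI_values)
         (use x_times_ultra_poly[of "CARD('p)" _ l] p Suc in \<open>auto simp: a_def R_def\<close>)
    have HR: "?B (?H k) R = 0" "?B R (?H k) = 0"
      using sphere_form_harm_ultra[OF p u w, of "l - 1" k] sphere_form_harm_ultra[OF p w u, of "l - 1" k]
        sphere_form_commute[of u w R] Suc by (auto simp: R_def)
    have RR: "?B R R = poly R (u \<bullet> w)"
      using S[of "l - 1"] Suc by (auto simp: R_def)
    have D: "pderiv (?H k) = smult (2 * real l + ?p) (?S l)"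
      unfolding Suc by (rule pderiv_harm_poly_Suc)
    have xD: "[:0, 1:] * pderiv (?H k) = smult (2 * real l + ?p) (smult a (?H k) + R)"
      unfolding D x[symmetric] by simp
    have "- real k * (real k + ?p - 2) * ?B (?H k) (?H k)
       = (2 * real l + ?p)\<^sup>2 * (a\<^sup>2 * ?B (?H k) (?H k) + (poly R (u \<bullet> w) - (u \<bullet> w) * poly (?S l) (u \<bullet> w)))"
      using sphere_form_ultra_op[OF u w, of "?H k" "?H k"] S[of l] Suc
      unfolding ultra_op_harm_poly xD unfolding D sphere_form_linear HR RR
      by (simp add: power2_eq_square algebra_simps)
    also have "poly R (u \<bullet> w) - (u \<bullet> w) * poly (?S l) (u \<bullet> w) = - a * poly (?H k) (u \<bullet> w)"
      using arg_cong[OF x, of "\<lambda>P. poly P (u \<bullet> w)"] by simp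
    finally have "- real k * (real k + ?p - 2) * ?B (?H k) (?H k) =
       ((2 * real l + ?p) * a)\<^sup>2 * ?B (?H k) (?H k) - ((2 * real l + ?p) * a) * (2 * real l + ?p) * poly (?H k) (u \<bullet> w)"
      by (simp add: power2_eq_square algebra_simps)
    also have "(2 * real l + ?p) * a = real k" using pos Suc by (simp add: a_def)
    \<comment> \<open>The coefficient is k^2 + k (k + p - 2), the sum of the contributions from the
      two sides; it is positive because k > 0.\<close>
    finally have "(real k * (2 * real k + ?p - 2)) * ?B (?H k) (?H k) = (real k * (2 * real l + ?p)) * poly (?H k) (u \<bullet> w)"
      by (simp add: power2_eq_square algebra_simps)
    also have "2 * real l + ?p = 2 * real k + ?p - 2" using Suc by simp
    finally show ?thesis using pos Suc by simp
  qed
qed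

text \<open>Multiplication by x turns H_l into a combination of H_{l+1} and, for l > 0, H_{l-1}.
  Hence x^j H_l contains only degrees up to l + j with the parity of l + j. The factor H_l carries
  the induction on j; the application is l = 0.\<close>

lemma sphere_form_harm_poly_power:
  fixes u w :: "real ^ 'p::finite"
  assumes p: "CARD('p) \<ge> 2" and u: "norm u = 1" and w: "norm w = 1"
  shows "l + j < k \<or> odd (k + l + j) \<Longrightarrow>
    sphere_form u w (harm_poly CARD('p) k) ([:0, 1:] ^ j * harm_poly CARD('p) l) = 0"
proof (induction j arbitrary: l)
  case 0
  then show ?case using sphere_form_harm_poly_orthogonal[OF p u w, of k l] by auto
next
  case (Suc j)
  let ?H = "harm_poly CARD('p)"
  have eq: "[:0, 1:] ^ Suc j * ?H l = [:0, 1:] ^ j * ([:0, 1:] * ?H l)"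
    by (simp only: power_Suc2 mult.assoc)
  show ?case
  proof (cases l)
    case 0
    have "[:0, 1:] * ?H l = smult (1 / real CARD('p)) (?H 1)"
      using 0 by simp
    with eq have eq': "[:0, 1:] ^ Suc j * ?H l = smult (1 / real CARD('p)) ([:0, 1:] ^ j * ?H 1)"
      by (simp only: mult_smult_right)
    have "sphere_form u w (?H k) ([:0, 1:] ^ j * ?H 1) = 0"
      using Suc.prems 0 by (intro Suc.IH) auto
    then show ?thesis unfolding eq' sphere_form_linear by simp
  next
    case (Suc m)
    obtain \<alpha> \<beta> where "[:0, 1:] * ?H l = smult \<alpha> (?H (Suc (Suc m))) + smult \<beta> (?H m)"
      using x_times_harm_poly[of "CARD('p)" m] p Suc by auto
    with eq have eq': "[:0, 1:] ^ Suc j * ?H l = smult \<alpha> ([:0, 1:] ^ j * ?H (Suc (Suc m))) + smult \<beta> ([:0, 1:] ^ j * ?H m)"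
      by (simp only: distrib_left mult_smult_right)
    have "sphere_form u w (?H k) ([:0, 1:] ^ j * ?H (Suc (Suc m))) = 0" "sphere_form u w (?H k) ([:0, 1:] ^ j * ?H m) = 0"
      using Suc.prems Suc by (auto intro!: Suc.IH simp del: harm_poly_simps)
    then show ?thesis unfolding eq' sphere_form_linear by simp
  qed
qed

section \<open>Reproducing kernels of finite trace\<close>

text \<open>The bound holds at every point of the space, so the property moves freely between
  measures with the same measurable sets, such as the uniform law and the sampling laws.\<close>

definition bounded_measurable :: "'a measure \<Rightarrow> ('a \<Rightarrow> real) \<Rightarrow> bool" where
  "bounded_measurable M g \<longleftrightarrow> g \<in> borel_measurable M \<and> (\<exists>B. \<forall>x\<in>space M. \<bar>g x\<bar> \<le> B)"

lemma bounded_measurable_mult [intro]: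
  assumes "bounded_measurable M f" "bounded_measurable M g"
  shows "bounded_measurable M (\<lambda>x. f x * g x)"
proof -
  obtain A B where "\<forall>x\<in>space M. \<bar>f x\<bar> \<le> A" "\<forall>x\<in>space M. \<bar>g x\<bar> \<le> B"
    using assms by (auto simp: bounded_measurable_def)
  then have "\<forall>x\<in>space M. \<bar>f x * g x\<bar> \<le> A * B"
    by (auto simp: abs_mult intro!: mult_mono order_trans[OF abs_ge_zero])
  then show ?thesis using assms by (auto simp: bounded_measurable_def)
qed

lemma bounded_measurable_const [intro, simp]: "bounded_measurable M (\<lambda>x. c)"
  by (auto simp: bounded_measurable_def)

lemma bounded_measurable_add [intro]:
  assumes "bounded_measurable M f" "bounded_measurable M g"
  shows "bounded_measurable M (\<lambda>x. f x + g x)"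
proof -
  obtain A B where "\<forall>x\<in>space M. \<bar>f x\<bar> \<le> A" "\<forall>x\<in>space M. \<bar>g x\<bar> \<le> B"
    using assms by (auto simp: bounded_measurable_def)
  then have "\<forall>x\<in>space M. \<bar>f x + g x\<bar> \<le> A + B"
    by (auto intro!: order_trans[OF abs_triangle_ineq] add_mono)
  then show ?thesis using assms by (auto simp: bounded_measurable_def)
qed

lemma bounded_measurable_diff [intro]:
  assumes "bounded_measurable M f" "bounded_measurable M g"
  shows "bounded_measurable M (\<lambda>x. f x - g x)"
  using bounded_measurable_add[OF assms(1) bounded_measurable_mult[OF bounded_measurable_const[of M "-1"] assms(2)]]
  by simp

lemma bounded_measurable_sum [intro]:
  assumes "\<And>i. i \<in> I \<Longrightarrow> bounded_measurable M (f i)"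
  shows "bounded_measurable M (\<lambda>x. \<Sum>i\<in>I. f i x)"
  using assms by (induction I rule: infinite_finite_induct) auto

lemma (in finite_measure) bounded_measurable_integrable:
  assumes "bounded_measurable M f"
  shows "integrable M f"
  using assms by (auto simp: bounded_measurable_def intro!: integrable_const_bound AE_I2)

text \<open>All identities hold pointwise, since single sections are selected and split off. The
  diagonal has a clause of its own because its integral, the trace, is the induction parameter and
  its measurability does not follow from that of the sections.\<close>

definition reproducing_kernel :: "'a measure \<Rightarrow> ('a \<Rightarrow> 'a \<Rightarrow> real) \<Rightarrow> bool" where
  "reproducing_kernel M h \<longleftrightarrow>
     (\<forall>u\<in>space M. \<forall>w\<in>space M. h u w = h w u) \<and>
     (\<forall>u\<in>space M. bounded_measurable M (h u)) \<and> bounded_measurable M (\<lambda>u. h u u) \<and>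
     (\<forall>u\<in>space M. \<forall>w\<in>space M. (LINT x|M. h u x * h w x) = h u w)"

text \<open>The diagonal value is the squared L2 norm of the section, so the section vanishes almost
  everywhere; the reproducing identity turns this into vanishing at every point.\<close>

lemma (in finite_measure) reproducing_kernel_eq_0:
  assumes h: "reproducing_kernel M h" and x: "x \<in> space M" "h x x = 0" and w: "w \<in> space M"
  shows "h w x = 0"
proof -
  have bm: "bounded_measurable M (h x)" using h x(1) by (auto simp: reproducing_kernel_def)
  have "(LINT y|M. h x y * h x y) = 0"
    using h x by (auto simp: reproducing_kernel_def)
  then have "AE y in M. h x y * h x y = 0"
    by (subst (asm) integral_nonneg_eq_0_iff_AE) (auto intro!: bounded_measurable_integrable bm)
  then have "(LINT y|M. h w y * h x y) = 0"
    by (intro integral_eq_zero_AE) auto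
  then show ?thesis using h x(1) w by (auto simp: reproducing_kernel_def)
qed

text \<open>The last clause states by duality that the \<open>g r\<close> belong to the span of the
  kernel sections: whatever is orthogonal to all sections is orthogonal to them. In this form
  orthogonality relations of kernels transfer directly to the basis.\<close>

definition kernel_basis :: "'a measure \<Rightarrow> ('a \<Rightarrow> 'a \<Rightarrow> real) \<Rightarrow> nat \<Rightarrow> (nat \<Rightarrow> 'a \<Rightarrow> real) \<Rightarrow> bool" where
  "kernel_basis M h d g \<longleftrightarrow>
    (\<forall>r<d. bounded_measurable M (g r)) \<and>
    (\<forall>r<d. \<forall>s<d. (LINT x|M. g r x * g s x) = (if r = s then 1 else 0)) \<and>
    (\<forall>u\<in>space M. \<forall>w\<in>space M. h u w = (\<Sum>r<d. g r u * g r w)) \<and>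
    (\<forall>\<phi>. bounded_measurable M \<phi> \<longrightarrow> (\<forall>u\<in>space M. (LINT x|M. h u x * \<phi> x) = 0) \<longrightarrow>
       (\<forall>r<d. (LINT x|M. g r x * \<phi> x) = 0))"

lemma kernel_basisD:
  assumes "kernel_basis M h d g"
  shows "r < d \<Longrightarrow> bounded_measurable M (g r)"
    and "r < d \<Longrightarrow> s < d \<Longrightarrow> (LINT x|M. g r x * g s x) = (if r = s then 1 else 0)"
    and "u \<in> space M \<Longrightarrow> w \<in> space M \<Longrightarrow> h u w = (\<Sum>r<d. g r u * g r w)"
    and "bounded_measurable M \<phi> \<Longrightarrow> (\<And>u. u \<in> space M \<Longrightarrow> (LINT x|M. h u x * \<phi> x) = 0) \<Longrightarrow>
      r < d \<Longrightarrow> (LINT x|M. g r x * \<phi> x) = 0"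
  using assms by (simp_all add: kernel_basis_def)

text \<open>
  Peeling off one normalised section \<open>h (\<cdot>, u)\<close> with \<open>h u u > 0\<close> leaves a reproducing kernel whose
  trace has dropped by one.
\<close>

lemma (in prob_space) reproducing_kernel_decomposition:
  assumes "reproducing_kernel M h" and "(LINT u|M. h u u) = real d"
  shows "\<exists>g. kernel_basis M h d g"
  using assms
proof (induction d arbitrary: h)
  case 0
  note h = 0(1)
  have bm: "bounded_measurable M (\<lambda>u. h u u)" using h by (auto simp: reproducing_kernel_def)
  have nn: "h u u \<ge> 0" if "u \<in> space M" for u
  proof -
    have "h u u = (LINT x|M. h u x * h u x)" using h that by (simp add: reproducing_kernel_def)
    also have "\<dots> \<ge> 0" by (intro Bochner_Integration.integral_nonneg) simp
    finally show ?thesis .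
  qed
  have "AE u in M. h u u = 0"
  proof -
    have "(LINT u|M. h u u) = 0 \<longleftrightarrow> (AE u in M. h u u = 0)"
      by (intro integral_nonneg_eq_0_iff_AE bounded_measurable_integrable bm AE_I2 nn)
    then show ?thesis using 0(2) by simp
  qed
  then have ae: "AE u in M. h w u = 0" if "w \<in> space M" for w
    using AE_space
  proof eventually_elim
    case (elim u)
    then show ?case using reproducing_kernel_eq_0[OF h] that by blast
  qed
  \<comment> \<open>Trace zero only controls the diagonal almost everywhere; integrating the square
    of the section at w recovers the value at the point w itself.\<close>
  have "h w w = 0" if "w \<in> space M" for w
  proof -
    have "h w w = (LINT x|M. h w x * h w x)" using h that by (simp add: reproducing_kernel_def)
    also have "\<dots> = 0" using ae[OF that] by (intro integral_eq_zero_AE) auto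
    finally show ?thesis .
  qed
  then have "\<forall>u\<in>space M. \<forall>w\<in>space M. h u w = 0"
    using reproducing_kernel_eq_0[OF h] by auto
  then show ?case by (auto simp: kernel_basis_def)
next
  case (Suc d)
  note h = Suc.prems(1)
  have sym: "h u w = h w u" and bm: "bounded_measurable M (h u)" and rep: "(LINT x|M. h u x * h w x) = h u w"
    if "u \<in> space M" "w \<in> space M" for u w
    using h that by (auto simp: reproducing_kernel_def)
  have bmd: "bounded_measurable M (\<lambda>u. h u u)" using h by (auto simp: reproducing_kernel_def)
  have "\<exists>z\<in>space M. h z z \<noteq> 0"
  proof (rule ccontr)
    assume "\<not> ?thesis"
    then have "(LINT u|M. h u u) = (LINT u|M. 0)" by (intro Bochner_Integration.integral_cong) auto
    then show False using Suc.prems(2) by simp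
  qed
  then obtain z where z: "z \<in> space M" "h z z \<noteq> 0" by blast
  have "h z z = (LINT x|M. h z x * h z x)" using rep z by simp
  also have "\<dots> \<ge> 0" by (intro Bochner_Integration.integral_nonneg) simp
  finally have pos: "h z z > 0" using z by simp
  \<comment> \<open>The section at z has squared norm \<open>h z z\<close>, so
    \<open>sqrt c * h z\<close> is a unit vector and \<open>h'\<close> is the kernel with this
    direction projected out.\<close>
  define c where "c = 1 / h z z"
  have c: "c > 0" "c * h z z = 1" using pos by (auto simp: c_def)
  define h' where "h' u w = h u w - c * h z u * h z w" for u w
  note bmz = bm[OF z(1) z(1)]
  have int: "integrable M (\<lambda>x. f x * g x)" if "bounded_measurable M f" "bounded_measurable M g" for f g
    using that by (auto intro: bounded_measurable_integrable)
  have expand: "(LINT x|M. h' u x * \<phi> x) = (LINT x|M. h u x * \<phi> x) - c * h z u * (LINT x|M. h z x * \<phi> x)"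
    if "bounded_measurable M \<phi>" "u \<in> space M" for \<phi> u
  proof -
    have "(LINT x|M. h' u x * \<phi> x) = (LINT x|M. h u x * \<phi> x - c * h z u * (h z x * \<phi> x))"
      by (simp add: h'_def algebra_simps)
    also have "\<dots> = (LINT x|M. h u x * \<phi> x) - c * h z u * (LINT x|M. h z x * \<phi> x)"
      using that bm by (subst Bochner_Integration.integral_diff) (auto intro: int bmz)
    finally show ?thesis .
  qed
  \<comment> \<open>Sections of \<open>h'\<close> are orthogonal to the removed direction. This
    makes \<open>h'\<close> reproducing, and through the span clause it makes the remaining basis
    functions orthogonal to the new one.\<close>
  have hz: "(LINT x|M. h' u x * h z x) = 0" if "u \<in> space M" for u
    using expand[OF bmz that] rep[OF that z(1)] rep[OF z(1) z(1)] sym[OF that z(1)] c by (simp add: mult.assoc mult.left_commute)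
  have bm': "bounded_measurable M (h' u)" if "u \<in> space M" for u
    unfolding h'_def[abs_def]
    by (intro bounded_measurable_diff bounded_measurable_mult bounded_measurable_const bmz bm[OF that that])
  have h': "reproducing_kernel M h'"
    unfolding reproducing_kernel_def
  proof (intro conjI ballI)
    fix u w assume u: "u \<in> space M" and w: "w \<in> space M"
    show "h' u w = h' w u" using sym[OF u w] by (simp add: h'_def)
    show "bounded_measurable M (h' u)" by (rule bm'[OF u])
    have "(LINT x|M. h' u x * h' w x) = (LINT x|M. h' u x * h w x - c * h z w * (h' u x * h z x))"
      by (simp add: h'_def algebra_simps)
    also have "\<dots> = (LINT x|M. h' u x * h w x) - c * h z w * (LINT x|M. h' u x * h z x)"
      using u w bm by (subst Bochner_Integration.integral_diff) (auto intro: int bmz bm')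
    also have "\<dots> = h' u w"
      using hz[OF u] expand[OF bm[OF w w] u] rep[OF u w] rep[OF z(1) w] by (simp add: h'_def)
    finally show "(LINT x|M. h' u x * h' w x) = h' u w" .
  next
    show "bounded_measurable M (\<lambda>u. h' u u)"
      unfolding h'_def by (intro bounded_measurable_diff bounded_measurable_mult bounded_measurable_const bmd bmz)
  qed
  have "(LINT u|M. h' u u) = (LINT u|M. h u u - c * (h z u * h z u))"
    by (simp add: h'_def mult.assoc)
  also have "\<dots> = real d"
    using Suc.prems(2) rep[OF z(1) z(1)] c
    by (subst Bochner_Integration.integral_diff) (auto intro: int bmz bmd bounded_measurable_integrable)
  finally obtain g where "kernel_basis M h' d g"
    using Suc.IH[OF h'] by blast
  note g = kernel_basisD[OF this]
  define G where "G r x = (if r < d then g r x else sqrt c * h z x)" for r x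
  have gz: "(LINT x|M. g r x * h z x) = 0" if "r < d" for r
    by (rule g(4)[OF bmz hz that])
  have zz: "(LINT x|M. h z x * h z x) = h z z" using rep z by simp
  show ?case
    unfolding kernel_basis_def
  proof (intro exI[of _ G] conjI allI impI ballI)
    fix r assume "r < Suc d"
    show "bounded_measurable M (G r)"
      unfolding G_def using g(1) by (cases "r < d") (auto intro: bmz)
  next
    fix r s assume "r < Suc d" "s < Suc d"
    then consider "r < d" "s < d" | "r < d" "s = d" | "r = d" "s < d" | "r = d" "s = d" by linarith
    then show "(LINT x|M. G r x * G s x) = (if r = s then 1 else 0)"
    proof cases
      case 1
      then show ?thesis by (simp add: G_def g(2))
    next
      case 2
      then show ?thesis using gz[of r] by (simp add: G_def mult.left_commute)
    next
      case 3
      then show ?thesis using gz[of s] by (simp add: G_def mult.assoc mult.commute[of "h z _"])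
    next
      case 4
      have "(LINT x|M. G d x * G d x) = (LINT x|M. (sqrt c * sqrt c) * (h z x * h z x))"
        by (simp add: G_def ac_simps)
      also have "\<dots> = 1" using c zz by simp
      finally show ?thesis using 4 by simp
    qed
  next
    fix u w assume u: "u \<in> space M" and w: "w \<in> space M"
    have "(\<Sum>r<Suc d. G r u * G r w) = h' u w + sqrt c * sqrt c * (h z u * h z w)"
      using g(3)[OF u w] by (simp add: G_def ac_simps)
    then show "h u w = (\<Sum>r<Suc d. G r u * G r w)" using c by (simp add: h'_def)
  next
    fix \<phi> r assume \<phi>: "bounded_measurable M \<phi>" "\<forall>u\<in>space M. (LINT x|M. h u x * \<phi> x) = 0" and "r < Suc d"
    have h'\<phi>: "(LINT x|M. h' u x * \<phi> x) = 0" if "u \<in> space M" for u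
      using expand[OF \<phi>(1) that] \<phi>(2) z that by simp
    show "(LINT x|M. G r x * \<phi> x) = 0"
    proof (cases "r < d")
      case True
      then show ?thesis using g(4)[OF \<phi>(1) h'\<phi> True] by (simp add: G_def)
    next
      case False
      then show ?thesis using \<phi>(2) z by (simp add: G_def mult.assoc)
    qed
  qed
qed

section \<open>Laplace transforms and weak convergence\<close>

lemma weak_conv_m_Laplace:
  fixes M_seq :: "nat \<Rightarrow> real measure" and M :: "real measure"
  assumes M_seq: "\<And>n. real_distribution (M_seq n)" and M: "real_distribution M"
    and nonneg_seq: "\<And>n. AE x in M_seq n. 0 \<le> x" and nonneg: "AE x in M. 0 \<le> x"
    and conv: "\<And>s :: nat. (\<lambda>n. LINT x|M_seq n. exp (- real s * x)) \<longlonglongrightarrow> (LINT x|M. exp (- real s * x))"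
  shows "weak_conv_m M_seq M"
proof (rule integral_cts_step_conv_imp_weak_conv[OF M_seq M])
  fix a b :: real assume ab: "a < b"
  \<comment> \<open>Substituting t = exp (-x) turns the step function into a function on the unit
    interval. The maximum keeps the logarithm finite at t = 0 and changes nothing else, since
    \<open>cts_step a b\<close> already vanishes from b on.\<close>
  define \<phi> where "\<phi> t = cts_step a b (- ln (max t (exp (- b - 1))))" for t
  have "continuous_on UNIV (cts_step a b)"
    by (intro uniformly_continuous_imp_continuous cts_step_uniformly_continuous ab)
  moreover have "continuous_on {0..1} (\<lambda>t. - ln (max t (exp (- b - 1))))"
    by (intro continuous_intros) (auto simp: max_def)
  ultimately have cont: "continuous_on {0..1} \<phi>"
    unfolding \<phi>_def by (rule continuous_on_compose2) auto
  have \<phi>: "\<phi> (exp (- z)) = cts_step a b z" for z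
    using ab by (cases "z \<le> b + 1") (auto simp: \<phi>_def max_def cts_step_def)
  show "(\<lambda>n. integral\<^sup>L (M_seq n) (cts_step a b)) \<longlonglongrightarrow> integral\<^sup>L M (cts_step a b)"
  proof (rule LIMSEQ_I)
    fix e :: real assume e: "e > 0"
    obtain g where g: "real_polynomial_function g" "\<And>t. t \<in> {0..1} \<Longrightarrow> \<bar>\<phi> t - g t\<bar> < e / 4"
      by (rule Stone_Weierstrass_real_polynomial_function[OF compact_Icc cont, of "e / 4"]) (use e in auto)
    obtain c N where cN: "g = (\<lambda>t. \<Sum>i\<le>N. c i * t ^ i)"
      using g(1) unfolding real_polynomial_function_iff_sum by blast
    have int: "integrable K (\<lambda>x. exp (- real s * x))" if "real_distribution K" "AE x in K. 0 \<le> x" for K s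
    proof -
      interpret real_distribution K by fact
      show ?thesis using that(2) by (intro integrable_const_bound[of _ 1]) (auto elim!: AE_mp)
    qed
    have g_eq: "g (exp (- x)) = (\<Sum>i\<le>N. c i * exp (- real i * x))" for x
      by (simp add: cN exp_of_nat_mult[symmetric])
    \<comment> \<open>Polynomials in exp (-x) are combinations of the given Laplace integrals. The
      approximation error does not depend on the law, hence it is uniform along the sequence and
      also applies to the limit.\<close>
    have close: "\<bar>integral\<^sup>L K (cts_step a b) - (LINT x|K. g (exp (- x)))\<bar> \<le> e / 4"
      if K: "real_distribution K" "AE x in K. 0 \<le> x" for K
    proof -
      interpret real_distribution K by fact
      have g_int: "integrable K (\<lambda>x. g (exp (- x)))"
        unfolding g_eq using int[OF K] by auto
      have "\<bar>integral\<^sup>L K (cts_step a b) - (LINT x|K. g (exp (- x)))\<bar> = \<bar>LINT x|K. cts_step a b x - g (exp (- x))\<bar>"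
        using g_int integrable_cts_step[OF ab] by simp
      also have "\<dots> \<le> (LINT x|K. \<bar>cts_step a b x - g (exp (- x))\<bar>)"
        by (rule integral_abs_bound)
      also have "\<dots> \<le> (LINT x|K. e / 4)"
      proof (rule integral_mono_AE)
        show "AE x in K. \<bar>cts_step a b x - g (exp (- x))\<bar> \<le> e / 4"
          using K(2)
        proof eventually_elim
          case (elim x)
          then show ?case using g(2)[of "exp (- x)"] \<phi>[of x] by simp
        qed
      qed (use g_int integrable_cts_step[OF ab] in auto)
      also have "\<dots> = e / 4" using prob_space by simp
      finally show ?thesis .
    qed
    have "(\<lambda>n. \<Sum>i\<le>N. c i * (LINT x|M_seq n. exp (- real i * x))) \<longlonglongrightarrow> (\<Sum>i\<le>N. c i * (LINT x|M. exp (- real i * x)))"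
      by (intro tendsto_intros conv)
    then have "(\<lambda>n. LINT x|M_seq n. g (exp (- x))) \<longlonglongrightarrow> (LINT x|M. g (exp (- x)))"
      unfolding g_eq using int[OF M_seq nonneg_seq] int[OF M nonneg]
      by (simp add: Bochner_Integration.integral_sum)
    then obtain n0 where n0: "\<forall>n\<ge>n0. norm ((LINT x|M_seq n. g (exp (- x))) - (LINT x|M. g (exp (- x)))) < e / 4"
      using LIMSEQ_D[of _ _ "e / 4"] e by force
    have "norm (integral\<^sup>L (M_seq n) (cts_step a b) - integral\<^sup>L M (cts_step a b)) < e" if "n \<ge> n0" for n
    proof -
      have "norm ((LINT x|M_seq n. g (exp (- x))) - (LINT x|M. g (exp (- x)))) < e / 4"
        using n0 that by blast
      with close[OF M_seq nonneg_seq, of n] close[OF M nonneg] e show ?thesis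
        unfolding real_norm_def by linarith
    qed
    then show "\<exists>n0. \<forall>n\<ge>n0. norm (integral\<^sup>L (M_seq n) (cts_step a b) - integral\<^sup>L M (cts_step a b)) < e" by blast
  qed
qed

section \<open>Quadratic forms of triangular arrays\<close>

text \<open>For c and w in the closed unit disc, c^n and w^n differ by at most n times the distance
  of c and w. Comparison with the real sequence w = 1 + z/n avoids complex logarithms.\<close>

lemma tendsto_power_exp_complex:
  fixes c :: "nat \<Rightarrow> complex" and z :: real
  assumes z: "z \<le> 0" and c: "\<forall>\<^sub>F n in sequentially. norm (c n) \<le> 1"
    and lim: "(\<lambda>n. of_nat n * (c n - 1)) \<longlonglongrightarrow> of_real z"
  shows "(\<lambda>n. c n ^ n) \<longlonglongrightarrow> of_real (exp z)"
proof -
  define w where "w n = 1 + z / real n" for n :: nat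
  have w: "(\<lambda>n. complex_of_real (w n ^ n)) \<longlonglongrightarrow> of_real (exp z)"
    unfolding w_def by (intro tendsto_of_real tendsto_exp_limit_sequentially)
  have "(\<lambda>n. c n ^ n - of_real (w n ^ n)) \<longlonglongrightarrow> 0"
  proof (rule Lim_null_comparison)
    \<comment> \<open>From n >= -z/2 on, 1 + z/n is at least -1; together with z <= 0 this places it
      in the unit disc.\<close>
    have "\<forall>\<^sub>F n in sequentially. real n \<ge> - z / 2 \<and> n > 0"
      by (intro eventually_conj eventually_gt_at_top eventually_compose_filterlim[OF eventually_ge_at_top filterlim_real_sequentially])
    with c show "\<forall>\<^sub>F n in sequentially. norm (c n ^ n - of_real (w n ^ n)) \<le> norm (of_nat n * (c n - 1) - of_real z)"
    proof eventually_elim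
      case (elim n)
      have "norm (complex_of_real (w n)) \<le> 1"
        using elim z unfolding norm_of_real by (auto simp: w_def abs_le_iff field_simps)
      then have "norm (c n ^ n - (complex_of_real (w n)) ^ n) \<le> n * norm (c n - complex_of_real (w n))"
        using elim by (intro norm_power_diff) auto
      also have "\<dots> = norm (of_nat n * (c n - complex_of_real (w n)))"
        by (simp add: norm_mult)
      also have "of_nat n * (c n - complex_of_real (w n)) = of_nat n * (c n - 1) - of_real z"
        using elim by (simp add: w_def field_simps)
      finally show ?case by simp
    qed
    show "(\<lambda>n. norm (of_nat n * (c n - 1) - of_real z)) \<longlonglongrightarrow> 0"
      using lim by (simp add: tendsto_norm_zero LIM_zero)
  qed
  from tendsto_add[OF this w] show ?thesis by simp
qed

lemma triangular_array_law:
  fixes U :: "nat \<Rightarrow> nat \<Rightarrow> 'a \<Rightarrow> 'b"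
  assumes array: "\<forall>\<^sub>F n in sequentially. prob_space (M n) \<and> prob_space.indep_vars (M n) (\<lambda>_. N) (U n) {1..n} \<and>
      (\<forall>m\<in>{1..n}. distr (M n) N (U n m) = P n)"
  shows "\<forall>\<^sub>F n in sequentially. n > 0 \<and> prob_space (P n) \<and> sets (P n) = sets N \<and> space (P n) = space N"
  using array eventually_gt_at_top[of 0]
proof eventually_elim
  case (elim n)
  then interpret prob_space "M n" by blast
  have 1: "1 \<in> {1..n}" using elim by simp
  then have "U n 1 \<in> M n \<rightarrow>\<^sub>M N" using elim by (auto simp: indep_vars_def)
  then have "prob_space (distr (M n) N (U n 1))" by (rule prob_space_distr)
  moreover have "distr (M n) N (U n 1) = P n" using elim 1 by blast
  ultimately show ?case using elim by (metis sets_distr space_distr)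
qed

text \<open>The uniform bound B replaces a Lindeberg condition: the third-order remainder of the
  exponential costs at most B^3/6 n^(-3/2) per factor, and n factors still tend to 0. The drift sqrt
  n times the mean vanishes in the limit, so the second moment can stand for the variance.\<close>

lemma char_triangular_array:
  fixes U :: "nat \<Rightarrow> nat \<Rightarrow> 'a \<Rightarrow> 'b" and \<gamma> :: "'b \<Rightarrow> real"
  assumes array: "\<forall>\<^sub>F n in sequentially. prob_space (M n) \<and> prob_space.indep_vars (M n) (\<lambda>_. N) (U n) {1..n} \<and>
      (\<forall>m\<in>{1..n}. distr (M n) N (U n m) = P n)"
    and \<gamma>: "bounded_measurable N \<gamma>" and s: "s \<ge> 0"
    and mean: "(\<lambda>n. sqrt (real n) * (LINT u|P n. \<gamma> u)) \<longlonglongrightarrow> 0"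
    and var: "(\<lambda>n. LINT u|P n. (\<gamma> u)\<^sup>2) \<longlonglongrightarrow> s"
  shows "(\<lambda>n. LINT \<omega>|M n. iexp ((\<Sum>m\<in>{1..n}. \<gamma> (U n m \<omega>)) / sqrt (real n))) \<longlonglongrightarrow> of_real (exp (- s / 2))"
proof -
  obtain B where B: "\<And>x. x \<in> space N \<Longrightarrow> \<bar>\<gamma> x\<bar> \<le> B" and \<gamma>_meas [measurable]: "\<gamma> \<in> borel_measurable N"
    using \<gamma> by (auto simp: bounded_measurable_def)
  define c where "c n = (LINT u|P n. iexp (\<gamma> u / sqrt (real n)))" for n
  note P = triangular_array_law[OF array]
  have char_eq: "\<forall>\<^sub>F n in sequentially. c n ^ n = (LINT \<omega>|M n. iexp ((\<Sum>m\<in>{1..n}. \<gamma> (U n m \<omega>)) / sqrt (real n)))"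
    using array
  proof eventually_elim
    case (elim n)
    then interpret prob_space "M n" by blast
    have ind: "indep_vars (\<lambda>_. N) (U n) {1..n}" using elim by blast
    then have rv [measurable]: "U n m \<in> M n \<rightarrow>\<^sub>M N" if "m \<in> {1..n}" for m
      using that by (auto simp: indep_vars_def)
    let ?X = "\<lambda>m \<omega>. \<gamma> (U n m \<omega>) / sqrt (real n)"
    have indX: "indep_vars (\<lambda>_. borel) ?X {1..n}"
      by (rule indep_vars_compose2[OF ind]) measurable
    have meas: "?X m \<in> borel_measurable (M n)" if "m \<in> {1..n}" for m
      using rv[OF that] by measurable
    have "(LINT \<omega>|M n. iexp ((\<Sum>m\<in>{1..n}. \<gamma> (U n m \<omega>)) / sqrt (real n)))
        = char (distr (M n) borel (\<lambda>\<omega>. \<Sum>m\<in>{1..n}. ?X m \<omega>)) 1"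
      unfolding char_def
      by (subst integral_distr) (auto intro!: borel_measurable_sum meas simp: sum_divide_distrib)
    also have "\<dots> = (\<Prod>m\<in>{1..n}. char (distr (M n) borel (?X m)) 1)"
      by (rule char_distr_sum[OF indX])
    also have "\<dots> = (\<Prod>m\<in>{1..n}. c n)"
    proof (rule prod.cong[OF refl])
      fix m assume m: "m \<in> {1..n}"
      have "char (distr (M n) borel (?X m)) 1 = (LINT \<omega>|M n. iexp (\<gamma> (U n m \<omega>) / sqrt (real n)))"
        unfolding char_def using meas[OF m] by (subst integral_distr) auto
      also have "\<dots> = (LINT u|distr (M n) N (U n m). iexp (\<gamma> u / sqrt (real n)))"
        using rv[OF m] by (subst integral_distr) auto
      finally show "char (distr (M n) borel (?X m)) 1 = c n"
        using elim m by (simp add: c_def)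
    qed
    also have "\<dots> = c n ^ n" by simp
    finally show ?case ..
  qed
  define m where "m n = (LINT u|P n. \<gamma> u)" for n
  define v where "v n = (LINT u|P n. (\<gamma> u)\<^sup>2)" for n
  have bound: "\<forall>\<^sub>F n in sequentially. norm (of_nat n * (c n - 1) - (\<i> * of_real (sqrt (real n) * m n) - of_real (v n / 2)))
      \<le> B ^ 3 / 6 / sqrt (real n)"
    using P
  proof eventually_elim
    case (elim n)
    then interpret prob_space "P n" by blast
    have sp: "sets (P n) = sets N" "space (P n) = space N" and n: "n > 0" using elim by auto
    have gm [measurable]: "\<gamma> \<in> borel_measurable (P n)" using \<gamma>_meas by (simp cong: measurable_cong_sets add: sp)
    have int1: "integrable (P n) \<gamma>" "integrable (P n) (\<lambda>u. (\<gamma> u)\<^sup>2)"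
    proof -
      show "integrable (P n) \<gamma>"
        using B sp(2) by (intro integrable_const_bound[of _ B] AE_I2) auto
      have "(\<gamma> u)\<^sup>2 \<le> B\<^sup>2" if "u \<in> space N" for u
        using power_mono[OF B[OF that] abs_ge_zero, of 2] by simp
      then show "integrable (P n) (\<lambda>u. (\<gamma> u)\<^sup>2)"
        using sp(2) by (intro integrable_const_bound[of _ "B\<^sup>2"] AE_I2) auto
    qed
    let ?t = "sqrt (real n)"
    have t: "?t > 0" "?t * ?t = real n" using n by auto
    have int2: "integrable (P n) (\<lambda>u. iexp (\<gamma> u / ?t))"
      by (rule integrable_const_bound[of _ 1]) auto
    let ?r = "\<lambda>u. iexp (\<gamma> u / ?t) - 1 - \<i> * of_real (\<gamma> u / ?t) + of_real ((\<gamma> u)\<^sup>2 / (2 * real n))"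
    have hr: "has_bochner_integral (P n) ?r (c n - 1 - \<i> * of_real (m n / ?t) + of_real (v n / (2 * real n)))"
    proof -
      have one: "has_bochner_integral (P n) (\<lambda>u. 1 :: complex) 1"
        using has_bochner_integral_integrable[of "P n" "\<lambda>u. 1 :: complex"] prob_space by simp
      have m: "has_bochner_integral (P n) \<gamma> (m n)" and v: "has_bochner_integral (P n) (\<lambda>u. (\<gamma> u)\<^sup>2) (v n)"
        and c: "has_bochner_integral (P n) (\<lambda>u. iexp (\<gamma> u / ?t)) (c n)"
        using int1 int2 by (auto simp: m_def v_def c_def intro: has_bochner_integral_integrable)
      show ?thesis
        by (intro has_bochner_integral_add has_bochner_integral_diff has_bochner_integral_mult_right
            has_bochner_integral_of_real has_bochner_integral_divide_zero one m v c)
    qed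
    have "norm (LINT u|P n. ?r u) \<le> (LINT u|P n. B ^ 3 / 6 / ?t ^ 3)"
    proof (rule order_trans[OF integral_norm_bound Bochner_Integration.integral_mono])
      fix u assume u: "u \<in> space (P n)"
      have "norm (?r u) = norm (iexp (\<gamma> u / ?t) - (\<Sum>k\<le>2. (\<i> * of_real (\<gamma> u / ?t)) ^ k / fact k))"
      proof -
        have "complex_of_real ?t * complex_of_real ?t = of_nat n"
          unfolding of_real_mult[symmetric] t(2) by simp
        then show ?thesis by (simp add: numeral_2_eq_2 power2_eq_square algebra_simps)
      qed
      also have "\<dots> \<le> \<bar>\<gamma> u / ?t\<bar> ^ Suc 2 / fact (Suc 2)" by (rule iexp_approx1)
      also have "\<dots> = \<bar>\<gamma> u\<bar> ^ 3 / 6 / ?t ^ 3"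
        using t by (simp add: numeral_3_eq_3 numeral_2_eq_2 field_simps)
      also have "\<dots> \<le> B ^ 3 / 6 / ?t ^ 3"
        using B[of u] u sp t by (intro divide_right_mono power_mono) auto
      finally show "norm (?r u) \<le> B ^ 3 / 6 / ?t ^ 3" .
    next
      show "integrable (P n) (\<lambda>u. norm (?r u))"
        using hr unfolding has_bochner_integral_iff by (intro integrable_norm) (rule conjunct1)
    qed simp
    then have *: "norm (c n - 1 - \<i> * of_real (m n / ?t) + of_real (v n / (2 * real n))) \<le> B ^ 3 / 6 / ?t ^ 3"
      unfolding has_bochner_integral_integral_eq[OF hr] using prob_space by simp
    have "of_nat n * (c n - 1) - (\<i> * of_real (?t * m n) - of_real (v n / 2))
       = of_nat n * (c n - 1 - \<i> * of_real (m n / ?t) + of_real (v n / (2 * real n)))"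
    proof -
      have "real n * (m n / ?t) = ?t * m n" using t by (simp add: field_simps)
      then have "of_nat n * (\<i> * complex_of_real (m n / ?t)) = \<i> * of_real (?t * m n)"
        by (metis (no_types, lifting) mult.left_commute of_real_mult of_real_of_nat_eq)
      moreover have "of_nat n * complex_of_real (v n / (2 * real n)) = of_real (v n / 2)"
        using n by (simp add: field_simps)
      ultimately show ?thesis by (simp add: algebra_simps)
    qed
    then have "norm (of_nat n * (c n - 1) - (\<i> * of_real (?t * m n) - of_real (v n / 2)))
       \<le> real n * (B ^ 3 / 6 / ?t ^ 3)"
      using mult_left_mono[OF *, of "real n"] by (simp add: norm_mult)
    also have "real n * (B ^ 3 / 6 / ?t ^ 3) = B ^ 3 / 6 / ?t"
      using t by (simp add: power3_eq_cube field_simps)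
    finally show ?case .
  qed
  have lim1: "(\<lambda>n. of_nat n * (c n - 1) - (\<i> * of_real (sqrt (real n) * m n) - of_real (v n / 2))) \<longlonglongrightarrow> 0"
  proof (rule Lim_null_comparison[OF bound])
    have "filterlim (\<lambda>n. sqrt (real n)) at_top sequentially"
      by (intro filterlim_compose[OF sqrt_at_top filterlim_real_sequentially])
    then show "(\<lambda>n. B ^ 3 / 6 / sqrt (real n)) \<longlonglongrightarrow> 0"
      by (intro tendsto_divide_0[OF tendsto_const] filterlim_at_top_imp_at_infinity)
  qed
  have lim2: "(\<lambda>n. \<i> * of_real (sqrt (real n) * m n) - of_real (v n / 2)) \<longlonglongrightarrow> \<i> * of_real 0 - of_real (s / 2)"
    using mean var unfolding m_def v_def by (intro tendsto_intros) auto
  have "(\<lambda>n. of_nat n * (c n - 1)) \<longlonglongrightarrow> of_real (- s / 2)"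
    using tendsto_add[OF lim1 lim2] by simp
  moreover have "\<forall>\<^sub>F n in sequentially. norm (c n) \<le> 1"
    using P
  proof eventually_elim
    case (elim n)
    then interpret prob_space "P n" by blast
    have "norm (c n) \<le> (LINT u|P n. norm (iexp (\<gamma> u / sqrt (real n))))"
      unfolding c_def by (rule integral_norm_bound)
    then show ?case using prob_space by simp
  qed
  ultimately have "(\<lambda>n. c n ^ n) \<longlonglongrightarrow> of_real (exp (- s / 2))"
    using s by (intro tendsto_power_exp_complex) auto
  then show ?thesis by (rule Lim_transform_eventually[OF _ char_eq])
qed

text \<open>
  The Gaussian identity \<open>exp (- t y\<^sup>2) = \<integral> exp (i \<surd>(2 t) y z) dN(z)\<close> turns the Laplace transform of a
  quadratic form into a Gaussian average of characteristic functions.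
\<close>

lemma Laplace_quadratic_form:
  fixes U :: "nat \<Rightarrow> nat \<Rightarrow> 'a \<Rightarrow> 'b" and g :: "'i \<Rightarrow> 'b \<Rightarrow> real"
  assumes array: "\<forall>\<^sub>F n in sequentially. prob_space (M n) \<and> prob_space.indep_vars (M n) (\<lambda>_. N) (U n) {1..n} \<and>
      (\<forall>m\<in>{1..n}. distr (M n) N (U n m) = P n)"
    and I: "finite I" and w: "\<And>i. i \<in> I \<Longrightarrow> w i \<ge> 0" and t: "t \<ge> 0"
    and g: "\<And>i. i \<in> I \<Longrightarrow> bounded_measurable N (g i)"
    and mean: "\<And>i. i \<in> I \<Longrightarrow> (\<lambda>n. sqrt (real n) * (LINT u|P n. g i u)) \<longlonglongrightarrow> 0"
    and cov: "\<And>i j. i \<in> I \<Longrightarrow> j \<in> I \<Longrightarrow> (\<lambda>n. LINT u|P n. g i u * g j u) \<longlonglongrightarrow> (if i = j then 1 else 0)"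
  shows "(\<lambda>n. LINT \<omega>|M n. exp (- t * (\<Sum>i\<in>I. w i * ((\<Sum>m\<in>{1..n}. g i (U n m \<omega>)) / sqrt (real n))\<^sup>2)))
    \<longlonglongrightarrow> (\<Prod>i\<in>I. LINT z|std_normal_distribution. exp (- t * w i * z\<^sup>2))"
proof -
  define G :: "('i \<Rightarrow> real) measure" where "G = (\<Pi>\<^sub>M i\<in>I. std_normal_distribution)"
  \<comment> \<open>The coefficients are chosen so that half the sum of their squares is t times the
    weighted quadratic form in z.\<close>
  define a where "a z i = sqrt (2 * t * w i) * z i" for z :: "'i \<Rightarrow> real" and i
  define Y where "Y n \<omega> i = (\<Sum>m\<in>{1..n}. g i (U n m \<omega>)) / sqrt (real n)" for n \<omega> i
  interpret N01: prob_space std_normal_distribution by (rule prob_space_normal_density) simp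
  interpret PN: product_sigma_finite "\<lambda>_ :: 'i. std_normal_distribution" by standard
  interpret G: prob_space G unfolding G_def by (intro prob_space_PiM N01.prob_space_axioms)
  have comp [measurable]: "(\<lambda>z. z i) \<in> borel_measurable G" if "i \<in> I" for i
    using measurable_component_singleton[OF that, of "\<lambda>_. std_normal_distribution"] by (simp add: G_def)
  have a_meas: "(\<lambda>z. a z i) \<in> borel_measurable G" if "i \<in> I" for i
    unfolding a_def using comp[OF that] by measurable
  have a_sq: "(a z i)\<^sup>2 = 2 * (t * w i * (z i)\<^sup>2)" if "i \<in> I" for z i
    using w[OF that] t by (simp add: a_def power_mult_distrib)
  have gauss: "(LINT z|G. iexp (\<Sum>i\<in>I. a z i * y i)) = of_real (exp (- t * (\<Sum>i\<in>I. w i * (y i)\<^sup>2)))" for y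
  proof -
    have "(LINT z|G. iexp (\<Sum>i\<in>I. a z i * y i)) = (LINT z|G. (\<Prod>i\<in>I. iexp (sqrt (2 * t * w i) * y i * z i)))"
      by (simp add: exp_sum[OF I] sum_distrib_left a_def ac_simps)
    also have "\<dots> = (\<Prod>i\<in>I. LINT x|std_normal_distribution. iexp (sqrt (2 * t * w i) * y i * x))"
      unfolding G_def by (rule PN.product_integral_prod[OF I]) (rule N01.integrable_const_bound[of _ 1]; simp)
    also have "\<dots> = (\<Prod>i\<in>I. of_real (exp (- t * (w i * (y i)\<^sup>2))))"
    proof (rule prod.cong[OF refl])
      fix i assume i: "i \<in> I"
      have "(LINT x|std_normal_distribution. iexp (sqrt (2 * t * w i) * y i * x)) = char std_normal_distribution (sqrt (2 * t * w i) * y i)"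
        by (simp add: char_def)
      also have "\<dots> = of_real (exp (- (2 * t * w i * (y i)\<^sup>2) / 2))"
        using w[OF i] t by (simp add: char_std_normal_distribution power_mult_distrib)
      finally show "(LINT x|std_normal_distribution. iexp (sqrt (2 * t * w i) * y i * x)) = of_real (exp (- t * (w i * (y i)\<^sup>2)))"
        by (simp add: mult.assoc)
    qed
    also have "\<dots> = of_real (exp (- t * (\<Sum>i\<in>I. w i * (y i)\<^sup>2)))"
      by (simp only: of_real_prod[symmetric] exp_sum[OF I, symmetric] sum_distrib_left)
    finally show ?thesis .
  qed
  define \<phi> where "\<phi> n z = (LINT \<omega>|M n. iexp (\<Sum>i\<in>I. a z i * Y n \<omega> i))" for n z
  \<comment> \<open>For fixed z the exponent is a single linear combination of the
    \<open>g i\<close>, so the scalar limit theorem applies; the identity covariance reduces its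
    limiting second moment to the sum of the squared coefficients.\<close>
  have \<phi>_lim: "(\<lambda>n. \<phi> n z) \<longlonglongrightarrow> of_real (exp (- t * (\<Sum>i\<in>I. w i * (z i)\<^sup>2)))" for z
  proof -
    let ?\<gamma> = "\<lambda>u. \<Sum>i\<in>I. a z i * g i u"
    note law = triangular_array_law[OF array]
    have int: "integrable (P n) f" if "prob_space (P n)" "sets (P n) = sets N" "space (P n) = space N" "bounded_measurable N f" for n f
    proof -
      interpret prob_space "P n" by fact
      have "bounded_measurable (P n) f"
        using that(2-4) by (simp add: bounded_measurable_def cong: measurable_cong_sets)
      then show ?thesis by (rule bounded_measurable_integrable)
    qed
    have "(\<lambda>n. sqrt (real n) * (LINT u|P n. ?\<gamma> u)) \<longlonglongrightarrow> 0"
    proof (rule Lim_transform_eventually)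
      show "(\<lambda>n. \<Sum>i\<in>I. a z i * (sqrt (real n) * (LINT u|P n. g i u))) \<longlonglongrightarrow> 0"
        by (rule tendsto_null_sum) (use mean in \<open>auto intro: tendsto_mult_right_zero\<close>)
      show "\<forall>\<^sub>F n in sequentially. (\<Sum>i\<in>I. a z i * (sqrt (real n) * (LINT u|P n. g i u))) = sqrt (real n) * (LINT u|P n. ?\<gamma> u)"
        using law
      proof eventually_elim
        case (elim n)
        then show ?case
          by (subst Bochner_Integration.integral_sum) (auto intro!: int g integrable_mult_right simp: sum_distrib_left ac_simps)
      qed
    qed
    moreover have "(\<lambda>n. LINT u|P n. (?\<gamma> u)\<^sup>2) \<longlonglongrightarrow> (\<Sum>i\<in>I. (a z i)\<^sup>2)"
    proof (rule Lim_transform_eventually)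
      have "(\<lambda>n. \<Sum>i\<in>I. \<Sum>j\<in>I. a z i * a z j * (LINT u|P n. g i u * g j u)) \<longlonglongrightarrow> (\<Sum>i\<in>I. \<Sum>j\<in>I. a z i * a z j * (if i = j then 1 else 0))"
        by (intro tendsto_intros cov)
      also have "(\<Sum>i\<in>I. \<Sum>j\<in>I. a z i * a z j * (if i = j then 1 else 0)) = (\<Sum>i\<in>I. (a z i)\<^sup>2)"
        using I by (intro sum.cong refl) (simp add: if_distrib sum.delta power2_eq_square cong: if_cong)
      finally show "(\<lambda>n. \<Sum>i\<in>I. \<Sum>j\<in>I. a z i * a z j * (LINT u|P n. g i u * g j u)) \<longlonglongrightarrow> (\<Sum>i\<in>I. (a z i)\<^sup>2)" .
      show "\<forall>\<^sub>F n in sequentially. (\<Sum>i\<in>I. \<Sum>j\<in>I. a z i * a z j * (LINT u|P n. g i u * g j u)) = (LINT u|P n. (?\<gamma> u)\<^sup>2)"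
        using law
      proof eventually_elim
        case (elim n)
        have i2: "integrable (P n) (\<lambda>u. g i u * g j u)" if "i \<in> I" "j \<in> I" for i j
          using elim that by (intro int bounded_measurable_mult g) auto
        have "(\<Sum>i\<in>I. \<Sum>j\<in>I. a z i * a z j * (LINT u|P n. g i u * g j u)) = (\<Sum>i\<in>I. \<Sum>j\<in>I. (LINT u|P n. a z i * a z j * (g i u * g j u)))"
          by simp
        also have "\<dots> = (\<Sum>i\<in>I. (LINT u|P n. (\<Sum>j\<in>I. a z i * a z j * (g i u * g j u))))"
          by (intro sum.cong refl Bochner_Integration.integral_sum[symmetric] integrable_mult_right i2)
        also have "\<dots> = (LINT u|P n. (\<Sum>i\<in>I. \<Sum>j\<in>I. a z i * a z j * (g i u * g j u)))"
          by (intro Bochner_Integration.integral_sum[symmetric] Bochner_Integration.integrable_sum integrable_mult_right i2)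
        also have "\<dots> = (LINT u|P n. (?\<gamma> u)\<^sup>2)"
          by (simp add: power2_eq_square sum_product ac_simps)
        finally show ?case .
      qed
    qed
    ultimately have "(\<lambda>n. LINT \<omega>|M n. iexp ((\<Sum>m\<in>{1..n}. ?\<gamma> (U n m \<omega>)) / sqrt (real n)))
        \<longlonglongrightarrow> of_real (exp (- (\<Sum>i\<in>I. (a z i)\<^sup>2) / 2))"
      by (intro char_triangular_array[OF array] bounded_measurable_sum bounded_measurable_mult bounded_measurable_const g)
         (auto intro: sum_nonneg)
    also have "(\<Sum>i\<in>I. (a z i)\<^sup>2) = 2 * (t * (\<Sum>i\<in>I. w i * (z i)\<^sup>2))"
      by (simp add: a_sq sum_distrib_left mult.assoc)
    also have "(\<lambda>n. LINT \<omega>|M n. iexp ((\<Sum>m\<in>{1..n}. ?\<gamma> (U n m \<omega>)) / sqrt (real n))) = (\<lambda>n. \<phi> n z)"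
    proof -
      have "(\<Sum>m\<in>{1..n}. ?\<gamma> (U n m \<omega>)) / sqrt (real n) = (\<Sum>i\<in>I. a z i * Y n \<omega> i)" for n \<omega>
        unfolding Y_def by (subst sum.swap) (simp add: sum_distrib_left sum_divide_distrib)
      then show ?thesis by (simp only: \<phi>_def)
    qed
    finally show ?thesis by simp
  qed
  \<comment> \<open>The array is only good eventually. The arguments below need every index, so they
    run on the sequence shifted by \<open>n0\<close>, and the shift is undone at the end.\<close>
  obtain n0 where n0: "\<And>n. n \<ge> n0 \<Longrightarrow> prob_space (M n) \<and> prob_space.indep_vars (M n) (\<lambda>_. N) (U n) {1..n}"
    using array unfolding eventually_sequentially by blast
  have Y_meas: "(\<lambda>\<omega>. Y n \<omega> i) \<in> borel_measurable (M n)" if "n \<ge> n0" "i \<in> I" for n i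
  proof -
    interpret prob_space "M n" using n0 that by blast
    have "U n m \<in> M n \<rightarrow>\<^sub>M N" if "m \<in> {1..n}" for m
      using n0[OF \<open>n \<ge> n0\<close>] that by (auto simp: indep_vars_def)
    moreover have "g i \<in> borel_measurable N" using g[OF that(2)] by (simp add: bounded_measurable_def)
    ultimately show ?thesis
      unfolding Y_def by (intro borel_measurable_divide borel_measurable_sum borel_measurable_const) (rule measurable_compose)
  qed
  have pair_meas: "(\<lambda>(z, \<omega>). iexp (\<Sum>i\<in>I. a z i * Y n \<omega> i)) \<in> borel_measurable (G \<Otimes>\<^sub>M M n)" if "n \<ge> n0" for n
  proof -
    have "(\<lambda>x. \<Sum>i\<in>I. a (fst x) i * Y n (snd x) i) \<in> borel_measurable (G \<Otimes>\<^sub>M M n)"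
      using measurable_compose[OF measurable_fst a_meas] measurable_compose[OF measurable_snd Y_meas[OF that]]
      by (intro borel_measurable_sum borel_measurable_times) auto
    then show ?thesis unfolding case_prod_beta by measurable
  qed
  have Fubini: "(LINT z|G. \<phi> n z) = of_real (LINT \<omega>|M n. exp (- t * (\<Sum>i\<in>I. w i * (Y n \<omega> i)\<^sup>2)))" if n: "n \<ge> n0" for n
  proof -
    interpret Mn: prob_space "M n" using n0 n by blast
    interpret pair_prob_space G "M n" ..
    have "integrable (G \<Otimes>\<^sub>M M n) (\<lambda>(z, \<omega>). iexp (\<Sum>i\<in>I. a z i * Y n \<omega> i))"
      using pair_meas[OF n] by (intro integrable_const_bound[of _ 1]) (auto simp: case_prod_beta)
    then have "(LINT z|G. \<phi> n z) = (LINT \<omega>|M n. (LINT z|G. iexp (\<Sum>i\<in>I. a z i * Y n \<omega> i)))"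
      unfolding \<phi>_def by (rule Fubini_integral[symmetric])
    then show ?thesis unfolding gauss by simp
  qed
  \<comment> \<open>Characteristic functions are bounded by 1, so the pointwise limits in z may be
    averaged over the Gaussian law.\<close>
  have "(\<lambda>n. LINT z|G. \<phi> (n + n0) z) \<longlonglongrightarrow> (LINT z|G. complex_of_real (exp (- t * (\<Sum>i\<in>I. w i * (z i)\<^sup>2))))"
  proof (rule integral_dominated_convergence[where w = "\<lambda>_. 1"])
    show "(\<lambda>z. complex_of_real (exp (- t * (\<Sum>i\<in>I. w i * (z i)\<^sup>2)))) \<in> borel_measurable G"
      by measurable
    fix n
    interpret Mn: prob_space "M (n + n0)" using n0[of "n + n0"] by simp
    show "\<phi> (n + n0) \<in> borel_measurable G"
      unfolding \<phi>_def[abs_def] using pair_meas[of "n + n0"] by (intro Mn.borel_measurable_lebesgue_integral) simp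
    have "norm (\<phi> (n + n0) z) \<le> (LINT \<omega>|M (n + n0). norm (iexp (\<Sum>i\<in>I. a z i * Y (n + n0) \<omega> i)))" for z
      unfolding \<phi>_def by (rule integral_norm_bound)
    then show "AE z in G. norm (\<phi> (n + n0) z) \<le> 1"
      using Mn.prob_space by simp
  next
    show "AE z in G. (\<lambda>n. \<phi> (n + n0) z) \<longlonglongrightarrow> complex_of_real (exp (- t * (\<Sum>i\<in>I. w i * (z i)\<^sup>2)))"
      using \<phi>_lim by (intro AE_I2 LIMSEQ_ignore_initial_segment)
  qed simp
  then have "(\<lambda>n. complex_of_real (LINT \<omega>|M (n + n0). exp (- t * (\<Sum>i\<in>I. w i * (Y (n + n0) \<omega> i)\<^sup>2))))
      \<longlonglongrightarrow> complex_of_real (LINT z|G. exp (- t * (\<Sum>i\<in>I. w i * (z i)\<^sup>2)))"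
    by (simp add: Fubini)
  then have "(\<lambda>n. LINT \<omega>|M (n + n0). exp (- t * (\<Sum>i\<in>I. w i * (Y (n + n0) \<omega> i)\<^sup>2)))
      \<longlonglongrightarrow> (LINT z|G. exp (- t * (\<Sum>i\<in>I. w i * (z i)\<^sup>2)))"
    by (simp only: tendsto_of_real_iff)
  then have "(\<lambda>n. LINT \<omega>|M n. exp (- t * (\<Sum>i\<in>I. w i * (Y n \<omega> i)\<^sup>2)))
      \<longlonglongrightarrow> (LINT z|G. exp (- t * (\<Sum>i\<in>I. w i * (z i)\<^sup>2)))"
    by (rule LIMSEQ_offset)
  also have "(LINT z|G. exp (- t * (\<Sum>i\<in>I. w i * (z i)\<^sup>2))) = (LINT z|G. (\<Prod>i\<in>I. exp (- t * w i * (z i)\<^sup>2)))"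
    by (simp add: exp_sum[OF I, symmetric] sum_distrib_left sum_negf mult.assoc)
  also have "\<dots> = (\<Prod>i\<in>I. LINT z|std_normal_distribution. exp (- t * w i * z\<^sup>2))"
    unfolding G_def
    by (rule PN.product_integral_prod[OF I]) (rule N01.integrable_const_bound[of _ 1]; use w t in simp)
  finally show ?thesis unfolding Y_def .
qed

section \<open>Expectations under the rotationally symmetric model\<close>

lemma times_differentiable_at_Suc_deriv:
  assumes "times_differentiable_at (Suc (Suc q)) f x"
  shows "times_differentiable_at (Suc q) (deriv f) x" and "\<forall>\<^sub>F y in nhds x. f differentiable (at y)"
proof -
  have eq: "(deriv ^^ k) (deriv f) = (deriv ^^ Suc k) f" for k by (simp only: funpow_Suc_right o_apply)
  show "times_differentiable_at (Suc q) (deriv f) x"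
    using assms unfolding times_differentiable_at_def eq by auto
  show "\<forall>\<^sub>F y in nhds x. f differentiable (at y)"
    using assms unfolding times_differentiable_at_def by (auto dest!: spec[of _ 0])
qed

text \<open>The highest derivative is only assumed at the point itself, which rules out a Lagrange
  remainder. The induction applies the claim to f' and then the mean value inequality to f - T on
  the ball of radius |x|, gaining one power. Orders start at 1 because
  \<open>times_differentiable_at 0\<close> says nothing about f.\<close>

lemma Taylor_Peano:
  assumes "times_differentiable_at (Suc q) f 0" and "e > 0"
  shows "\<forall>\<^sub>F x in nhds 0. \<bar>f x - (\<Sum>j\<le>Suc q. (deriv ^^ j) f 0 / fact j * x ^ j)\<bar> \<le> e * \<bar>x\<bar> ^ Suc q"
  using assms
proof (induction q arbitrary: f)
  case 0
  then have "(f has_real_derivative deriv f 0) (at 0)"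
    by (simp add: times_differentiable_at_def DERIV_deriv_iff_real_differentiable)
  then have "((\<lambda>x. (f x - f 0) / x) \<longlongrightarrow> deriv f 0) (at 0)"
    by (simp add: DERIV_def)
  then have "\<forall>\<^sub>F x in at 0. dist ((f x - f 0) / x) (deriv f 0) < e"
    using 0(2) by (rule tendstoD)
  then have "\<forall>\<^sub>F x in nhds 0. x \<noteq> 0 \<longrightarrow> dist ((f x - f 0) / x) (deriv f 0) < e"
    by (simp add: eventually_at_filter)
  then show ?case
  proof eventually_elim
    case (elim x)
    show ?case
    proof (cases "x = 0")
      case False
      then have "\<bar>f x - (f 0 + deriv f 0 * x)\<bar> = \<bar>(f x - f 0) / x - deriv f 0\<bar> * \<bar>x\<bar>"
        by (simp add: abs_mult[symmetric] field_simps)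
      also have "\<dots> \<le> e * \<bar>x\<bar>"
        using elim False by (intro mult_right_mono) (auto simp: dist_real_def)
      finally show ?thesis by simp
    qed simp
  qed
next
  case (Suc q)
  note f' = times_differentiable_at_Suc_deriv[OF Suc.prems(1)]
  have eq: "(deriv ^^ j) (deriv f) = (deriv ^^ Suc j) f" for j by (simp only: funpow_Suc_right o_apply)
  define T where "T x = (\<Sum>j\<le>Suc (Suc q). (deriv ^^ j) f 0 / fact j * x ^ j)" for x
  define T' where "T' x = (\<Sum>j\<le>Suc q. (deriv ^^ j) (deriv f) 0 / fact j * x ^ j)" for x
  have T: "(T has_real_derivative T' x) (at x)" for x
  proof -
    have Teq: "T = (\<lambda>x. f 0 + (\<Sum>j\<le>Suc q. (deriv ^^ Suc j) f 0 / fact (Suc j) * x ^ Suc j))"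
      unfolding T_def by (subst sum.atMost_Suc_shift) simp
    have D: "((\<lambda>x. (deriv ^^ Suc j) f 0 / fact (Suc j) * x ^ Suc j) has_real_derivative
        (deriv ^^ j) (deriv f) 0 / fact j * x ^ j) (at x)" for j
      unfolding eq by (rule derivative_eq_intros refl | simp add: field_simps del: of_nat_Suc)+
    have "((\<lambda>x. \<Sum>j\<le>Suc q. (deriv ^^ Suc j) f 0 / fact (Suc j) * x ^ Suc j) has_real_derivative T' x) (at x)"
      unfolding T'_def by (rule DERIV_sum[OF D])
    from DERIV_add[OF DERIV_const[of "f 0"] this] show ?thesis
      unfolding Teq by (simp only: add_0)
  qed
  have "\<forall>\<^sub>F x in nhds 0. f differentiable (at x) \<and> \<bar>deriv f x - T' x\<bar> \<le> e * \<bar>x\<bar> ^ Suc q"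
    unfolding T'_def by (intro eventually_conj f'(2) Suc.IH f'(1) Suc.prems(2))
  then obtain d where d: "d > 0" "\<And>x. \<bar>x\<bar> < d \<Longrightarrow> f differentiable (at x) \<and> \<bar>deriv f x - T' x\<bar> \<le> e * \<bar>x\<bar> ^ Suc q"
    unfolding eventually_nhds_metric by (auto simp: dist_real_def)
  have "\<bar>f x - T x\<bar> \<le> e * \<bar>x\<bar> ^ Suc (Suc q)" if x: "\<bar>x\<bar> < d" for x
  proof -
    have "norm ((f x - T x) - (f 0 - T 0)) \<le> (e * \<bar>x\<bar> ^ Suc q) * norm (x - 0)"
    proof (rule field_differentiable_bound[where S = "cball 0 \<bar>x\<bar>" and f' = "\<lambda>y. deriv f y - T' y"])
      fix y :: real assume "y \<in> cball 0 \<bar>x\<bar>"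
      then have y: "\<bar>y\<bar> \<le> \<bar>x\<bar>" "\<bar>y\<bar> < d" using x by (auto simp: dist_real_def)
      have "(f has_real_derivative deriv f y) (at y)"
        using d(2)[OF y(2)] by (simp add: DERIV_deriv_iff_real_differentiable)
      then show "((\<lambda>y. f y - T y) has_field_derivative deriv f y - T' y) (at y within cball 0 \<bar>x\<bar>)"
        using T DERIV_diff has_field_derivative_at_within by blast
      have "\<bar>deriv f y - T' y\<bar> \<le> e * \<bar>y\<bar> ^ Suc q" using d(2)[OF y(2)] by blast
      also have "\<dots> \<le> e * \<bar>x\<bar> ^ Suc q"
        using y(1) Suc.prems(2) by (intro mult_left_mono power_mono) auto
      finally show "norm (deriv f y - T' y) \<le> e * \<bar>x\<bar> ^ Suc q" by simp
    qed (auto simp: dist_real_def)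
    moreover have "T 0 = f 0" unfolding T_def by (subst sum.atMost_Suc_shift) simp
    ultimately show ?thesis by (simp add: mult.assoc mult.commute[of "\<bar>x\<bar>"])
  qed
  then show ?case
    unfolding eventually_nhds_metric T_def using d(1) by (auto simp: dist_real_def)
qed

section \<open>Expectations of bounded functions and their limits\<close>

lemma measurable_surface_measure_eq:
  "borel_measurable surface_measure = (borel_measurable uniform_sphere :: ('a::euclidean_space \<Rightarrow> real) set)"
  by (rule measurable_cong_sets) (simp_all add: uniform_sphere_def)

lemma integral_surface_measure:
  fixes \<psi> :: "'a::euclidean_space \<Rightarrow> real"
  assumes "\<psi> \<in> borel_measurable surface_measure"
  shows "(LINT u|surface_measure. \<psi> u) = measure surface_measure (sphere 0 1 :: 'a set) * (LINT u|uniform_sphere. \<psi> u)"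
proof -
  let ?A = "measure surface_measure (sphere 0 1 :: 'a set)"
  have em: "emeasure surface_measure (sphere 0 1 :: 'a set) = ennreal ?A"
    using emeasure_surface_measure_sphere(2) by (intro emeasure_eq_ennreal_measure) simp
  have A: "?A > 0"
    using emeasure_surface_measure_sphere(1)[where 'a = 'a] em by (metis ennreal_0 measure_nonneg order_le_less)
  have meas: "sphere 0 1 \<in> sets (surface_measure :: 'a measure)"
    using sets.top[of "surface_measure :: 'a measure"] by simp
  have "uniform_sphere = density surface_measure (\<lambda>_ :: 'a. ennreal (1 / ?A))"
    unfolding uniform_sphere_def uniform_measure_def
  proof (rule density_cong)
    show "AE x :: 'a in surface_measure. indicator (sphere 0 1) x / emeasure surface_measure (sphere 0 1 :: 'a set) = ennreal (1 / ?A)"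
      unfolding em using A by (intro AE_I2) (auto simp: divide_ennreal ennreal_1[symmetric] simp del: ennreal_1)
  qed (use meas in auto)
  then have "(LINT u|uniform_sphere. \<psi> u) = (LINT u|density surface_measure (\<lambda>_ :: 'a. ennreal (1 / ?A)). \<psi> u)"
    by (simp only:)
  also have "\<dots> = (LINT u|surface_measure. (1 / ?A) *\<^sub>R \<psi> u)"
    using assms A by (intro integral_density) auto
  finally have "(LINT u|uniform_sphere. \<psi> u) = (LINT u|surface_measure. (1 / ?A) *\<^sub>R \<psi> u)" .
  then show ?thesis using A by simp
qed

text \<open>Testing with the constant function 1 eliminates both c and the total area. The product
  form avoids dividing by an integral that is not yet known to be positive.\<close>

lemma rotsym_expectation:
  fixes \<theta> :: "'a::euclidean_space"
  assumes f: "f \<in> borel_measurable borel" "\<And>x. f x \<ge> 0" and c: "c > 0"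
    and P: "P = density surface_measure (\<lambda>u. ennreal (c * f (\<kappa> * (u \<bullet> \<theta>))))" "prob_space P"
    and \<phi>: "\<phi> \<in> borel_measurable surface_measure"
  shows "(LINT u|P. \<phi> u) * (LINT u|uniform_sphere. f (\<kappa> * (u \<bullet> \<theta>))) = (LINT u|uniform_sphere. f (\<kappa> * (u \<bullet> \<theta>)) * \<phi> u)"
proof -
  interpret prob_space P by fact
  let ?F = "\<lambda>u. f (\<kappa> * (u \<bullet> \<theta>))" and ?A = "measure surface_measure (sphere 0 1 :: 'a set)"
  have F: "?F \<in> borel_measurable surface_measure"
    by (intro borel_measurable_surface_measure) (use f(1) in measurable)
  have E: "(LINT u|P. \<psi> u) = c * ?A * (LINT u|uniform_sphere. ?F u * \<psi> u)" if "\<psi> \<in> borel_measurable surface_measure" for \<psi>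
  proof -
    have "(LINT u|P. \<psi> u) = (LINT u|surface_measure. (c * ?F u) *\<^sub>R \<psi> u)"
      unfolding P(1) using that F f(2) c by (intro integral_density) auto
    also have "\<dots> = c * (LINT u|surface_measure. ?F u * \<psi> u)" by (simp add: mult.assoc)
    finally show ?thesis using that F by (simp add: integral_surface_measure)
  qed
  have "c * ?A * (LINT u|uniform_sphere. ?F u) = 1"
    using E[of "\<lambda>_. 1"] prob_space by simp
  then show ?thesis unfolding E[OF \<phi>] by (simp add: algebra_simps)
qed

text \<open>Away from 0 nothing bounds f. A dominating constant exists only once
  \<open>\<kappa> n\<close> is so small that all arguments lie where f stays below 2, hence the
  passage to a tail before dominated convergence.\<close>

lemma rotsym_expectation_limit:
  fixes \<theta> :: "'a::euclidean_space"
  assumes f: "f \<in> borel_measurable borel" "f 0 = 1" "isCont f 0" and \<theta>: "norm \<theta> = 1"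
    and \<kappa>: "\<kappa> \<longlonglongrightarrow> 0" and \<phi>: "bounded_measurable uniform_sphere \<phi>"
  shows "(\<lambda>n. LINT u|uniform_sphere. f (\<kappa> n * (u \<bullet> \<theta>)) * \<phi> u) \<longlonglongrightarrow> (LINT u|uniform_sphere. \<phi> u)"
proof -
  interpret prob_space "uniform_sphere :: 'a measure" by (rule prob_space_uniform_sphere)
  obtain B where B: "\<And>x. x \<in> sphere 0 1 \<Longrightarrow> \<bar>\<phi> x\<bar> \<le> B" and \<phi>m: "\<phi> \<in> borel_measurable uniform_sphere"
    using \<phi> unfolding bounded_measurable_def space_uniform_sphere by blast
  obtain d where d: "d > 0" "\<And>x. \<bar>x\<bar> < d \<Longrightarrow> \<bar>f x - 1\<bar> < 1"
    using f(2,3) unfolding continuous_at_eps_delta by (metis dist_real_def diff_zero zero_less_one)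
  have le: "\<bar>u \<bullet> \<theta>\<bar> \<le> 1" if "u \<in> sphere 0 1" for u
    using Cauchy_Schwarz_ineq2[of u \<theta>] that \<theta> by simp
  obtain n0 where n0: "\<And>n. n \<ge> n0 \<Longrightarrow> \<bar>\<kappa> n\<bar> < d"
    using LIMSEQ_D[OF \<kappa> d(1)] by auto
  have small: "\<bar>\<kappa> n * (u \<bullet> \<theta>)\<bar> < d" if "u \<in> sphere 0 1" "n \<ge> n0" for u n
    using n0[OF that(2)] mult_left_le[OF le[OF that(1)], of "\<bar>\<kappa> n\<bar>"] by (simp add: abs_mult)
  have Fm: "(\<lambda>u. f (\<kappa> n * (u \<bullet> \<theta>))) \<in> borel_measurable uniform_sphere" for n
    by (intro borel_measurable_uniform_sphere) (use f(1) in measurable)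
  have "(\<lambda>n. LINT u|uniform_sphere. f (\<kappa> (n + n0) * (u \<bullet> \<theta>)) * \<phi> u) \<longlonglongrightarrow> (LINT u|uniform_sphere. \<phi> u)"
  proof (rule integral_dominated_convergence[where w = "\<lambda>_. 2 * B"])
    fix n
    show "AE u in uniform_sphere. norm (f (\<kappa> (n + n0) * (u \<bullet> \<theta>)) * \<phi> u) \<le> 2 * B"
    proof (rule AE_I2)
      fix u :: 'a assume "u \<in> space uniform_sphere"
      then have u: "u \<in> sphere 0 1" by simp
      have "\<bar>f (\<kappa> (n + n0) * (u \<bullet> \<theta>))\<bar> \<le> 2" using d(2)[OF small[OF u, of "n + n0"]] by simp
      then show "norm (f (\<kappa> (n + n0) * (u \<bullet> \<theta>)) * \<phi> u) \<le> 2 * B"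
        unfolding real_norm_def abs_mult using B[OF u] by (intro mult_mono) auto
    qed
    show "AE u in uniform_sphere. (\<lambda>n. f (\<kappa> (n + n0) * (u \<bullet> \<theta>)) * \<phi> u) \<longlonglongrightarrow> \<phi> u"
    proof (rule AE_I2)
      fix u :: 'a
      have "(\<lambda>n. f (\<kappa> (n + n0) * (u \<bullet> \<theta>))) \<longlonglongrightarrow> f 0"
        by (intro isCont_tendsto_compose[OF f(3)] tendsto_mult_left_zero LIMSEQ_ignore_initial_segment \<kappa>)
      from tendsto_mult[OF this tendsto_const[of "\<phi> u"]] f(2)
      show "(\<lambda>n. f (\<kappa> (n + n0) * (u \<bullet> \<theta>)) * \<phi> u) \<longlonglongrightarrow> \<phi> u" by simp
    qed
  qed (use Fm \<phi>m in auto)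
  then show ?thesis by (rule LIMSEQ_offset)
qed

text \<open>By \<open>orth\<close> the whole Taylor polynomial integrates to 0 against g. The
  remainder is at most any \<epsilon> times the q-th power of \<kappa>_n, and sqrt n times that
  power is the constant \<tau>^q.\<close>

lemma rotsym_mean_limit:
  fixes \<theta> :: "'a::euclidean_space"
  assumes f: "f \<in> borel_measurable borel" and q: "q > 0" "times_differentiable_at q f 0" and \<theta>: "norm \<theta> = 1"
    and \<tau>: "\<tau> > 0" and g: "bounded_measurable uniform_sphere g"
    and orth: "\<And>j. j \<le> q \<Longrightarrow> (deriv ^^ j) f 0 = 0 \<or> (LINT u|uniform_sphere. g u * (u \<bullet> \<theta>) ^ j) = 0"
  shows "(\<lambda>n. sqrt (real n) * (LINT u|uniform_sphere. f (real n powr (- 1 / (2 * real q)) * \<tau> * (u \<bullet> \<theta>)) * g u)) \<longlonglongrightarrow> 0"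
proof -
  interpret prob_space "uniform_sphere :: 'a measure" by (rule prob_space_uniform_sphere)
  obtain B0 where B0: "\<And>x. x \<in> sphere 0 1 \<Longrightarrow> \<bar>g x\<bar> \<le> B0" and gm: "g \<in> borel_measurable uniform_sphere"
    using g unfolding bounded_measurable_def space_uniform_sphere by blast
  \<comment> \<open>The maximum with 1 makes the bound positive, so that \<epsilon> may be divided
    by it.\<close>
  define B where "B = max B0 1"
  have B: "\<And>x. x \<in> sphere 0 1 \<Longrightarrow> \<bar>g x\<bar> \<le> B" "B > 0" using B0 by (auto simp: B_def le_max_iff_disj)
  define \<kappa> where "\<kappa> n = real n powr (- 1 / (2 * real q)) * \<tau>" for n
  define T where "T x = (\<Sum>j\<le>q. (deriv ^^ j) f 0 / fact j * x ^ j)" for x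
  have le: "\<bar>u \<bullet> \<theta>\<bar> \<le> 1" if "u \<in> sphere 0 1" for u
    using Cauchy_Schwarz_ineq2[of u \<theta>] that \<theta> by simp
  have \<kappa>0: "\<kappa> \<longlonglongrightarrow> 0"
    unfolding \<kappa>_def using q(1)
    by (intro tendsto_mult_left_zero tendsto_neg_powr filterlim_real_sequentially) simp
  have \<kappa>q: "sqrt (real n) * \<kappa> n ^ q = \<tau> ^ q" if "n > 0" for n
  proof -
    have "(real n powr (- 1 / (2 * real q))) ^ q = real n powr (- 1 / 2)"
      using that q(1) by (simp add: powr_realpow[symmetric] powr_powr)
    also have "\<dots> = 1 / sqrt (real n)"
      using powr_minus_divide[of "real n" "1 / 2"] by (simp add: powr_half_sqrt)
    finally show ?thesis
      using that by (simp only: \<kappa>_def power_mult_distrib) simp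
  qed
  have T0: "(LINT u|uniform_sphere. T (\<kappa> n * (u \<bullet> \<theta>)) * g u) = 0" for n
  proof -
    have int: "integrable uniform_sphere (\<lambda>u. g u * (u \<bullet> \<theta>) ^ j)" for j
    proof (rule bounded_measurable_integrable, rule bounded_measurable_mult[OF g])
      have "\<bar>(u \<bullet> \<theta>) ^ j\<bar> \<le> 1" if "u \<in> sphere 0 1" for u
        using le[OF that] by (simp add: power_abs power_le_one)
      then show "bounded_measurable uniform_sphere (\<lambda>u. (u \<bullet> \<theta>) ^ j)"
        unfolding bounded_measurable_def by (auto intro!: borel_measurable_uniform_sphere exI[of _ 1])
    qed
    have "(LINT u|uniform_sphere. T (\<kappa> n * (u \<bullet> \<theta>)) * g u) =
        (LINT u|uniform_sphere. (\<Sum>j\<le>q. (deriv ^^ j) f 0 / fact j * \<kappa> n ^ j * (g u * (u \<bullet> \<theta>) ^ j)))"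
      unfolding T_def sum_distrib_right power_mult_distrib by (simp only: ac_simps)
    also have "\<dots> = (\<Sum>j\<le>q. (deriv ^^ j) f 0 / fact j * \<kappa> n ^ j * (LINT u|uniform_sphere. g u * (u \<bullet> \<theta>) ^ j))"
      using int by (subst Bochner_Integration.integral_sum) auto
    also have "\<dots> = 0" using orth by (intro sum.neutral) auto
    finally show ?thesis .
  qed
  show ?thesis
  proof (rule tendstoI)
    fix e :: real assume e: "e > 0"
    \<comment> \<open>Chosen so that the final bound \<epsilon> B \<tau>^q equals e/2.\<close>
    define \<epsilon> where "\<epsilon> = e / (2 * B * \<tau> ^ q)"
    have \<epsilon>: "\<epsilon> > 0" using e B \<tau> by (simp add: \<epsilon>_def)
    obtain q' where "q = Suc q'" using q(1) gr0_implies_Suc by blast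
    then have "\<forall>\<^sub>F x in nhds 0. \<bar>f x - T x\<bar> \<le> \<epsilon> * \<bar>x\<bar> ^ q"
      unfolding T_def using Taylor_Peano[OF _ \<epsilon>, of q' f] q(2) by simp
    then obtain d where d: "d > 0" "\<And>x. \<bar>x\<bar> < d \<Longrightarrow> \<bar>f x - T x\<bar> \<le> \<epsilon> * \<bar>x\<bar> ^ q"
      unfolding eventually_nhds_metric by (auto simp: dist_real_def)
    have "\<forall>\<^sub>F n in sequentially. \<bar>\<kappa> n\<bar> < d"
      using tendstoD[OF \<kappa>0 d(1)] by simp
    then show "\<forall>\<^sub>F n in sequentially. dist (sqrt (real n) * (LINT u|uniform_sphere. f (real n powr (- 1 / (2 * real q)) * \<tau> * (u \<bullet> \<theta>)) * g u)) 0 < e"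
      using eventually_gt_at_top[of 0]
    proof eventually_elim
      case (elim n)
      have \<kappa>n: "\<kappa> n \<ge> 0" using \<tau> by (simp add: \<kappa>_def)
      have bound: "\<bar>f (\<kappa> n * (u \<bullet> \<theta>)) - T (\<kappa> n * (u \<bullet> \<theta>))\<bar> \<le> \<epsilon> * \<kappa> n ^ q" if u: "u \<in> sphere 0 1" for u
      proof -
        have s: "\<bar>\<kappa> n * (u \<bullet> \<theta>)\<bar> \<le> \<kappa> n"
          using mult_left_le[OF le[OF u] \<kappa>n] \<kappa>n by (simp add: abs_mult)
        then have "\<bar>f (\<kappa> n * (u \<bullet> \<theta>)) - T (\<kappa> n * (u \<bullet> \<theta>))\<bar> \<le> \<epsilon> * \<bar>\<kappa> n * (u \<bullet> \<theta>)\<bar> ^ q"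
          using elim by (intro d(2)) auto
        also have "\<dots> \<le> \<epsilon> * \<kappa> n ^ q"
          using s \<epsilon> by (intro mult_left_mono power_mono) auto
        finally show ?thesis .
      qed
      let ?R = "\<lambda>u. (f (\<kappa> n * (u \<bullet> \<theta>)) - T (\<kappa> n * (u \<bullet> \<theta>))) * g u"
      have Rb: "\<bar>?R u\<bar> \<le> \<epsilon> * \<kappa> n ^ q * B" if "u \<in> sphere 0 1" for u
        unfolding abs_mult using bound[OF that] B(1)[OF that] \<epsilon> \<kappa>n by (intro mult_mono) auto
      have Tc: "continuous_on UNIV T" unfolding T_def by (intro continuous_intros) auto
      have Tm: "(\<lambda>u. T (\<kappa> n * (u \<bullet> \<theta>))) \<in> borel_measurable uniform_sphere"
        by (intro borel_measurable_uniform_sphere borel_measurable_continuous_onI continuous_on_compose2[OF Tc] continuous_intros subset_UNIV)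
      have Fm: "(\<lambda>u. f (\<kappa> n * (u \<bullet> \<theta>))) \<in> borel_measurable uniform_sphere"
        by (intro borel_measurable_uniform_sphere) (use f in measurable)
      have Ri: "integrable uniform_sphere ?R"
      proof (rule integrable_const_bound[of _ "\<epsilon> * \<kappa> n ^ q * B"])
        show "AE u in uniform_sphere. norm (?R u) \<le> \<epsilon> * \<kappa> n ^ q * B"
          using Rb by (intro AE_I2) (simp only: space_uniform_sphere real_norm_def)
        show "?R \<in> borel_measurable uniform_sphere"
          by (intro borel_measurable_times borel_measurable_diff Fm Tm gm)
      qed
      have Ti: "integrable uniform_sphere (\<lambda>u. T (\<kappa> n * (u \<bullet> \<theta>)) * g u)"
      proof (rule bounded_measurable_integrable, rule bounded_measurable_mult[OF _ g])
        have "compact ((\<lambda>u. T (\<kappa> n * (u \<bullet> \<theta>))) ` sphere 0 1)"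
          by (intro compact_continuous_image continuous_on_compose2[OF Tc] continuous_intros compact_sphere subset_UNIV)
        then have "bounded ((\<lambda>u. T (\<kappa> n * (u \<bullet> \<theta>))) ` sphere 0 1)" by (rule compact_imp_bounded)
        then obtain C where "\<And>u. u \<in> sphere 0 1 \<Longrightarrow> \<bar>T (\<kappa> n * (u \<bullet> \<theta>))\<bar> \<le> C"
          unfolding bounded_iff real_norm_def by blast
        then show "bounded_measurable uniform_sphere (\<lambda>u. T (\<kappa> n * (u \<bullet> \<theta>)))"
          using Tm unfolding bounded_measurable_def space_uniform_sphere by blast
      qed
      have "(LINT u|uniform_sphere. f (\<kappa> n * (u \<bullet> \<theta>)) * g u) = (LINT u|uniform_sphere. ?R u + T (\<kappa> n * (u \<bullet> \<theta>)) * g u)"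
        by (simp only: left_diff_distrib diff_add_cancel)
      also have "\<dots> = (LINT u|uniform_sphere. ?R u) + (LINT u|uniform_sphere. T (\<kappa> n * (u \<bullet> \<theta>)) * g u)"
        by (rule Bochner_Integration.integral_add[OF Ri Ti])
      also have "\<dots> = (LINT u|uniform_sphere. ?R u)"
        unfolding T0 by (rule add_0_right)
      finally have "\<bar>LINT u|uniform_sphere. f (\<kappa> n * (u \<bullet> \<theta>)) * g u\<bar> = \<bar>LINT u|uniform_sphere. ?R u\<bar>"
        by (rule arg_cong)
      also have "\<dots> \<le> (LINT u|uniform_sphere. \<bar>?R u\<bar>)" by (rule integral_abs_bound)
      also have "\<dots> \<le> (LINT u|(uniform_sphere :: 'a measure). \<epsilon> * \<kappa> n ^ q * B)"
      proof (rule Bochner_Integration.integral_mono[OF integrable_abs[OF Ri]])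
        show "\<bar>?R u\<bar> \<le> \<epsilon> * \<kappa> n ^ q * B" if "u \<in> space uniform_sphere" for u
          using that unfolding space_uniform_sphere by (rule Rb)
      qed simp
      also have "\<dots> = \<epsilon> * \<kappa> n ^ q * B" using prob_space by simp
      finally have "sqrt (real n) * \<bar>LINT u|uniform_sphere. f (\<kappa> n * (u \<bullet> \<theta>)) * g u\<bar> \<le> sqrt (real n) * (\<epsilon> * \<kappa> n ^ q * B)"
        by (intro mult_left_mono) auto
      also have "\<dots> = \<epsilon> * B * (sqrt (real n) * \<kappa> n ^ q)" by simp
      also have "\<dots> = \<epsilon> * B * \<tau> ^ q" using \<kappa>q elim by simp
      also have "\<dots> = e / 2" using B \<tau> by (simp add: \<epsilon>_def)
      also have "\<dots> < e" using e by simp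
      finally show ?case by (simp add: \<kappa>_def abs_mult)
    qed
  qed
qed

section \<open>The limit law of the Sobolev statistic\<close>

lemma prob_space_std_normal: "prob_space std_normal_distribution"
  by (rule prob_space_normal_density) simp

lemma sum_squares_measurable:
  "(\<lambda>z. \<Sum>i\<in>{1..d}. (z i)\<^sup>2) \<in> borel_measurable (\<Pi>\<^sub>M i\<in>{1..d::nat}. std_normal_distribution)"
proof (intro borel_measurable_sum borel_measurable_power)
  fix i assume "i \<in> {1..d}"
  from measurable_component_singleton[OF this, of "\<lambda>_. std_normal_distribution"]
  show "(\<lambda>z. z i) \<in> borel_measurable (\<Pi>\<^sub>M i\<in>{1..d::nat}. std_normal_distribution)" by simp
qed

lemma sets_chi_square [simp, measurable_cong]: "sets (chi_square d) = sets borel"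
  by (simp add: chi_square_def)

lemma space_chi_square [simp]: "space (chi_square d) = UNIV"
  by (simp add: chi_square_def)

lemma prob_space_chi_square: "prob_space (chi_square d)"
  unfolding chi_square_def
  by (intro prob_space.prob_space_distr prob_space_PiM prob_space_std_normal sum_squares_measurable)

lemma AE_chi_square_nonneg: "AE x in chi_square d. 0 \<le> x"
  unfolding chi_square_def
  by (subst AE_distr_iff[OF sum_squares_measurable]) (auto intro!: AE_I2 sum_nonneg)

text \<open>The Gaussian integral is kept as it stands, because the limit of the quadratic form
  consists of the same factors.\<close>

lemma Laplace_chi_square:
  assumes t: "t \<ge> 0"
  shows "(LINT x|chi_square d. exp (- t * x)) = (LINT z|std_normal_distribution. exp (- t * z\<^sup>2)) ^ d"
proof -
  interpret N01: prob_space std_normal_distribution by (rule prob_space_std_normal)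
  interpret PN: product_sigma_finite "\<lambda>_ :: nat. std_normal_distribution" by standard
  have "(LINT x|chi_square d. exp (- t * x)) = (LINT z|(\<Pi>\<^sub>M i\<in>{1..d}. std_normal_distribution). exp (- t * (\<Sum>i\<in>{1..d}. (z i)\<^sup>2)))"
    unfolding chi_square_def by (rule integral_distr[OF sum_squares_measurable]) simp
  also have "\<dots> = (LINT z|(\<Pi>\<^sub>M i\<in>{1..d}. std_normal_distribution). (\<Prod>i\<in>{1..d}. exp (- t * (z i)\<^sup>2)))"
    by (simp only: exp_sum[OF finite_atLeastAtMost, symmetric] sum_distrib_left)
  also have "\<dots> = (\<Prod>i\<in>{1..d}. LINT z|std_normal_distribution. exp (- t * z\<^sup>2))"
    by (rule PN.product_integral_prod) (use t in \<open>auto intro!: N01.integrable_const_bound[of _ 1]\<close>)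
  finally show ?thesis by simp
qed

lemma weighted_chi_square_measurable:
  assumes "finite I"
  shows "(\<lambda>x. \<Sum>k\<in>I. w k * x k) \<in> borel_measurable (\<Pi>\<^sub>M k\<in>I. chi_square (d k))"
proof (intro borel_measurable_sum borel_measurable_times borel_measurable_const)
  fix k assume "k \<in> I"
  from measurable_component_singleton[OF this, of "\<lambda>k. chi_square (d k)"]
  show "(\<lambda>x. x k) \<in> borel_measurable (\<Pi>\<^sub>M k\<in>I. chi_square (d k))"
    by (simp cong: measurable_cong_sets)
qed

lemma real_distribution_weighted_chi_square:
  assumes "finite I"
  shows "real_distribution (weighted_chi_square I w d)"
  unfolding weighted_chi_square_def
  by (intro prob_space.real_distribution_distr prob_space_PiM prob_space_chi_square weighted_chi_square_measurable assms)

lemma AE_weighted_chi_square_nonneg: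
  assumes "finite I" and w: "\<And>k. k \<in> I \<Longrightarrow> w k \<ge> 0"
  shows "AE x in weighted_chi_square I w d. 0 \<le> x"
proof -
  have "AE x in (\<Pi>\<^sub>M k\<in>I. chi_square (d k)). \<forall>k\<in>I. 0 \<le> x k"
    using \<open>finite I\<close>
    by (intro AE_finite_allI AE_PiM_component prob_space_chi_square AE_chi_square_nonneg)
  then show ?thesis
    unfolding weighted_chi_square_def
    by (subst AE_distr_iff[OF weighted_chi_square_measurable[OF assms(1)]])
       (auto elim!: eventually_mono intro!: sum_nonneg mult_nonneg_nonneg w)
qed

lemma Laplace_weighted_chi_square:
  assumes I: "finite I" and w: "\<And>k. k \<in> I \<Longrightarrow> w k \<ge> 0" and t: "t \<ge> 0"
  shows "(LINT x|weighted_chi_square I w d. exp (- t * x)) =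
    (\<Prod>k\<in>I. (LINT z|std_normal_distribution. exp (- t * w k * z\<^sup>2)) ^ d k)"
proof -
  interpret chi: prob_space "chi_square n" for n by (rule prob_space_chi_square)
  interpret PC: product_sigma_finite "\<lambda>k. chi_square (d k)" by standard
  have "(LINT x|weighted_chi_square I w d. exp (- t * x)) = (LINT x|(\<Pi>\<^sub>M k\<in>I. chi_square (d k)). exp (- t * (\<Sum>k\<in>I. w k * x k)))"
    unfolding weighted_chi_square_def by (rule integral_distr[OF weighted_chi_square_measurable[OF I]]) simp
  also have "\<dots> = (LINT x|(\<Pi>\<^sub>M k\<in>I. chi_square (d k)). (\<Prod>k\<in>I. exp (- (t * w k) * x k)))"
    by (simp only: exp_sum[OF I, symmetric] sum_distrib_left mult_minus_left mult.assoc)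
  also have "\<dots> = (\<Prod>k\<in>I. LINT x|chi_square (d k). exp (- (t * w k) * x))"
  proof (rule PC.product_integral_prod[OF I])
    fix k assume k: "k \<in> I"
    have "AE x in chi_square (d k). norm (exp (- (t * w k) * x)) \<le> 1"
      using AE_chi_square_nonneg by eventually_elim (use t w[OF k] in simp)
    then show "integrable (chi_square (d k)) (\<lambda>x. exp (- (t * w k) * x))"
      by (rule chi.integrable_const_bound) (simp cong: measurable_cong_sets)
  qed
  also have "\<dots> = (\<Prod>k\<in>I. (LINT z|std_normal_distribution. exp (- t * w k * z\<^sup>2)) ^ d k)"
    using t w by (intro prod.cong refl, subst Laplace_chi_square) auto
  finally show ?thesis .
qed

section \<open>Orthonormal harmonic bases and the statistic as a sum of squares\<close>

lemma reproducing_kernel_harm_poly: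
  assumes p: "CARD('p::finite) \<ge> 2"
  shows "reproducing_kernel (uniform_sphere :: (real ^ 'p) measure) (\<lambda>u w. poly (harm_poly CARD('p) k) (u \<bullet> w))"
  unfolding reproducing_kernel_def space_uniform_sphere
proof (intro conjI ballI)
  let ?H = "harm_poly CARD('p) k"
  fix u w :: "real ^ 'p" assume u: "u \<in> sphere 0 1" and w: "w \<in> sphere 0 1"
  show "poly ?H (u \<bullet> w) = poly ?H (w \<bullet> u)" by (simp only: inner_commute)
  show "(LINT x|uniform_sphere. poly ?H (u \<bullet> x) * poly ?H (w \<bullet> x)) = poly ?H (u \<bullet> w)"
    using sphere_form_harm_poly_same[OF p, of u w k] u w by (simp add: sphere_form_def)
next
  let ?H = "harm_poly CARD('p) k"
  have bm: "bounded_measurable uniform_sphere \<phi>" if "continuous_on UNIV \<phi>" for \<phi> :: "real ^ 'p \<Rightarrow> real"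
  proof -
    have "compact (\<phi> ` sphere 0 1)"
      by (intro compact_continuous_image continuous_on_subset[OF that]) auto
    then have "bounded (\<phi> ` sphere 0 1)" by (rule compact_imp_bounded)
    then show ?thesis
      unfolding bounded_measurable_def space_uniform_sphere bounded_iff
      using borel_measurable_uniform_sphere[OF borel_measurable_continuous_onI[OF that]] by auto
  qed
  show "bounded_measurable uniform_sphere (\<lambda>x. poly ?H (u \<bullet> x))" for u :: "real ^ 'p"
    by (intro bm continuous_intros)
  show "bounded_measurable uniform_sphere (\<lambda>u :: real ^ 'p. poly ?H (u \<bullet> u))"
    by (intro bm continuous_intros)
qed

text \<open>On the sphere u . u = 1, so the diagonal of the kernel is its value at 1 and the trace
  is the harmonic dimension; this fixes the number of basis functions.\<close>

lemma exists_harmonic_basis: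
  assumes p: "CARD('p::finite) \<ge> 2" and k: "k > 0"
  shows "\<exists>g. kernel_basis (uniform_sphere :: (real ^ 'p) measure)
    (\<lambda>u w. poly (harm_poly CARD('p) k) (u \<bullet> w)) (harmonic_dim CARD('p) k) g"
proof -
  interpret prob_space "uniform_sphere :: (real ^ 'p) measure" by (rule prob_space_uniform_sphere)
  have "(LINT u|(uniform_sphere :: (real ^ 'p) measure). poly (harm_poly CARD('p) k) (u \<bullet> u))
      = (LINT u|(uniform_sphere :: (real ^ 'p) measure). real (harmonic_dim CARD('p) k))"
    by (intro Bochner_Integration.integral_cong refl)
       (simp add: dot_square_norm poly_harm_poly_1[OF p k, symmetric])
  also have "\<dots> = real (harmonic_dim CARD('p) k)" using prob_space by simp
  finally show ?thesis
    by (rule reproducing_kernel_decomposition[OF reproducing_kernel_harm_poly[OF p]])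
qed

text \<open>Expanding the kernel in the basis separates i from j, so the double sum factors into
  squares; the prefactor 1/n is split into 1/sqrt n inside each square.\<close>

lemma sobolev_stat_eq_sum_squares:
  fixes v :: "nat \<Rightarrow> real" and U :: "nat \<Rightarrow> 'a \<Rightarrow> real ^ 'p::finite"
  assumes p: "CARD('p) \<ge> 2" and fin: "finite {k. k \<ge> 1 \<and> v k \<noteq> 0}"
    and g: "\<And>k. k \<ge> 1 \<Longrightarrow> v k \<noteq> 0 \<Longrightarrow> kernel_basis (uniform_sphere :: (real ^ 'p) measure)
      (\<lambda>u w. poly (harm_poly CARD('p) k) (u \<bullet> w)) (d k) (g k)"
    and U: "\<And>i. i \<in> {1..n} \<Longrightarrow> U i \<omega> \<in> sphere 0 1" and n: "n > 0"
  shows "sobolev_stat v n U \<omega> = (\<Sum>(k, r)\<in>Sigma {k. k \<ge> 1 \<and> v k \<noteq> 0} (\<lambda>k. {..<d k}).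
    (v k)\<^sup>2 * ((\<Sum>m\<in>{1..n}. g k r (U m \<omega>)) / sqrt (real n))\<^sup>2)"
proof -
  let ?K = "{k. k \<ge> 1 \<and> v k \<noteq> 0}" and ?H = "harm_poly CARD('p)"
  have kernel: "(\<Sum>k. (v (Suc k))\<^sup>2 * sobolev_kernel CARD('p) (Suc k) s) = (\<Sum>k\<in>?K. (v k)\<^sup>2 * poly (?H k) s)" for s
  proof -
    have fin': "finite {k. v (Suc k) \<noteq> 0}"
    proof (rule finite_imageD)
      show "finite (Suc ` {k. v (Suc k) \<noteq> 0})" by (rule finite_subset[OF _ fin]) auto
    qed simp
    have "(\<Sum>k. (v (Suc k))\<^sup>2 * sobolev_kernel CARD('p) (Suc k) s) =
        (\<Sum>k\<in>{k. v (Suc k) \<noteq> 0}. (v (Suc k))\<^sup>2 * sobolev_kernel CARD('p) (Suc k) s)"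
      by (rule suminf_finite[OF fin']) simp
    also have "\<dots> = (\<Sum>k\<in>{k. v (Suc k) \<noteq> 0}. (v (Suc k))\<^sup>2 * poly (?H (Suc k)) s)"
      using p by (simp only: sobolev_kernel_eq_poly zero_less_Suc)
    also have "\<dots> = (\<Sum>k\<in>Suc ` {k. v (Suc k) \<noteq> 0}. (v k)\<^sup>2 * poly (?H k) s)"
      by (simp add: sum.reindex del: harm_poly_simps)
    also have "Suc ` {k. v (Suc k) \<noteq> 0} = ?K"
      by (auto simp: image_iff) (metis Suc_le_D One_nat_def)
    finally show ?thesis .
  qed
  have "sobolev_stat v n U \<omega> = 1 / real n * (\<Sum>i\<in>{1..n}. \<Sum>j\<in>{1..n}. \<Sum>k\<in>?K. (v k)\<^sup>2 * (\<Sum>r<d k. g k r (U i \<omega>) * g k r (U j \<omega>)))"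
    unfolding sobolev_stat_def kernel
    by (intro arg_cong[where f = "(*) _"] sum.cong refl) (use kernel_basisD(3)[OF g] U in auto)
  also have "(\<Sum>i\<in>{1..n}. \<Sum>j\<in>{1..n}. \<Sum>k\<in>?K. (v k)\<^sup>2 * (\<Sum>r<d k. g k r (U i \<omega>) * g k r (U j \<omega>)))
      = (\<Sum>k\<in>?K. \<Sum>r<d k. (\<Sum>i\<in>{1..n}. \<Sum>j\<in>{1..n}. (v k)\<^sup>2 * (g k r (U i \<omega>) * g k r (U j \<omega>))))"
    unfolding sum_distrib_left
    by (simp only: sum.swap[of _ _ ?K] sum.swap[of _ "{1..n}" "{..<_}"])
  also have "\<dots> = (\<Sum>k\<in>?K. \<Sum>r<d k. (v k)\<^sup>2 * (\<Sum>m\<in>{1..n}. g k r (U m \<omega>))\<^sup>2)"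
    by (simp only: sum_distrib_left[symmetric] sum_distrib_right[symmetric] power2_eq_square)
  also have "1 / real n * \<dots> = (\<Sum>k\<in>?K. \<Sum>r<d k. (v k)\<^sup>2 * ((\<Sum>m\<in>{1..n}. g k r (U m \<omega>)) / sqrt (real n))\<^sup>2)"
    unfolding sum_distrib_left power_divide by (simp add: ac_simps)
  also have "\<dots> = (\<Sum>(k, r)\<in>Sigma ?K (\<lambda>k. {..<d k}). (v k)\<^sup>2 * ((\<Sum>m\<in>{1..n}. g k r (U m \<omega>)) / sqrt (real n))\<^sup>2)"
    using fin by (subst sum.Sigma) auto
  finally show ?thesis .
qed

text \<open>The span clause is used twice: for \<open>g'\<close> against the sections of
  \<open>h\<close>, and then for \<open>g\<close> against a function of \<open>g'\<close>.\<close>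

lemma kernel_basis_orthogonal:
  assumes g: "kernel_basis M h d g" and g': "kernel_basis M h' d' g'"
    and h: "\<And>u. u \<in> space M \<Longrightarrow> bounded_measurable M (h u)"
    and orth: "\<And>u w. u \<in> space M \<Longrightarrow> w \<in> space M \<Longrightarrow> (LINT x|M. h u x * h' w x) = 0"
    and r: "r < d" and s: "s < d'"
  shows "(LINT x|M. g r x * g' s x) = 0"
proof (rule kernel_basisD(4)[OF g kernel_basisD(1)[OF g' s] _ r])
  fix u assume u: "u \<in> space M"
  have "(LINT x|M. g' s x * h u x) = 0"
    by (rule kernel_basisD(4)[OF g' h[OF u] _ s]) (use orth[OF u] in \<open>simp add: mult.commute\<close>)
  then show "(LINT x|M. h u x * g' s x) = 0" by (simp only: mult.commute)
qed

lemma harmonic_basis_orthonormal: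
  assumes p: "CARD('p::finite) \<ge> 2"
    and g: "kernel_basis (uniform_sphere :: (real ^ 'p) measure) (\<lambda>u w. poly (harm_poly CARD('p) k) (u \<bullet> w)) d g"
    and g': "kernel_basis (uniform_sphere :: (real ^ 'p) measure) (\<lambda>u w. poly (harm_poly CARD('p) l) (u \<bullet> w)) d' g'"
    and "k \<noteq> l" "r < d" "s < d'"
  shows "(LINT x|uniform_sphere. g r x * g' s x) = 0"
proof (rule kernel_basis_orthogonal[OF g g' _ _ \<open>r < d\<close> \<open>s < d'\<close>])
  fix u w :: "real ^ 'p" assume "u \<in> space uniform_sphere" "w \<in> space uniform_sphere"
  then show "(LINT x|uniform_sphere. poly (harm_poly CARD('p) k) (u \<bullet> x) * poly (harm_poly CARD('p) l) (w \<bullet> x)) = 0"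
    using sphere_form_harm_poly_orthogonal[OF p _ _ \<open>k \<noteq> l\<close>, of u w] by (simp add: sphere_form_def)
next
  fix u :: "real ^ 'p" assume "u \<in> space uniform_sphere"
  then show "bounded_measurable uniform_sphere (\<lambda>w. poly (harm_poly CARD('p) k) (u \<bullet> w))"
    using reproducing_kernel_harm_poly[OF p, of k] unfolding reproducing_kernel_def by blast
qed

text \<open>The span clause with the power of x . \<theta> as test function; the kernel sections
  annihilate it by the case of degree l = 0.\<close>

lemma harmonic_basis_power:
  fixes \<theta> :: "real ^ 'p::finite"
  assumes p: "CARD('p) \<ge> 2" and \<theta>: "norm \<theta> = 1"
    and g: "kernel_basis (uniform_sphere :: (real ^ 'p) measure) (\<lambda>u w. poly (harm_poly CARD('p) k) (u \<bullet> w)) d g"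
    and r: "r < d" and j: "j < k \<or> odd (k + j)"
  shows "(LINT x|uniform_sphere. g r x * (x \<bullet> \<theta>) ^ j) = 0"
proof (rule kernel_basisD(4)[OF g _ _ r])
  have "\<bar>(x \<bullet> \<theta>) ^ j\<bar> \<le> 1" if "x \<in> sphere 0 1" for x
    using Cauchy_Schwarz_ineq2[of x \<theta>] that \<theta> by (simp add: power_abs power_le_one)
  then show "bounded_measurable uniform_sphere (\<lambda>x. (x \<bullet> \<theta>) ^ j)"
    unfolding bounded_measurable_def space_uniform_sphere
    by (auto intro!: borel_measurable_uniform_sphere exI[of _ 1])
  fix u :: "real ^ 'p" assume "u \<in> space uniform_sphere"
  then have "norm u = 1" by simp
  from sphere_form_harm_poly_power[OF p this \<theta>, of 0 j k] j
  show "(LINT x|uniform_sphere. poly (harm_poly CARD('p) k) (u \<bullet> x) * (x \<bullet> \<theta>) ^ j) = 0"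
    by (simp add: sphere_form_def inner_commute[of _ \<theta>])
qed

lemma bounded_measurable_uniform_sphere_iff:
  "bounded_measurable uniform_sphere \<phi> \<longleftrightarrow> bounded_measurable surface_measure \<phi>"
  by (simp add: bounded_measurable_def measurable_surface_measure_eq)

section \<open>Convergence of the Sobolev statistic\<close>

theorem corollary1:
  fixes M :: "nat \<Rightarrow> 'a measure"
    and U :: "nat \<Rightarrow> nat \<Rightarrow> 'a \<Rightarrow> real ^ 'p::{finite,linorder}"
    and v :: "nat \<Rightarrow> real"
    and f :: "real \<Rightarrow> real"
    and \<tau> :: real
    and q k\<^sub>v K\<^sub>v :: nat
  assumes p: "CARD('p) \<ge> 2"
    and v_fin: "finite {k. k \<ge> 1 \<and> v k \<noteq> 0}"
    and v_nz: "{k. k \<ge> 1 \<and> v k \<noteq> 0} \<noteq> {}"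
    and kv: "k\<^sub>v = Min {k. k \<ge> 1 \<and> v k \<noteq> 0}"
    and Kv: "K\<^sub>v = Max {k. k \<ge> 1 \<and> v k \<noteq> 0}"
    and f: "angular_function f"
    and q: "q \<ge> K\<^sub>v"
    and f_diff: "times_differentiable_at q f 0"
    and parity:
      "((\<forall>k\<ge>1. even k \<longrightarrow> v k = 0) \<and> (\<forall>k\<in>{k\<^sub>v..q}. odd k \<longrightarrow> (deriv ^^ k) f 0 = 0)) \<or>
       ((\<forall>k\<ge>1. odd k \<longrightarrow> v k = 0) \<and> (\<forall>k\<in>{k\<^sub>v..q}. even k \<longrightarrow> (deriv ^^ k) f 0 = 0))"
    and \<tau>: "\<tau> > 0"
    and sample: "\<forall>\<^sub>F n in sequentially.
      rotsym_sample (M n) n (U n) (real n powr (- 1 / (2 * real q)) * \<tau>) f"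
  shows "weak_conv_m (\<lambda>n. distr (M n) borel (sobolev_stat v n (U n)))
           (weighted_chi_square {1..K\<^sub>v} (\<lambda>k. (v k)\<^sup>2) (harmonic_dim CARD('p)))"
proof -
  let ?K = "{k. k \<ge> 1 \<and> v k \<noteq> 0}" and ?\<theta> = "north_pole :: (real, 'p) vec" and ?p = "CARD('p)"
  let ?\<mu> = "uniform_sphere :: ((real, 'p) vec) measure" and ?\<sigma> = "surface_measure :: ((real, 'p) vec) measure"
  define d where "d = harmonic_dim ?p"
  define \<kappa> where "\<kappa> n = real n powr (- 1 / (2 * real q)) * \<tau>" for n
  have \<theta>: "norm ?\<theta> = 1" by (simp add: north_pole_def)
  have K: "K\<^sub>v \<ge> 1" "?K \<subseteq> {1..K\<^sub>v}" "?K \<subseteq> {k\<^sub>v..}"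
    using Max_in[OF v_fin v_nz] Max_ge[OF v_fin] Min_le[OF v_fin] by (auto simp: Kv kv)
  have q0: "q > 0" using K(1) q by simp
  have fm: "f \<in> borel_measurable borel" and f0: "f 0 = 1" and fnn: "\<And>x. f x \<ge> 0"
    using f by (auto simp: angular_function_def)
  have fcont: "isCont f 0"
  proof -
    have "f differentiable (at 0)"
    \<comment> \<open>For q = 1 differentiability is given at 0 only; for larger q it comes from a
      whole neighbourhood of 0.\<close>
    proof (cases "q = 1")
      case True
      then show ?thesis using f_diff by (simp add: times_differentiable_at_def)
    next
      case False
      then obtain q' where "q = Suc (Suc q')" using q0 by (metis One_nat_def gr0_implies_Suc not0_implies_Suc)
      then show ?thesis
        using times_differentiable_at_Suc_deriv(2)[of q' f 0] f_diff eventually_nhds_x_imp_x by blast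
    qed
    then show ?thesis by (rule differentiable_imp_continuous_within)
  qed
  have \<kappa>0: "\<kappa> \<longlonglongrightarrow> 0"
    unfolding \<kappa>_def using q0 by (intro tendsto_mult_left_zero tendsto_neg_powr filterlim_real_sequentially) simp

  have "\<forall>k\<in>?K. \<exists>g. kernel_basis ?\<mu> (\<lambda>u w. poly (harm_poly ?p k) (u \<bullet> w)) (d k) g"
    unfolding d_def using exists_harmonic_basis[OF p] by auto
  then obtain g where g: "\<And>k. k \<in> ?K \<Longrightarrow> kernel_basis ?\<mu> (\<lambda>u w. poly (harm_poly ?p k) (u \<bullet> w)) (d k) (g k)"
    using bchoice[of ?K] by metis
  define I where "I = Sigma ?K (\<lambda>k. {..<d k})"
  define G where "G = (\<lambda>(k, r). g k r)"
  define w where "w = (\<lambda>(k, r :: nat). (v k)\<^sup>2)"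
  have I: "finite I" unfolding I_def using v_fin by auto
  have G_bm: "bounded_measurable ?\<mu> (G i)" if "i \<in> I" for i
    using that kernel_basisD(1)[OF g] by (auto simp: I_def G_def)
  have G_orth: "(LINT x|?\<mu>. G i x * G j x) = (if i = j then 1 else 0)" if ij: "i \<in> I" "j \<in> I" for i j
  proof -
    obtain k r l s where kr: "i = (k, r)" "j = (l, s)" by (cases i, cases j)
    then have k: "k \<in> ?K" "l \<in> ?K" "r < d k" "s < d l" using ij by (auto simp: I_def)
    show ?thesis
    proof (cases "k = l")
      case True
      then show ?thesis using kernel_basisD(2)[OF g[OF k(1)], of r s] k kr by (simp add: G_def)
    next
      case False
      then show ?thesis
        using harmonic_basis_orthonormal[OF p g[OF k(1)] g[OF k(2)] False k(3,4)] kr by (simp add: G_def)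
    qed
  qed
  \<comment> \<open>Orders below k or of the other parity are killed by orthogonality. What remains
    has j between k and q with the parity of k, hence j >= \<open>k\<^sub>v\<close>, and there the
    parity hypothesis annihilates the derivative of f.\<close>
  have G_Taylor: "(deriv ^^ j) f 0 = 0 \<or> (LINT u|?\<mu>. G i u * (u \<bullet> ?\<theta>) ^ j) = 0" if i: "i \<in> I" and j: "j \<le> q" for i j
  proof -
    obtain k r where kr: "i = (k, r)" by (cases i)
    then have k: "k \<in> ?K" "r < d k" using i by (auto simp: I_def)
    show ?thesis
    proof (cases "j < k \<or> odd (k + j)")
      case True
      then show ?thesis using harmonic_basis_power[OF p \<theta> g[OF k(1)] k(2)] kr by (simp add: G_def)
    next
      case False
      moreover have "k \<ge> k\<^sub>v" using K(3) k(1) by auto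
      ultimately have "j \<in> {k\<^sub>v..q}" "even j = even k" using j by auto
      then show ?thesis using parity k(1) by auto
    qed
  qed

  define P where "P n = distr (M n) ?\<sigma> (U n 1)" for n
  have good: "\<forall>\<^sub>F n in sequentially. n > 0 \<and> prob_space (M n) \<and> prob_space.indep_vars (M n) (\<lambda>_. ?\<sigma>) (U n) {1..n} \<and>
      (\<forall>m\<in>{1..n}. distr (M n) ?\<sigma> (U n m) = P n) \<and> prob_space (P n) \<and>
      (\<exists>c>0. P n = density ?\<sigma> (\<lambda>u. ennreal (c * f (\<kappa> n * (u \<bullet> ?\<theta>)))))"
    using sample eventually_gt_at_top[of 0]
  proof eventually_elim
    case (elim n)
    then obtain c where c: "c > 0"
      "\<And>i. i \<in> {1..n} \<Longrightarrow> distributed (M n) ?\<sigma> (U n i) (\<lambda>u. ennreal (c * f (\<kappa> n * (u \<bullet> ?\<theta>))))"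
      unfolding rotsym_sample_def \<kappa>_def by blast
    have M: "prob_space (M n)" "prob_space.indep_vars (M n) (\<lambda>_. ?\<sigma>) (U n) {1..n}"
      using elim by (auto simp: rotsym_sample_def)
    have D: "distr (M n) ?\<sigma> (U n i) = density ?\<sigma> (\<lambda>u. ennreal (c * f (\<kappa> n * (u \<bullet> ?\<theta>))))" if "i \<in> {1..n}" for i
      using c(2)[OF that] by (rule distributed_distr_eq_density)
    have 1: "1 \<in> {1..n}" using elim by simp
    have "prob_space (P n)"
      unfolding P_def using c(2)[OF 1] by (intro prob_space.prob_space_distr[OF M(1)]) (auto simp: distributed_def)
    then show ?case using elim M D D[OF 1] c(1) by (auto simp: P_def)
  qed
  have array: "\<forall>\<^sub>F n in sequentially. prob_space (M n) \<and> prob_space.indep_vars (M n) (\<lambda>_. ?\<sigma>) (U n) {1..n} \<and>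
      (\<forall>m\<in>{1..n}. distr (M n) ?\<sigma> (U n m) = P n)"
    using good by eventually_elim blast

  define X where "X n = (LINT u|?\<mu>. f (\<kappa> n * (u \<bullet> ?\<theta>)))" for n
  interpret \<mu>: prob_space ?\<mu> by (rule prob_space_uniform_sphere)
  have X: "X \<longlonglongrightarrow> 1"
    using rotsym_expectation_limit[OF fm f0 fcont \<theta> \<kappa>0 bounded_measurable_const[of ?\<mu> 1]] \<mu>.prob_space
    by (simp add: X_def[abs_def])
  \<comment> \<open>\<open>X n\<close> is the normalising integral. It tends to 1 and is thus
    eventually positive, so expectations under the model may be written as quotients.\<close>
  have P_eq: "\<forall>\<^sub>F n in sequentially. (LINT u|?\<mu>. f (\<kappa> n * (u \<bullet> ?\<theta>)) * \<phi> u) / X n = (LINT u|P n. \<phi> u)"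
    if "bounded_measurable ?\<mu> \<phi>" for \<phi>
    using good order_tendstoD(1)[OF X zero_less_one]
  proof eventually_elim
    case (elim n)
    then obtain c where c: "c > 0" "P n = density ?\<sigma> (\<lambda>u. ennreal (c * f (\<kappa> n * (u \<bullet> ?\<theta>))))" by blast
    have "\<phi> \<in> borel_measurable ?\<sigma>"
      using that unfolding bounded_measurable_def measurable_surface_measure_eq by blast
    from rotsym_expectation[OF fm fnn c _ this] elim show ?case
      by (simp add: X_def field_simps)
  qed
  \<comment> \<open>As \<open>X\<close> tends to 1, normalisation does not affect the order of the
    mean.\<close>
  have mean: "(\<lambda>n. sqrt (real n) * (LINT u|P n. G i u)) \<longlonglongrightarrow> 0" if i: "i \<in> I" for i
  proof (rule Lim_transform_eventually)
    have "(\<lambda>n. sqrt (real n) * (LINT u|?\<mu>. f (\<kappa> n * (u \<bullet> ?\<theta>)) * G i u)) \<longlonglongrightarrow> 0"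
      unfolding \<kappa>_def by (rule rotsym_mean_limit[OF fm q0 f_diff \<theta> \<tau> G_bm[OF i] G_Taylor[OF i]])
    from tendsto_divide[OF this X]
    show "(\<lambda>n. sqrt (real n) * (LINT u|?\<mu>. f (\<kappa> n * (u \<bullet> ?\<theta>)) * G i u) / X n) \<longlonglongrightarrow> 0" by simp
    show "\<forall>\<^sub>F n in sequentially. sqrt (real n) * (LINT u|?\<mu>. f (\<kappa> n * (u \<bullet> ?\<theta>)) * G i u) / X n = sqrt (real n) * (LINT u|P n. G i u)"
      using P_eq[OF G_bm[OF i]] by eventually_elim (simp only: times_divide_eq_right[symmetric])
  qed
  have cov: "(\<lambda>n. LINT u|P n. G i u * G j u) \<longlonglongrightarrow> (if i = j then 1 else 0)" if ij: "i \<in> I" "j \<in> I" for i j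
  proof (rule Lim_transform_eventually)
    have bm: "bounded_measurable ?\<mu> (\<lambda>u. G i u * G j u)" using G_bm ij by blast
    from tendsto_divide[OF rotsym_expectation_limit[OF fm f0 fcont \<theta> \<kappa>0 bm] X]
    show "(\<lambda>n. (LINT u|?\<mu>. f (\<kappa> n * (u \<bullet> ?\<theta>)) * (G i u * G j u)) / X n) \<longlonglongrightarrow> (if i = j then 1 else 0)"
      using G_orth[OF ij] by simp
    show "\<forall>\<^sub>F n in sequentially. (LINT u|?\<mu>. f (\<kappa> n * (u \<bullet> ?\<theta>)) * (G i u * G j u)) / X n = (LINT u|P n. G i u * G j u)"
      by (rule P_eq[OF bm])
  qed

  let ?L = "\<lambda>t. LINT z|std_normal_distribution. exp (- t * z\<^sup>2)"
  define Q where "Q n \<omega> = (\<Sum>i\<in>I. w i * ((\<Sum>m\<in>{1..n}. G i (U n m \<omega>)) / sqrt (real n))\<^sup>2)" for n \<omega>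
  have Laplace: "(\<lambda>n. LINT \<omega>|M n. exp (- real s * Q n \<omega>)) \<longlonglongrightarrow> (\<Prod>i\<in>I. ?L (real s * w i))" for s :: nat
  proof -
    have "(\<lambda>n. LINT \<omega>|M n. exp (- real s * Q n \<omega>)) \<longlonglongrightarrow> (\<Prod>i\<in>I. LINT z|std_normal_distribution. exp (- real s * w i * z\<^sup>2))"
      unfolding Q_def using mean cov
      by (intro Laplace_quadratic_form[OF array I])
         (auto simp: bounded_measurable_uniform_sphere_iff[symmetric] G_bm w_def)
    then show ?thesis by simp
  qed
  let ?T = "weighted_chi_square {1..K\<^sub>v} (\<lambda>k. (v k)\<^sup>2) d"
  have limit: "(\<Prod>i\<in>I. ?L (real s * w i)) = (LINT x|?T. exp (- real s * x))" for s :: nat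
  proof -
    have "(\<Prod>i\<in>I. ?L (real s * w i)) = (\<Prod>k\<in>?K. \<Prod>r<d k. ?L (real s * (v k)\<^sup>2))"
      unfolding I_def using v_fin by (subst prod.Sigma) (auto simp: w_def intro!: prod.cong)
    also have "\<dots> = (\<Prod>k\<in>?K. ?L (real s * (v k)\<^sup>2) ^ d k)" by simp
    \<comment> \<open>A degree with zero weight contributes the integral of the constant 1, so the
      product extends to the full range of the limit law.\<close>
    also have "\<dots> = (\<Prod>k\<in>{1..K\<^sub>v}. ?L (real s * (v k)\<^sup>2) ^ d k)"
    proof (rule prod.mono_neutral_left)
      interpret N01: prob_space std_normal_distribution by (rule prob_space_std_normal)
      show "\<forall>k\<in>{1..K\<^sub>v} - ?K. ?L (real s * (v k)\<^sup>2) ^ d k = 1"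
        using N01.prob_space by auto
    qed (use K in auto)
    also have "\<dots> = (LINT x|?T. exp (- real s * x))"
      by (subst Laplace_weighted_chi_square) auto
    finally show ?thesis .
  qed

  obtain n0 where n0: "\<And>n. n \<ge> n0 \<Longrightarrow> n > 0 \<and> prob_space (M n) \<and> prob_space.indep_vars (M n) (\<lambda>_. ?\<sigma>) (U n) {1..n}"
    using good unfolding eventually_sequentially by blast
  have U_meas: "U n m \<in> M n \<rightarrow>\<^sub>M ?\<sigma>" if "n \<ge> n0" "m \<in> {1..n}" for n m
  proof -
    interpret prob_space "M n" using n0[OF that(1)] by blast
    show ?thesis using n0[OF that(1)] that(2) by (auto simp: indep_vars_def)
  qed
  \<comment> \<open>The kernel expansion is valid on the sphere only; measurability into the surface
    measure places the observations there at every point of \<open>space (M n)\<close>, which is all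
    that the image law sees.\<close>
  have stat: "sobolev_stat v n (U n) \<omega> = Q n \<omega>" if "n \<ge> n0" "\<omega> \<in> space (M n)" for n \<omega>
  proof -
    have sph: "U n m \<omega> \<in> sphere 0 1" if "m \<in> {1..n}" for m
      using measurable_space[OF U_meas[OF \<open>n \<ge> n0\<close> that] \<open>\<omega> \<in> space (M n)\<close>] by simp
    have "sobolev_stat v n (U n) \<omega> = (\<Sum>(k, r)\<in>Sigma ?K (\<lambda>k. {..<d k}).
        (v k)\<^sup>2 * ((\<Sum>m\<in>{1..n}. g k r (U n m \<omega>)) / sqrt (real n))\<^sup>2)"
      using n0[OF that(1)] by (intro sobolev_stat_eq_sum_squares p v_fin g sph) simp_all
    also have "\<dots> = Q n \<omega>"
      unfolding Q_def I_def w_def G_def by (intro sum.cong refl) (simp add: case_prod_beta)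
    finally show ?thesis .
  qed
  have Q_meas: "Q n \<in> borel_measurable (M n)" if "n \<ge> n0" for n
  proof -
    have "(\<lambda>\<omega>. G i (U n m \<omega>)) \<in> borel_measurable (M n)" if "i \<in> I" "m \<in> {1..n}" for i m
    proof (rule measurable_compose[OF U_meas[OF \<open>n \<ge> n0\<close> that(2)]])
      show "G i \<in> borel_measurable ?\<sigma>"
        using G_bm[OF that(1)] unfolding bounded_measurable_def measurable_surface_measure_eq by blast
    qed
    then show ?thesis
      unfolding Q_def[abs_def]
      by (intro borel_measurable_sum borel_measurable_times borel_measurable_power borel_measurable_divide borel_measurable_const)
  qed
  let ?D = "\<lambda>n. distr (M n) borel (sobolev_stat v n (U n))"
  have D: "?D n = distr (M n) borel (Q n)" if "n \<ge> n0" for n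
    using stat[OF that] by (intro distr_cong) auto
  \<comment> \<open>The criterion asks for real distributions at every index, which holds from
    \<open>n0\<close> on; weak convergence itself is insensitive to the shift.\<close>
  have "weak_conv_m (\<lambda>n. ?D (n + n0)) ?T"
  proof (rule weak_conv_m_Laplace)
    fix n
    have n: "n + n0 \<ge> n0" by simp
    interpret prob_space "M (n + n0)" using n0[OF n] by blast
    show "real_distribution (?D (n + n0))"
      unfolding D[OF n] by (rule real_distribution_distr[OF Q_meas[OF n]])
    show "AE x in ?D (n + n0). 0 \<le> x"
      unfolding D[OF n] by (subst AE_distr_iff[OF Q_meas[OF n]])
        (auto simp: Q_def w_def intro!: sum_nonneg)
  next
    fix s :: nat
    have "(LINT x|?D (n + n0). exp (- real s * x)) = (LINT \<omega>|M (n + n0). exp (- real s * Q (n + n0) \<omega>))" for n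
      unfolding D[of "n + n0", simplified] by (rule integral_distr[OF Q_meas]) simp_all
    then show "(\<lambda>n. LINT x|?D (n + n0). exp (- real s * x)) \<longlonglongrightarrow> (LINT x|?T. exp (- real s * x))"
      using LIMSEQ_ignore_initial_segment[OF Laplace[of s], of n0] by (simp only: limit)
  qed (simp_all add: real_distribution_weighted_chi_square AE_weighted_chi_square_nonneg)
  then have "weak_conv_m ?D ?T"
    unfolding weak_conv_m_def weak_conv_def by (blast intro: LIMSEQ_offset)
  then show ?thesis unfolding d_def .
qed


end
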